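(* Let $R=\mathbb{C}[[u,v]]$, where $u$ and $v$ are indeterminates over $\mathbb{C}$, and let $X$ be an indeterminate over $R$. Let $p_n$ denote the $n$-th prime number for $n>0$, and set $$L:=\mathbb{C}((v))[v^{1/p_1},v^{1/p_2},\dots,v^{1/p_n},\dots],$$ an infinite algebraic extension of the field $\mathbb{C}((v))$. Let $x_0=uX$, $x_1=(vx_0-1)/u$, and $$x_n=\frac{x_{n-1}^{p_{n-1}}-v}{u}\quad\text{for } n>1.$$ Let $D=R[x_0,x_1,\dots,x_n,\dots]$ and $A=R[X]\cap D$. Then the following hold. (1) $D[1/u]=R[1/u][X]$. (2) $D/uD\cong L$; in particular, $D/uD$ is not finitely generated over $R/uR$. (3) $uD$ is a maximal ideal of $D$, $uD\cap R=uR$ and $\operatorname{ht}(uD)=1$. (4) $D$ is a Noetherian UFD which is not finitely generated over $R$. (5) $A$ is a Noetherian normal domain which is faithfully flat but not finitely generated over $R$.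
   Context: The elements $x_n$ and the rings $D$, $A$ are taken inside $R[1/u][X]$. The roots $v^{1/p_n}$ are taken in a fixed algebraic closure of $\mathbb{C}((v))$. "Finitely generated over" means finitely generated as an algebra; $\operatorname{ht}$ denotes height. *)

theory Defs
  imports
    "HOL-Algebra.Algebraic_Closure_Type"
    "HOL-Algebra.Ring_Divisibility"
    "HOL-Algebra.QuotRing"
    "HOL-Algebra.Generated_Rings"
    "HOL-Algebra.Free_Abelian_Groups"
    "HOL-Algebra.Module"
    "HOL-Library.Extended_Nat"
    "HOL-Library.Infinite_Set"
begin

section \<open>General notions of commutative algebra\<close>

text \<open>A set of elements of an ambient ring type, as a ring with the ambient operations.\<close>

abbreviation ring_on :: "'a::ring_1 set \<Rightarrow> 'a ring"
  where "ring_on S \<equiv> ring_of_type_algebra \<lparr>carrier := S\<rparr>"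

definition fin_gen_algebra ::
    "('r \<Rightarrow> 's) \<Rightarrow> ('r, 'x) ring_scheme \<Rightarrow> ('s, 'y) ring_scheme \<Rightarrow> bool"
  where "fin_gen_algebra \<phi> R S \<longleftrightarrow>
    (\<exists>F. finite F \<and> F \<subseteq> carrier S \<and> carrier S = generate_ring S (\<phi> ` carrier R \<union> F))"

definition prime_height :: "('a, 'x) ring_scheme \<Rightarrow> 'a set \<Rightarrow> enat"
  where "prime_height R P =
    Sup {enat n | n. \<exists>Q. (\<forall>i\<le>n. primeideal (Q i) R) \<and> (\<forall>i<n. Q i \<subset> Q (Suc i)) \<and> Q n = P}"

text \<open>For a subring \<open>S\<close> of an integral domain type, the fraction field of \<open>S\<close> is realised
  inside the fraction field of the ambient type.\<close>

definition frac_field_of :: "'a::idom set \<Rightarrow> 'a fract set"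
  where "frac_field_of S = {Fract a b | a b. a \<in> S \<and> b \<in> S \<and> b \<noteq> 0}"

definition integral_over :: "'a::idom set \<Rightarrow> 'a fract \<Rightarrow> bool"
  where "integral_over S z \<longleftrightarrow>
    (\<exists>p. (\<forall>i. Polynomial.coeff p i \<in> S) \<and> Polynomial.lead_coeff p = 1 \<and>
         poly (map_poly to_fract p) z = 0)"

definition normal_domain :: "'a::idom set \<Rightarrow> bool"
  where "normal_domain S \<longleftrightarrow> domain (ring_on S) \<and>
    (\<forall>z \<in> frac_field_of S. integral_over S z \<longrightarrow> z \<in> to_fract ` S)"


section \<open>Tensor products and faithful flatness\<close>

definition module_homs ::
    "('r, 'x) ring_scheme \<Rightarrow> ('r, 'm, 'y) module_scheme \<Rightarrow> ('r, 'n, 'z) module_scheme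
      \<Rightarrow> ('m \<Rightarrow> 'n) set"
  where "module_homs R M N = {h. h \<in> carrier M \<rightarrow> carrier N \<and>
    (\<forall>x\<in>carrier M. \<forall>y\<in>carrier M. h (x \<oplus>\<^bsub>M\<^esub> y) = h x \<oplus>\<^bsub>N\<^esub> h y) \<and>
    (\<forall>r\<in>carrier R. \<forall>x\<in>carrier M. h (r \<odot>\<^bsub>M\<^esub> x) = r \<odot>\<^bsub>N\<^esub> h x)}"

abbreviation tensor_free ::
    "('r, 'm, 'y) module_scheme \<Rightarrow> ('r, 'n, 'z) module_scheme \<Rightarrow> ('m \<times> 'n \<Rightarrow>\<^sub>0 int) monoid"
  where "tensor_free M N \<equiv> free_Abelian_group (carrier M \<times> carrier N)"

definition tensor_rel ::
    "('r, 'x) ring_scheme \<Rightarrow> ('r, 'm, 'y) module_scheme \<Rightarrow> ('r, 'n, 'z) module_scheme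
      \<Rightarrow> ('m \<times> 'n \<Rightarrow>\<^sub>0 int) set"
  where "tensor_rel R M N = generate (tensor_free M N)
    ({frag_of (x \<oplus>\<^bsub>M\<^esub> x', y) - frag_of (x, y) - frag_of (x', y) | x x' y.
        x \<in> carrier M \<and> x' \<in> carrier M \<and> y \<in> carrier N} \<union>
     {frag_of (x, y \<oplus>\<^bsub>N\<^esub> y') - frag_of (x, y) - frag_of (x, y') | x y y'.
        x \<in> carrier M \<and> y \<in> carrier N \<and> y' \<in> carrier N} \<union>
     {frag_of (r \<odot>\<^bsub>M\<^esub> x, y) - frag_of (x, r \<odot>\<^bsub>N\<^esub> y) | r x y.
        r \<in> carrier R \<and> x \<in> carrier M \<and> y \<in> carrier N})"

text \<open>Only the additive group of \<open>M \<otimes>\<^sub>R N\<close> is constructed, since exactness does not involve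
  the scalar action.\<close>

definition tensor_product ::
    "('r, 'x) ring_scheme \<Rightarrow> ('r, 'm, 'y) module_scheme \<Rightarrow> ('r, 'n, 'z) module_scheme
      \<Rightarrow> ('m \<times> 'n \<Rightarrow>\<^sub>0 int) set monoid"
  where "tensor_product R M N = tensor_free M N Mod tensor_rel R M N"

text \<open>The map \<open>h \<otimes> id : M \<otimes>\<^sub>R N \<rightarrow> M' \<otimes>\<^sub>R N\<close>. See \<open>tensor_map_coset\<close> below: the union is
  a single coset when \<open>h\<close> is linear.\<close>

definition tensor_map ::
    "('r, 'x) ring_scheme \<Rightarrow> ('r, 'm2, 'y) module_scheme \<Rightarrow> ('r, 'n, 'z) module_scheme
      \<Rightarrow> ('m1 \<Rightarrow> 'm2) \<Rightarrow> ('m1 \<times> 'n \<Rightarrow>\<^sub>0 int) set \<Rightarrow> ('m2 \<times> 'n \<Rightarrow>\<^sub>0 int) set"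
  where "tensor_map R M' N h C =
    (\<Union>c\<in>C. tensor_rel R M' N #>\<^bsub>tensor_free M' N\<^esub>
       frag_extend (\<lambda>(x, y). frag_of (h x, y)) c)"

lemma tensor_map_coset:
  fixes R :: "('r, 'x) ring_scheme" and M :: "('r, 'm1, 'y1) module_scheme"
    and M' :: "('r, 'm2, 'y2) module_scheme" and N :: "('r, 'n, 'z) module_scheme"
  assumes M: "module R M" and N: "module R N" and h: "h \<in> module_homs R M M'"
  shows "tensor_map R M' N h (tensor_rel R M N #>\<^bsub>tensor_free M N\<^esub> c) =
    tensor_rel R M' N #>\<^bsub>tensor_free M' N\<^esub> frag_extend (\<lambda>(x, y). frag_of (h x, y)) c"
proof -
  let ?F = "frag_extend (\<lambda>(x, y). frag_of (h x, y))"
  let ?K = "tensor_rel R M N" and ?K' = "tensor_rel R M' N"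
  interpret M: module R M by (fact M)
  interpret N: module R N by (fact N)
  have h_carr: "h x \<in> carrier M'" if "x \<in> carrier M" for x
    using h that by (auto simp: module_homs_def)
  have h_add: "h (x \<oplus>\<^bsub>M\<^esub> y) = h x \<oplus>\<^bsub>M'\<^esub> h y" if "x \<in> carrier M" "y \<in> carrier M" for x y
    using h that by (auto simp: module_homs_def)
  have h_smult: "h (r \<odot>\<^bsub>M\<^esub> x) = r \<odot>\<^bsub>M'\<^esub> h x" if "r \<in> carrier R" "x \<in> carrier M" for r x
    using h that by (auto simp: module_homs_def)
  let ?gens = "\<lambda>M. {frag_of (x \<oplus>\<^bsub>M\<^esub> x', y) - frag_of (x, y) - frag_of (x', y) | x x' y.
        x \<in> carrier M \<and> x' \<in> carrier M \<and> y \<in> carrier N} \<union>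
     {frag_of (x, y \<oplus>\<^bsub>N\<^esub> y') - frag_of (x, y) - frag_of (x, y') | x y y'.
        x \<in> carrier M \<and> y \<in> carrier N \<and> y' \<in> carrier N} \<union>
     {frag_of (r \<odot>\<^bsub>M\<^esub> x, y) - frag_of (x, r \<odot>\<^bsub>N\<^esub> y) | r x y.
        r \<in> carrier R \<and> x \<in> carrier M \<and> y \<in> carrier N}"
  have F_gens: "?F g \<in> ?gens M'" if "g \<in> ?gens M" for g
    using that
    apply (elim UnE CollectE exE conjE)
      apply (rule UnI1, rule UnI1, rule CollectI)
      apply (simp add: frag_extend_diff h_add)
      apply (metis h_carr)
     apply (rule UnI1, rule UnI2, rule CollectI)
     apply (simp add: frag_extend_diff)
     apply (metis h_carr)
    apply (rule UnI2, rule CollectI)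
    apply (simp add: frag_extend_diff h_smult)
    apply (metis h_carr)
    done
  have neg_K': "- a \<in> ?K'" if "a \<in> ?gens M'" "Poly_Mapping.keys a \<subseteq> carrier M' \<times> carrier N" for a
    using generate.inv[OF that(1), of "tensor_free M' N"] that(2) unfolding tensor_rel_def by simp
  have F_keys: "Poly_Mapping.keys (?F a) \<subseteq> carrier M' \<times> carrier N"
    if a: "Poly_Mapping.keys a \<subseteq> carrier M \<times> carrier N" for a
  proof -
    have "Poly_Mapping.keys (?F a) \<subseteq>
        (\<Union>x\<in>Poly_Mapping.keys a. Poly_Mapping.keys (case x of (x, y) \<Rightarrow> frag_of (h x, y)))"
      by (rule keys_frag_extend)
    also have "\<dots> \<subseteq> carrier M' \<times> carrier N"
    proof (rule UN_least)
      fix p assume "p \<in> Poly_Mapping.keys a"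
      then obtain x y where p: "p = (x, y)" "x \<in> carrier M" "y \<in> carrier N"
        using a by auto
      then show "Poly_Mapping.keys (case p of (x, y) \<Rightarrow> frag_of (h x, y)) \<subseteq> carrier M' \<times> carrier N"
        using h_carr[of x] by simp
    qed
    finally show ?thesis .
  qed
  have gens_keys: "Poly_Mapping.keys g \<subseteq> carrier M \<times> carrier N" if "g \<in> ?gens M" for g
  proof -
    have diff: "Poly_Mapping.keys (a - b) \<subseteq> carrier M \<times> carrier N"
      if "Poly_Mapping.keys a \<subseteq> carrier M \<times> carrier N" "Poly_Mapping.keys b \<subseteq> carrier M \<times> carrier N"
      for a b :: "'m1 \<times> 'n \<Rightarrow>\<^sub>0 int"
      using keys_diff[of a b] that by blast
    show ?thesis
      using that by (elim UnE CollectE exE conjE; hypsubst; intro diff; simp)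
  qed
  have add_K': "a + b \<in> ?K'" if "a \<in> ?K'" "b \<in> ?K'" for a b
    using generate.eng[OF that[unfolded tensor_rel_def]] unfolding tensor_rel_def by simp
  have zero_K: "0 \<in> ?K"
    using generate.one[of "tensor_free M N"] unfolding tensor_rel_def by simp
  have F_K: "?F k \<in> ?K'" if "k \<in> ?K" for k
    using that[unfolded tensor_rel_def]
  proof (induction rule: generate.induct)
    case one
    show ?case using generate.one[of "tensor_free M' N"] unfolding tensor_rel_def by simp
  next
    case (incl g)
    show ?case unfolding tensor_rel_def by (rule generate.incl[OF F_gens[OF incl]])
  next
    case (inv g)
    have "- ?F g \<in> ?K'"
      by (rule neg_K'[OF F_gens[OF inv] F_keys[OF gens_keys[OF inv]]])
    then show ?case using gens_keys[OF inv] by (simp add: frag_extend_minus)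
  next
    case (eng a b)
    then show ?case by (simp add: frag_extend_add add_K')
  qed
  have "tensor_map R M' N h (?K #>\<^bsub>tensor_free M N\<^esub> c) =
      {k' + ?F (k + c) | k k'. k \<in> ?K \<and> k' \<in> ?K'}"
    unfolding tensor_map_def r_coset_def by auto
  also have "\<dots> = {k' + ?F c | k'. k' \<in> ?K'}"
  proof (intro equalityI subsetI)
    fix z assume "z \<in> {k' + ?F (k + c) | k k'. k \<in> ?K \<and> k' \<in> ?K'}"
    then obtain k k' where "k \<in> ?K" "k' \<in> ?K'" "z = (k' + ?F k) + ?F c"
      by (auto simp: frag_extend_add add.assoc)
    then show "z \<in> {k' + ?F c | k'. k' \<in> ?K'}"
      using add_K' F_K by blast
  next
    fix z assume "z \<in> {k' + ?F c | k'. k' \<in> ?K'}"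
    then obtain k' where "k' \<in> ?K'" "z = k' + ?F (0 + c)" by auto
    then show "z \<in> {k' + ?F (k + c) | k k'. k \<in> ?K \<and> k' \<in> ?K'}"
      using zero_K by blast
  qed
  also have "\<dots> = ?K' #>\<^bsub>tensor_free M' N\<^esub> ?F c"
    unfolding r_coset_def by auto
  finally show ?thesis .
qed

definition exact_pair ::
    "('a, 'x) monoid_scheme \<Rightarrow> ('a \<Rightarrow> 'b) \<Rightarrow> ('b, 'y) monoid_scheme \<Rightarrow> ('b \<Rightarrow> 'c)
      \<Rightarrow> ('c, 'z) monoid_scheme \<Rightarrow> bool"
  where "exact_pair G f H g K \<longleftrightarrow> f ` carrier G = kernel H K g"

text \<open>\<open>M\<close> is faithfully flat if a sequence of \<open>R\<close>-modules \<open>N1 \<rightarrow> N2 \<rightarrow> N3\<close> is exact iff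
  its tensor product with \<open>M\<close> is. HOL cannot quantify over types inside a formula, so the type
  \<open>'n\<close> carrying the test modules is a parameter; a statement about all modules is obtained by
  leaving \<open>'n\<close> a free type variable of the theorem. One type suffices for three modules, since
  arbitrary ones can be transported into a common sum type.\<close>

definition faithfully_flat ::
    "'n itself \<Rightarrow> ('r, 'x) ring_scheme \<Rightarrow> ('r, 'm, 'y) module_scheme \<Rightarrow> bool"
  where "faithfully_flat T R M \<longleftrightarrow> module R M \<and>
    (\<forall>(N1 :: ('r, 'n) module) (N2 :: ('r, 'n) module) (N3 :: ('r, 'n) module) f g.
       module R N1 \<longrightarrow> module R N2 \<longrightarrow> module R N3 \<longrightarrow>
       f \<in> module_homs R N1 N2 \<longrightarrow> g \<in> module_homs R N2 N3 \<longrightarrow>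
       (exact_pair (add_monoid N1) f (add_monoid N2) g (add_monoid N3) \<longleftrightarrow>
        exact_pair (tensor_product R N1 M) (tensor_map R N2 M f) (tensor_product R N2 M)
          (tensor_map R N3 M g) (tensor_product R N3 M)))"

text \<open>A subset \<open>S\<close> of a ring type, as a module over its subrings.\<close>

definition module_on :: "'a::ring_1 set \<Rightarrow> ('a, 'a) module"
  where "module_on S = \<lparr>carrier = S, monoid.mult = (*), one = 1, ring.zero = 0, add = (+), module.smult = (*)\<rparr>"


section \<open>The rings of the construction\<close>

text \<open>\<open>\<complex>[[u,v]]\<close> is \<open>complex fps fps\<close>, that is \<open>\<complex>[[v]][[u]]\<close>: the outer variable is \<open>u\<close>, the
  inner one \<open>v\<close>. Everything takes place in \<open>K[X]\<close> with \<open>K\<close> the fraction field of \<open>\<complex>[[u,v]]\<close>;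
  \<open>R_ring\<close> is the set of constant polynomials coming from \<open>\<complex>[[u,v]]\<close>.\<close>

type_synonym power_series_uv = "complex fps fps"
type_synonym ambient = "power_series_uv fract poly"

definition series_u :: power_series_uv
  where "series_u = fps_X"

definition series_v :: power_series_uv
  where "series_v = fps_const fps_X"

definition const_of :: "power_series_uv \<Rightarrow> ambient"
  where "const_of r = [:to_fract r:]"

definition u_el :: ambient
  where "u_el = const_of series_u"

definition v_el :: ambient
  where "v_el = const_of series_v"

definition u_inv :: ambient
  where "u_inv = [:inverse (to_fract series_u):]"

definition R_ring :: "ambient set"
  where "R_ring = range const_of"

definition polys_over :: "'a::zero set \<Rightarrow> 'a poly set"
  where "polys_over S = {p. \<forall>i. Polynomial.coeff p i \<in> S}"

definition R_X :: "ambient set"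
  where "R_X = polys_over (range to_fract)"

definition R_inv_u_X :: "ambient set"
  where "R_inv_u_X = polys_over
    (generate_ring ring_of_type_algebra (range to_fract \<union> {inverse (to_fract series_u)}))"

text \<open>The \<open>n\<close>-th prime, counted from \<open>n = 1\<close>; the value at \<open>0\<close> is never used.\<close>

definition nth_prime :: "nat \<Rightarrow> nat"
  where "nth_prime n = enumerate {p::nat. normalization_semidom_class.prime p} (n - 1)"

fun x_seq :: "nat \<Rightarrow> ambient" where
  "x_seq 0 = u_el * [:0, 1:]"
| "x_seq (Suc 0) = u_inv * (v_el * x_seq 0 - 1)"
| "x_seq (Suc (Suc n)) = u_inv * (x_seq (Suc n) ^ nth_prime (Suc n) - v_el)"

definition D_ring :: "ambient set"
  where "D_ring = generate_ring ring_of_type_algebra (R_ring \<union> range x_seq)"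

definition D_inv_u :: "ambient set"
  where "D_inv_u = generate_ring ring_of_type_algebra (D_ring \<union> {u_inv})"

definition A_ring :: "ambient set"
  where "A_ring = R_X \<inter> D_ring"

abbreviation uR :: "ambient set"
  where "uR \<equiv> PIdl\<^bsub>ring_on R_ring\<^esub> u_el"

abbreviation uD :: "ambient set"
  where "uD \<equiv> PIdl\<^bsub>ring_on D_ring\<^esub> u_el"

text \<open>The canonical map \<open>R/uR \<rightarrow> D/uD\<close>, \<open>r + uR \<mapsto> r + uD\<close>.\<close>

definition quot_map :: "ambient set \<Rightarrow> ambient set"
  where "quot_map C = uD <+>\<^bsub>ring_on D_ring\<^esub> C"

lemma quot_map_coset:
  assumes "r \<in> R_ring"
  shows "quot_map (uR +>\<^bsub>ring_on R_ring\<^esub> r) = uD +>\<^bsub>ring_on D_ring\<^esub> r"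
proof -
  have RD: "R_ring \<subseteq> D_ring"
    unfolding D_ring_def by (auto intro: generate_ring.incl)
  have D_add: "a + b \<in> D_ring" if "a \<in> D_ring" "b \<in> D_ring" for a b
    using that generate_ring.eng_add[of a ring_of_type_algebra _ b]
    unfolding D_ring_def by (simp add: ring_of_type_algebra_def)
  have R0: "0 \<in> R_ring"
    unfolding R_ring_def const_of_def by (rule range_eqI[of _ _ 0]) simp
  have "quot_map (uR +>\<^bsub>ring_on R_ring\<^esub> r) =
      {d * u_el + (a * u_el + r) | d a. d \<in> D_ring \<and> a \<in> R_ring}"
    unfolding quot_map_def cgenideal_def set_add_def' a_r_coset_def'
    by (auto simp: ring_of_type_algebra_def)
  also have "\<dots> = {d * u_el + r | d. d \<in> D_ring}"
  proof (intro equalityI subsetI)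
    fix z assume "z \<in> {d * u_el + (a * u_el + r) | d a. d \<in> D_ring \<and> a \<in> R_ring}"
    then obtain d a where "d \<in> D_ring" "a \<in> R_ring" "z = d * u_el + (a * u_el + r)"
      by blast
    then have "d + a \<in> D_ring" "z = (d + a) * u_el + r"
      using D_add RD by (auto simp: algebra_simps)
    then show "z \<in> {d * u_el + r | d. d \<in> D_ring}" by blast
  next
    fix z assume "z \<in> {d * u_el + r | d. d \<in> D_ring}"
    then obtain d where "d \<in> D_ring" "z = d * u_el + (0 * u_el + r)" by auto
    then show "z \<in> {d * u_el + (a * u_el + r) | d a. d \<in> D_ring \<and> a \<in> R_ring}"
      using R0 by blast
  qed
  also have "\<dots> = uD +>\<^bsub>ring_on D_ring\<^esub> r"
    unfolding cgenideal_def a_r_coset_def' by (auto simp: ring_of_type_algebra_def)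
  finally show ?thesis .
qed

text \<open>\<open>L\<close>, for a choice \<open>\<rho> n\<close> of the roots \<open>v\<^sup>1\<^sup>/\<^sup>p\<close> with \<open>p\<close> the \<open>n\<close>-th prime.\<close>

definition L_field :: "(nat \<Rightarrow> complex fls alg_closure) \<Rightarrow> complex fls alg_closure set"
  where "L_field \<rho> = generate_ring ring_of_type_algebra (range to_ac \<union> \<rho> ` {n. n > 0})"

end

theory Submission
  imports Defs
begin

text \<open>Write \<open>K\<close> for the fraction field of \<open>R = \<complex>[[u,v]]\<close> and \<open>p\<^sub>n\<close> for the \<open>n\<close>-th prime. The proof rests on the
  relations \<open>v x\<^sub>0 = 1 + u x\<^sub>1\<close> and \<open>x\<^sub>n\<^sup>p = v + u x\<^sub>n\<^sub>+\<^sub>1\<close> with \<open>p = p\<^sub>n\<close>, and on one basis. Expand \<open>k\<close> in the mixed radix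
  system with radices \<open>p\<^sub>1\<close>, \<open>p\<^sub>2\<close>, and so on, and let \<open>b\<^sub>k\<close> be the monomial in \<open>x\<^sub>1\<close>, \<open>x\<^sub>2\<close>, \<open>\<dots>\<close> whose exponents are the
  digits of \<open>k\<close>. Then \<open>b\<^sub>k\<close> has degree \<open>k\<close> in \<open>X\<close>, the \<open>b\<^sub>k\<close> form a basis of the \<open>R\<close>-module \<open>R[x\<^sub>1, x\<^sub>2, \<dots>]\<close>,
  and every element of \<open>D\<close> lies in this module after multiplication by a power of \<open>v\<close>. In particular
  \<open>D\<close> is \<open>u\<close>-adically separated (\<open>D_ring_separated\<close>).

  The homomorphism from \<open>D\<close> to \<open>L\<close> with \<open>u \<mapsto> 0\<close>, \<open>x\<^sub>0 \<mapsto> 1/v\<close> and \<open>x\<^sub>n \<mapsto> \<rho>\<^sub>n = v\<^sup>1\<^sup>/\<^sup>p\<close> is well defined because a carry in the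
  mixed radix system is compatible with the relations modulo \<open>u\<close> (\<open>paired_mult_x\<close>). Its kernel is \<open>uD\<close>
  (\<open>to_L_kernel\<close>) because the images of the \<open>b\<^sub>k\<close> are linearly independent over \<open>\<complex>((v))\<close>; this comes from the
  irreducibility of \<open>T\<^sup>N - v\<close>, read off from the substitution \<open>v \<mapsto> t\<^sup>N\<close>. So \<open>D/uD\<close> is the field \<open>L\<close>, which is
  not finitely generated over \<open>\<complex>((v))\<close> since finitely many elements only involve finitely many
  primes. With separatedness this also gives height 1 for \<open>uD\<close>.

  The ring \<open>R\<close> is noetherian and factorial by a weak form of Weierstrass division, and \<open>R[X]\<close> inherits
  both properties by Hilbert's basis theorem and by Nagata's criterion (\<open>ufd_on_Nagata\<close>) applied to
  \<open>R[X] \<subseteq> K[X]\<close>. Since \<open>D[1/u] = R[1/u][X]\<close> and \<open>u\<close> is a prime element of \<open>D\<close>, Nagata's criterion shows that \<open>D\<close>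
  is factorial. An ideal of \<open>D\<close> other than \<open>0\<close> has the form \<open>u\<^sup>kJ\<close> with \<open>J\<close> not contained in \<open>uD\<close>; then \<open>u\<close> is
  invertible modulo an element of \<open>J\<close>, and \<open>J\<close> is finitely generated because it is so after
  inverting \<open>u\<close>.

  For \<open>A\<close>, the elements \<open>a = - u x\<^sub>1\<close> and \<open>b = v x\<^sub>0\<close> satisfy \<open>a + b = 1\<close>, and \<open>A[1/a] = R[X][1/a]\<close> whereas
  \<open>A[1/b] = D[1/b]\<close>. Hence \<open>A\<close> is noetherian and maps onto \<open>D/uD\<close>, so that it is not finitely generated; it is
  normal as an intersection of two factorial rings. It is flat because \<open>R[X]\<close> is a free \<open>R\<close>-module and
  \<open>D[1/v]\<close> is a free \<open>R[1/v]\<close>-module, and faithfully flat because the constant coefficient is a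
  retraction of \<open>R \<subseteq> A\<close>. In \<open>faithfully_flat_criterion\<close> this is expressed by functionals \<open>A \<rightarrow> R\<close> that are
  linear and represent the identity of \<open>A\<close> up to finitely many terms of a sequence.\<close>

section \<open>Subrings, ideals and factorisation inside an ambient ring\<close>

text \<open>Subrings are subsets of a ring type. This allows rings that are not types, such as \<open>D\<close> and \<open>A\<close>, to be
  treated with the type class operations and compared inside their common ambient ring.\<close>

definition subring_on :: "'a::comm_ring_1 set \<Rightarrow> bool"
  where "subring_on S \<longleftrightarrow> 1 \<in> S \<and> (\<forall>a\<in>S. \<forall>b\<in>S. a - b \<in> S \<and> a * b \<in> S)"

lemma subring_onI:
  assumes "1 \<in> S" "\<And>a b. a \<in> S \<Longrightarrow> b \<in> S \<Longrightarrow> a - b \<in> S"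
    "\<And>a b. a \<in> S \<Longrightarrow> b \<in> S \<Longrightarrow> a * b \<in> S"
  shows "subring_on S"
  using assms by (auto simp: subring_on_def)

context
  fixes S :: "'a::comm_ring_1 set"
  assumes S: "subring_on S"
begin

lemma subring_on_1: "1 \<in> S" and subring_on_diff: "a \<in> S \<Longrightarrow> b \<in> S \<Longrightarrow> a - b \<in> S"
  and subring_on_mult: "a \<in> S \<Longrightarrow> b \<in> S \<Longrightarrow> a * b \<in> S"
  using S by (auto simp: subring_on_def)

lemma subring_on_0: "0 \<in> S"
  using subring_on_diff[OF subring_on_1 subring_on_1] by simp

lemma subring_on_uminus: "a \<in> S \<Longrightarrow> - a \<in> S"
  using subring_on_diff[OF subring_on_0, of a] by simp

lemma subring_on_add: "a \<in> S \<Longrightarrow> b \<in> S \<Longrightarrow> a + b \<in> S"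
  using subring_on_diff[of a "- b"] subring_on_uminus[of b] by simp

lemma subring_on_power: "a \<in> S \<Longrightarrow> a ^ n \<in> S"
  by (induction n) (auto simp: subring_on_1 subring_on_mult)

lemma subring_on_sum: "(\<And>i. i \<in> I \<Longrightarrow> f i \<in> S) \<Longrightarrow> sum f I \<in> S"
  by (induction I rule: infinite_finite_induct) (auto simp: subring_on_0 subring_on_add)

lemmas subring_on_closed = subring_on_1 subring_on_0 subring_on_add subring_on_diff
  subring_on_uminus subring_on_mult subring_on_power

end

lemma subring_on_UNIV: "subring_on UNIV"
  by (simp add: subring_on_def)

lemma subring_on_denominators:
  assumes C: "subring_on C" and s: "s \<in> C"
  shows "subring_on {y. \<exists>k. s ^ k * y \<in> C}"
proof (rule subring_onI)
  note cl = subring_on_closed[OF C] and sk = subring_on_power[OF C s]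
  have "s ^ 0 * 1 \<in> C" using cl(1) by simp
  then show "1 \<in> {y. \<exists>k. s ^ k * y \<in> C}" by blast
  fix a b assume "a \<in> {y. \<exists>k. s ^ k * y \<in> C}" "b \<in> {y. \<exists>k. s ^ k * y \<in> C}"
  then obtain k l where kl: "s ^ k * a \<in> C" "s ^ l * b \<in> C" by blast
  have "s ^ (k + l) * (a - b) = s ^ l * (s ^ k * a) - s ^ k * (s ^ l * b)"
    by (simp add: power_add algebra_simps)
  also have "\<dots> \<in> C" by (intro cl(4) cl(6) kl sk)
  finally show "a - b \<in> {y. \<exists>k. s ^ k * y \<in> C}" by blast
  have "s ^ (k + l) * (a * b) = (s ^ k * a) * (s ^ l * b)" by (simp add: power_add algebra_simps)
  also have "\<dots> \<in> C" by (intro cl(6) kl)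
  finally show "a * b \<in> {y. \<exists>k. s ^ k * y \<in> C}" by blast
qed

lemma type_algebra_simps [simp]:
  "\<one>\<^bsub>ring_of_type_algebra\<^esub> = (1::'a::ring_1)" "\<zero>\<^bsub>ring_of_type_algebra\<^esub> = (0::'a)"
  "x \<oplus>\<^bsub>ring_of_type_algebra\<^esub> y = x + (y::'a)" "x \<otimes>\<^bsub>ring_of_type_algebra\<^esub> y = x * (y::'a)"
  by (simp_all add: ring_of_type_algebra_def)

lemma cring_ring_on:
  assumes S: "subring_on S"
  shows "cring (ring_on S)"
proof -
  note cl = subring_on_closed[OF S]
  have "\<exists>y\<in>S. x + y = 0" if "x \<in> S" for x
    using cl(5)[OF that] by (intro bexI[of _ "- x"]) auto
  then show ?thesis
    using cl by unfold_locales (auto simp: algebra_simps Units_def)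
qed

lemma ring_ring_on: "subring_on S \<Longrightarrow> ring (ring_on S)"
  using cring_ring_on cring.axioms(1) by blast

lemma domain_ring_on:
  fixes S :: "'a::idom set"
  assumes "subring_on S"
  shows "domain (ring_on S)"
  using cring_ring_on[OF assms] unfolding domain_def domain_axioms_def
  by (auto simp: ring_of_type_algebra_def)

lemma a_inv_ring_on:
  assumes S: "subring_on S" and "x \<in> S"
  shows "\<ominus>\<^bsub>ring_on S\<^esub> x = - x"
proof -
  interpret cring "ring_on S" by (rule cring_ring_on[OF S])
  show ?thesis
    using minus_equality[of "- x" x] subring_on_uminus[OF S] assms(2) by simp
qed

lemma a_inv_type_algebra: "\<ominus>\<^bsub>ring_of_type_algebra\<^esub> (x::'a::comm_ring_1) = - x"
proof -
  interpret R: ring "ring_of_type_algebra :: 'a ring" by (rule ring_from_type_algebra)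
  show ?thesis
    using R.minus_equality[of "- x" x] by (simp add: ring_of_type_algebra_def)
qed

lemma subring_on_generate_ring:
  "subring_on (generate_ring ring_of_type_algebra (H :: 'a::comm_ring_1 set))"
proof (rule subring_onI)
  let ?G = "generate_ring ring_of_type_algebra H"
  show "1 \<in> ?G"
    using generate_ring.one[of ring_of_type_algebra H] by (simp add: ring_of_type_algebra_def)
  show "a * b \<in> ?G" if "a \<in> ?G" "b \<in> ?G" for a b
    using generate_ring.eng_mult[OF that] by (simp add: ring_of_type_algebra_def)
  show "a - b \<in> ?G" if "a \<in> ?G" "b \<in> ?G" for a b
    using generate_ring.eng_add[OF that(1) generate_ring.a_inv[OF that(2)]]
    by (simp add: a_inv_type_algebra)
qed

lemma generate_ring_least:
  fixes H :: "'a::comm_ring_1 set"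
  assumes "subring_on S" "H \<subseteq> S"
  shows "generate_ring ring_of_type_algebra H \<subseteq> S"
proof
  note cl = subring_on_closed[OF assms(1)]
  fix x assume "x \<in> generate_ring ring_of_type_algebra H"
  then show "x \<in> S"
  proof (induction rule: generate_ring.induct)
    case (a_inv h)
    then show ?case by (simp add: a_inv_type_algebra cl)
  qed (use assms cl in \<open>auto simp: ring_of_type_algebra_def\<close>)
qed

lemma generate_ring_on_least:
  fixes H :: "'a::comm_ring_1 set"
  assumes S: "subring_on S" and V: "subring_on V" and "H \<subseteq> V" "H \<subseteq> S"
  shows "generate_ring (ring_on S) H \<subseteq> V"
proof
  note cl = subring_on_closed[OF V]
  fix x assume "x \<in> generate_ring (ring_on S) H"
  then have "x \<in> V \<and> x \<in> S"
  proof (induction rule: generate_ring.induct)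
    case (a_inv h)
    then show ?case by (simp add: a_inv_ring_on[OF S] cl subring_on_uminus[OF S])
  qed (use assms cl subring_on_closed[OF S] in auto)
  then show "x \<in> V" ..
qed

text \<open>Ideals of the subring \<open>S\<close>, phrased with the ambient operations.\<close>

definition ideal_on :: "'a::comm_ring_1 set \<Rightarrow> 'a set \<Rightarrow> bool"
  where "ideal_on S I \<longleftrightarrow> I \<subseteq> S \<and> 0 \<in> I \<and> (\<forall>a\<in>I. \<forall>b\<in>I. a + b \<in> I) \<and> (\<forall>s\<in>S. \<forall>a\<in>I. s * a \<in> I)"

lemma ideal_onI:
  assumes "I \<subseteq> S" "0 \<in> I" "\<And>a b. a \<in> I \<Longrightarrow> b \<in> I \<Longrightarrow> a + b \<in> I"
    "\<And>s a. s \<in> S \<Longrightarrow> a \<in> I \<Longrightarrow> s * a \<in> I"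
  shows "ideal_on S I"
  using assms by (auto simp: ideal_on_def)

lemma ideal_onD:
  assumes "ideal_on S I"
  shows "I \<subseteq> S" "0 \<in> I" "a \<in> I \<Longrightarrow> b \<in> I \<Longrightarrow> a + b \<in> I" "s \<in> S \<Longrightarrow> a \<in> I \<Longrightarrow> s * a \<in> I"
    "s \<in> S \<Longrightarrow> a \<in> I \<Longrightarrow> a * s \<in> I"
  using assms by (auto simp: ideal_on_def mult.commute)

lemma ideal_on_diff:
  assumes "ideal_on S I" "subring_on S" "a \<in> I" "b \<in> I"
  shows "a - b \<in> I"
  using ideal_onD(3)[OF assms(1,3), of "(-1) * b"] ideal_onD(4)[OF assms(1) _ assms(4), of "-1"]
    subring_on_closed[OF assms(2)] by simp

lemma ideal_ring_on_iff:
  assumes S: "subring_on S"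
  shows "ideal I (ring_on S) \<longleftrightarrow> ideal_on S I"
proof
  assume "ideal I (ring_on S)"
  then interpret ideal I "ring_on S" .
  show "ideal_on S I"
    using a_subset additive_subgroup.zero_closed[OF is_additive_subgroup]
      additive_subgroup.a_closed[OF is_additive_subgroup] I_l_closed
    by (intro ideal_onI) auto
next
  assume I: "ideal_on S I"
  interpret R: cring "ring_on S" by (rule cring_ring_on[OF S])
  have inv: "\<ominus>\<^bsub>ring_on S\<^esub> x \<in> I" if "x \<in> I" for x
    using ideal_on_diff[OF I S ideal_onD(2)[OF I] that] ideal_onD(1)[OF I] that
    by (auto simp: a_inv_ring_on[OF S])
  show "ideal I (ring_on S)"
  proof (rule idealI[OF R.ring_axioms])
    show "subgroup I (add_monoid (ring_on S))"
    proof (rule group.subgroupI)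
      show "Group.group (add_monoid (ring_on S))" by (rule R.a_group)
      show "inv\<^bsub>add_monoid (ring_on S)\<^esub> a \<in> I" if "a \<in> I" for a
        using inv[OF that] unfolding a_inv_def .
    qed (use ideal_onD[OF I] in \<open>auto simp: ring_of_type_algebra_def\<close>)
  qed (use ideal_onD[OF I] in auto)
qed

text \<open>Finite generation is expressed without linear combinations: a finite subset of \<open>I\<close> such that
  every ideal containing it contains \<open>I\<close>.\<close>

definition noeth_on :: "'a::comm_ring_1 set \<Rightarrow> bool"
  where "noeth_on S \<longleftrightarrow> (\<forall>I. ideal_on S I \<longrightarrow>
    (\<exists>F. finite F \<and> F \<subseteq> I \<and> (\<forall>H. ideal_on S H \<longrightarrow> F \<subseteq> H \<longrightarrow> I \<subseteq> H)))"

lemma noeth_onD: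
  assumes "noeth_on S" "ideal_on S I"
  shows "\<exists>F. finite F \<and> F \<subseteq> I \<and> (\<forall>H. ideal_on S H \<longrightarrow> F \<subseteq> H \<longrightarrow> I \<subseteq> H)"
  using assms by (auto simp: noeth_on_def)

lemma noetherian_ring_on:
  assumes S: "subring_on S" and N: "noeth_on S"
  shows "noetherian_ring (ring_on S)"
proof -
  interpret R: cring "ring_on S" by (rule cring_ring_on[OF S])
  show ?thesis
  proof (rule R.noetherian_ringI)
    fix I assume "ideal I (ring_on S)"
    then have I: "ideal_on S I" by (simp add: ideal_ring_on_iff[OF S])
    obtain F where F: "finite F" "F \<subseteq> I" "\<forall>H. ideal_on S H \<longrightarrow> F \<subseteq> H \<longrightarrow> I \<subseteq> H"
      using noeth_onD[OF N I] by blast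
    have "I = Idl\<^bsub>ring_on S\<^esub> F"
      using F I unfolding genideal_def by (auto simp: ideal_ring_on_iff[OF S])
    then show "\<exists>A\<subseteq>carrier (ring_on S). finite A \<and> I = Idl\<^bsub>ring_on S\<^esub> A"
      using F ideal_onD(1)[OF I] by (intro exI[of _ F]) auto
  qed
qed

text \<open>If \<open>C1\<close> and \<open>C2\<close> become equal after inverting \<open>s\<close> and \<open>C1\<close> is noetherian, ideals of \<open>C2\<close>
  are finitely generated up to multiplication by powers of \<open>s\<close>.\<close>

lemma noeth_on_localization:
  assumes N: "noeth_on C1" and C1: "subring_on C1" and C2: "subring_on C2"
    and s: "s \<in> C1" "s \<in> C2"
    and le1: "\<And>y. y \<in> C1 \<Longrightarrow> \<exists>m. s ^ m * y \<in> C2"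
    and le2: "\<And>y. y \<in> C2 \<Longrightarrow> \<exists>m. s ^ m * y \<in> C1"
    and J: "ideal_on C2 J"
  shows "\<exists>F. finite F \<and> F \<subseteq> J \<and>
    (\<forall>H x. ideal_on C2 H \<longrightarrow> F \<subseteq> H \<longrightarrow> x \<in> J \<longrightarrow> (\<exists>m. s ^ m * x \<in> H))"
proof -
  note s1 = subring_on_power[OF C1 s(1)] and s2 = subring_on_power[OF C2 s(2)]
  let ?sat = "\<lambda>H. {f \<in> C1. \<exists>k. s ^ k * f \<in> H}"
  have sat: "ideal_on C1 (?sat H)" if H: "ideal_on C2 H" for H
  proof (rule ideal_onI)
    show "0 \<in> ?sat H" using ideal_onD(2)[OF H] subring_on_0[OF C1] by auto
    fix a b assume "a \<in> ?sat H" "b \<in> ?sat H"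
    then obtain k l where kl: "a \<in> C1" "b \<in> C1" "s ^ k * a \<in> H" "s ^ l * b \<in> H" by auto
    have "s ^ (k + l) * (a + b) = s ^ l * (s ^ k * a) + s ^ k * (s ^ l * b)"
      by (simp add: power_add algebra_simps)
    also have "\<dots> \<in> H"
      using ideal_onD(3)[OF H ideal_onD(4)[OF H s2 kl(3)] ideal_onD(4)[OF H s2 kl(4)]] .
    finally show "a + b \<in> ?sat H" using kl subring_on_add[OF C1] by blast
  next
    fix r a assume "r \<in> C1" "a \<in> ?sat H"
    then obtain k m where km: "a \<in> C1" "s ^ k * a \<in> H" "s ^ m * r \<in> C2" using le1 by blast
    have "s ^ (m + k) * (r * a) = (s ^ m * r) * (s ^ k * a)" by (simp add: power_add algebra_simps)
    also have "\<dots> \<in> H" using km ideal_onD(4)[OF H] by blast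
    finally show "r * a \<in> ?sat H" using km \<open>r \<in> C1\<close> subring_on_mult[OF C1] by blast
  qed auto
  obtain F where F: "finite F" "F \<subseteq> ?sat J" "\<forall>H. ideal_on C1 H \<longrightarrow> F \<subseteq> H \<longrightarrow> ?sat J \<subseteq> H"
    using noeth_onD[OF N sat[OF J]] by blast
  have "\<forall>f\<in>F. \<exists>k. s ^ k * f \<in> J" using F(2) by auto
  from bchoice[OF this] obtain k where k: "\<And>f. f \<in> F \<Longrightarrow> s ^ k f * f \<in> J" by auto
  show ?thesis
  proof (intro exI[of _ "(\<lambda>f. s ^ k f * f) ` F"] conjI allI impI)
    fix H x assume H: "ideal_on C2 H" "(\<lambda>f. s ^ k f * f) ` F \<subseteq> H" and x: "x \<in> J"
    obtain m where m: "s ^ m * x \<in> C1" using le2 x ideal_onD(1)[OF J] by blast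
    moreover have "s ^ 0 * (s ^ m * x) \<in> J" using ideal_onD(4)[OF J s2 x] by simp
    ultimately have "s ^ m * x \<in> ?sat J" by blast
    moreover have "F \<subseteq> ?sat H" using H(2) F(2) by auto
    ultimately obtain k' where "s ^ k' * (s ^ m * x) \<in> H"
      using F(3)[rule_format, OF sat[OF H(1)]] by blast
    then show "\<exists>m. s ^ m * x \<in> H" by (intro exI[of _ "k' + m"]) (simp add: power_add mult.assoc)
  qed (use F k in auto)
qed

lemma noeth_on_image:
  fixes h :: "'a::comm_ring_1 \<Rightarrow> 'b::comm_ring_1"
  assumes N: "noeth_on (UNIV :: 'a set)"
    and h: "h 0 = 0" "\<And>a b. h (a + b) = h a + h b" "\<And>a b. h (a * b) = h a * h b"
  shows "noeth_on (range h)"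
  unfolding noeth_on_def
proof (intro allI impI)
  fix I assume I: "ideal_on (range h) I"
  have vim: "ideal_on UNIV (h -` H)" if "ideal_on (range h) H" for H
    using that by (auto simp: ideal_on_def h)
  obtain F where F: "finite F" "F \<subseteq> h -` I" "\<forall>H. ideal_on UNIV H \<longrightarrow> F \<subseteq> H \<longrightarrow> h -` I \<subseteq> H"
    using noeth_onD[OF N vim[OF I]] by blast
  show "\<exists>F. finite F \<and> F \<subseteq> I \<and> (\<forall>H. ideal_on (range h) H \<longrightarrow> F \<subseteq> H \<longrightarrow> I \<subseteq> H)"
  proof (intro exI conjI allI impI)
    fix H assume H: "ideal_on (range h) H" "h ` F \<subseteq> H"
    have "h -` I \<subseteq> h -` H" using F(3)[rule_format, OF vim[OF H(1)]] H(2) by blast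
    then show "I \<subseteq> H" using ideal_onD(1)[OF I] by blast
  qed (use F in auto)
qed

subsection \<open>Prime elements\<close>

text \<open>Divisibility, units and prime elements relative to a subring; the quotients must lie in it.\<close>

definition dvd_on :: "'a::comm_ring_1 set \<Rightarrow> 'a \<Rightarrow> 'a \<Rightarrow> bool"
  where "dvd_on C a b \<longleftrightarrow> (\<exists>c\<in>C. b = a * c)"

definition unit_on :: "'a::comm_ring_1 set \<Rightarrow> 'a \<Rightarrow> bool"
  where "unit_on C a \<longleftrightarrow> a \<in> C \<and> (\<exists>b\<in>C. a * b = 1)"

definition prime_on :: "'a::comm_ring_1 set \<Rightarrow> 'a \<Rightarrow> bool"
  where "prime_on C p \<longleftrightarrow> p \<in> C \<and> p \<noteq> 0 \<and> \<not> unit_on C p \<and>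
    (\<forall>a\<in>C. \<forall>b\<in>C. dvd_on C p (a * b) \<longrightarrow> dvd_on C p a \<or> dvd_on C p b)"

text \<open>Products of a unit of \<open>C\<close> and finitely many elements of \<open>\<Gamma>\<close>.\<close>

inductive_set products_on :: "'a::comm_ring_1 set \<Rightarrow> 'a set \<Rightarrow> 'a set" for C \<Gamma> where
  unit: "unit_on C a \<Longrightarrow> a \<in> products_on C \<Gamma>"
| step: "p \<in> \<Gamma> \<Longrightarrow> a \<in> products_on C \<Gamma> \<Longrightarrow> p * a \<in> products_on C \<Gamma>"

text \<open>Factoriality in the form that every nonzero element is a unit times a product of prime elements.
  Uniqueness of the factorisation follows from primality of the factors.\<close>

definition ufd_on :: "'a::comm_ring_1 set \<Rightarrow> bool"
  where "ufd_on C \<longleftrightarrow> (\<forall>c\<in>C. c \<noteq> 0 \<longrightarrow> c \<in> products_on C {p. prime_on C p})"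

lemma unit_on_mult:
  assumes "subring_on C" "unit_on C a" "unit_on C b"
  shows "unit_on C (a * b)"
proof -
  obtain a' b' where "a' \<in> C" "b' \<in> C" "a * a' = 1" "b * b' = 1"
    using assms by (auto simp: unit_on_def)
  moreover have "(a * b) * (a' * b') = (a * a') * (b * b')" by (simp add: mult_ac)
  ultimately have "a' * b' \<in> C" "(a * b) * (a' * b') = 1"
    using subring_on_mult[OF assms(1)] by simp_all
  then show ?thesis using assms subring_on_mult[OF assms(1)] by (auto simp: unit_on_def)
qed

lemma products_on_mult:
  assumes C: "subring_on C"
  shows "a \<in> products_on C \<Gamma> \<Longrightarrow> b \<in> products_on C \<Gamma> \<Longrightarrow> a * b \<in> products_on C \<Gamma>"
proof (induction rule: products_on.induct)
  case (unit a)
  from unit(2) show ?case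
  proof (induction rule: products_on.induct)
    case (unit b)
    then show ?case using \<open>unit_on C a\<close> C by (auto intro: products_on.unit unit_on_mult)
  next
    case (step p b)
    then show ?case using products_on.step[of p \<Gamma> "a * b"] by (simp add: mult.left_commute)
  qed
next
  case (step p a)
  then show ?case using products_on.step[of p \<Gamma> "a * b"] by (simp add: mult.assoc)
qed

lemma products_on_mono: "\<Gamma> \<subseteq> \<Gamma>' \<Longrightarrow> products_on C \<Gamma> \<subseteq> products_on C \<Gamma>'"
proof
  fix x assume "x \<in> products_on C \<Gamma>" "\<Gamma> \<subseteq> \<Gamma>'"
  then show "x \<in> products_on C \<Gamma>'"
    by (induction rule: products_on.induct) (auto intro: products_on.intros)
qed

lemma products_on_subset:
  assumes C: "subring_on C" "\<Gamma> \<subseteq> C" shows "products_on C \<Gamma> \<subseteq> C"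
proof
  fix x assume "x \<in> products_on C \<Gamma>"
  then show "x \<in> C"
    by (induction rule: products_on.induct) (use assms subring_on_mult in \<open>auto simp: unit_on_def\<close>)
qed

text \<open>Prime elements not dividing \<open>q\<close> can be cancelled from \<open>s a = q y\<close>: each of them divides \<open>y\<close>.\<close>

lemma prime_on_prod_cancel:
  fixes C :: "'a::idom set"
  assumes C: "subring_on C" and \<Gamma>: "\<And>\<pi>. \<pi> \<in> \<Gamma> \<Longrightarrow> prime_on C \<pi>"
    and s: "s \<in> products_on C \<Gamma>" and "a \<in> C" "y \<in> C" "q \<in> C"
    and q: "\<And>\<pi>. \<pi> \<in> \<Gamma> \<Longrightarrow> \<not> dvd_on C \<pi> q"
    and eq: "s * a = q * y"
  shows "dvd_on C q a"
  using s \<open>y \<in> C\<close> eq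
proof (induction arbitrary: y rule: products_on.induct)
  case (unit s)
  then obtain s' where s': "s' \<in> C" "s * s' = 1" by (auto simp: unit_on_def)
  have "a = (s * s') * a" using s' by simp
  also have "\<dots> = s' * (s * a)" by (simp add: mult_ac)
  also have "\<dots> = q * (s' * y)" using unit.prems by (simp add: mult_ac)
  finally have "a = q * (s' * y)" .
  moreover have "s' * y \<in> C" using unit.prems s' subring_on_mult[OF C] by blast
  ultimately show ?case by (auto simp: dvd_on_def)
next
  case (step p s)
  have p: "prime_on C p" using \<Gamma> step by blast
  have "\<Gamma> \<subseteq> C" using \<Gamma> by (auto simp: prime_on_def)
  then have "s * a \<in> C" using step products_on_subset[OF C] subring_on_mult[OF C] \<open>a \<in> C\<close> by blast
  then have "dvd_on C p (q * y)"
    using step.prems by (auto simp: dvd_on_def mult.assoc intro!: bexI[of _ "s * a"])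
  then have "dvd_on C p y" using p q[OF step(1)] \<open>q \<in> C\<close> step.prems by (auto simp: prime_on_def)
  then obtain y' where y': "y' \<in> C" "y = p * y'" by (auto simp: dvd_on_def)
  have "p * (s * a) = p * (q * y')" using step.prems y' by (simp add: algebra_simps)
  then have "s * a = q * y'" using p by (auto simp: prime_on_def)
  then show ?case using step.IH y' by blast
qed

text \<open>Nagata's criterion: if \<open>C'\<close> arises from \<open>C\<close> by inverting the prime elements in \<open>\<Gamma>\<close>, if each element
  of \<open>C\<close> can be freed of factors from \<open>\<Gamma>\<close>, and if \<open>C'\<close> is factorial, then \<open>C\<close> is factorial. A prime element of
  \<open>C'\<close> is scaled by units of \<open>C'\<close> to lie in \<open>C\<close> and to have no divisor in \<open>\<Gamma>\<close>; then it is prime in \<open>C\<close>.\<close>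

theorem ufd_on_Nagata:
  fixes C C' :: "'a::idom set"
  assumes C: "subring_on C" and C': "subring_on C'" and sub: "C \<subseteq> C'"
    and \<Gamma>: "\<And>\<pi>. \<pi> \<in> \<Gamma> \<Longrightarrow> prime_on C \<pi>"
    and loc: "\<And>y. y \<in> C' \<Longrightarrow> \<exists>s\<in>products_on C \<Gamma>. s * y \<in> C"
    and inv: "\<And>s. s \<in> products_on C \<Gamma> \<Longrightarrow> unit_on C' s"
    and sat: "\<And>c. c \<in> C \<Longrightarrow> c \<noteq> 0 \<Longrightarrow>
      \<exists>s\<in>products_on C \<Gamma>. \<exists>c'\<in>C. c = s * c' \<and> (\<forall>\<pi>\<in>\<Gamma>. \<not> dvd_on C \<pi> c')"
    and ufd: "ufd_on C'"
  shows "ufd_on C"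
proof -
  let ?P = "{p. prime_on C p}"
  let ?S = "products_on C \<Gamma>"
  have "\<Gamma> \<subseteq> C" using \<Gamma> by (auto simp: prime_on_def)
  then have SC: "?S \<subseteq> C" using products_on_subset[OF C] by blast
  have SP: "?S \<subseteq> products_on C ?P" by (rule products_on_mono) (use \<Gamma> in auto)
  have S0: "s \<noteq> 0" if "s \<in> ?S" for s
    using inv[OF that] by (auto simp: unit_on_def)
  have desc: "dvd_on C q a"
    if qa: "q \<in> C" "a \<in> C" "\<And>\<pi>. \<pi> \<in> \<Gamma> \<Longrightarrow> \<not> dvd_on C \<pi> q" "dvd_on C' q a" for q a
  proof -
    obtain y where y: "y \<in> C'" "a = q * y" using qa(4) by (auto simp: dvd_on_def)
    obtain s where s: "s \<in> ?S" "s * y \<in> C" using loc[OF y(1)] by blast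
    have "s * a = q * (s * y)" by (simp add: y(2) algebra_simps)
    from prime_on_prod_cancel[OF C \<Gamma> s(1) qa(2) s(2) qa(1) qa(3) this] show ?thesis .
  qed
  have prime: "prime_on C q"
    if q: "q \<in> C" "\<And>\<pi>. \<pi> \<in> \<Gamma> \<Longrightarrow> \<not> dvd_on C \<pi> q" and q': "prime_on C' q" for q
    unfolding prime_on_def
  proof (intro conjI ballI impI)
    show "\<not> unit_on C q" using q' sub by (auto simp: prime_on_def unit_on_def)
    fix a b assume ab: "a \<in> C" "b \<in> C" "dvd_on C q (a * b)"
    then have "dvd_on C' q (a * b)" using sub by (auto simp: dvd_on_def)
    then have "dvd_on C' q a \<or> dvd_on C' q b" using q' ab sub by (auto simp: prime_on_def)
    then show "dvd_on C q a \<or> dvd_on C q b" using desc[OF q(1) _ q(2)] ab by blast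
  qed (use q q' in \<open>auto simp: prime_on_def\<close>)
  \<comment> \<open>The unit \<open>w\<close> of \<open>C'\<close> absorbs the scalings of the prime factors in the induction.\<close>
  have main: "c \<in> products_on C ?P"
    if "z \<in> products_on C' {p. prime_on C' p}" "c \<in> C" "\<And>\<pi>. \<pi> \<in> \<Gamma> \<Longrightarrow> \<not> dvd_on C \<pi> c"
      "c = w * z" "unit_on C' w" for z c w
    using that
  proof (induction arbitrary: c w rule: products_on.induct)
    case (unit z)
    then have "unit_on C' c" using unit_on_mult[OF C'] by blast
    then have "dvd_on C' c 1" by (auto simp: unit_on_def dvd_on_def)
    then have "dvd_on C c 1" using unit.prems by (intro desc subring_on_1[OF C]) auto
    then have "unit_on C c" using unit.prems by (auto simp: unit_on_def dvd_on_def)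
    then show ?case by (rule products_on.unit)
  next
    case (step q z)
    have q: "prime_on C' q" using step by simp
    have "q \<in> C'" using q by (simp add: prime_on_def)
    then obtain s1 where s1: "s1 \<in> ?S" "s1 * q \<in> C" using loc by blast
    have "s1 * q \<noteq> 0" using S0[OF s1(1)] q by (auto simp: prime_on_def)
    then obtain s2 q' where q': "s2 \<in> ?S" "q' \<in> C" "s1 * q = s2 * q'" "\<And>\<pi>. \<pi> \<in> \<Gamma> \<Longrightarrow> \<not> dvd_on C \<pi> q'"
      using sat[OF s1(2)] by blast
    obtain t1 t2 where t: "t1 \<in> C'" "t2 \<in> C'" "s1 * t1 = 1" "s2 * t2 = 1"
      using inv[OF s1(1)] inv[OF q'(1)] by (auto simp: unit_on_def)
    have s12: "s1 \<in> C'" "s2 \<in> C'" using s1 q' SC sub by auto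
    define e where "e = s1 * t2"
    define e' where "e' = s2 * t1"
    have "e * e' = (s1 * t1) * (s2 * t2)" unfolding e_def e'_def by (simp add: mult_ac)
    then have e: "e \<in> C'" "e' \<in> C'" "e * e' = 1"
      unfolding e_def e'_def using s12 t subring_on_mult[OF C'] by simp_all
    have q'e: "q' = q * e"
    proof -
      have "s2 * q' = s2 * (q * e)"
      proof -
        have h: "s2 * (q * e) = (s2 * t2) * (s1 * q)" unfolding e_def by (simp add: mult_ac)
        show ?thesis unfolding h t(4) q'(3) by simp
      qed
      then show ?thesis using S0[OF q'(1)] by simp
    qed
    have qe': "q = q' * e'" using q'e e by (simp add: mult.assoc)
    have dvd_eq: "dvd_on C' q' a \<longleftrightarrow> dvd_on C' q a" for a
    proof
      assume "dvd_on C' q' a"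
      then obtain c where "c \<in> C'" "a = q' * c" by (auto simp: dvd_on_def)
      then show "dvd_on C' q a"
        using e subring_on_mult[OF C'] by (auto simp: dvd_on_def q'e mult.assoc intro!: bexI[of _ "e * c"])
    next
      assume "dvd_on C' q a"
      then obtain c where "c \<in> C'" "a = q * c" by (auto simp: dvd_on_def)
      then show "dvd_on C' q' a"
        using e subring_on_mult[OF C'] by (auto simp: dvd_on_def qe' mult.assoc intro!: bexI[of _ "e' * c"])
    qed
    have nu: "\<not> unit_on C' q'"
    proof
      assume "unit_on C' q'"
      then have "dvd_on C' q' 1" by (auto simp: dvd_on_def unit_on_def)
      then have "dvd_on C' q 1" by (simp add: dvd_eq)
      then show False using q by (auto simp: prime_on_def dvd_on_def unit_on_def)
    qed
    have "prime_on C' q'"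
      using q q' sub nu unfolding prime_on_def dvd_eq by (auto simp: qe')
    then have pq': "prime_on C q'" using prime q' by blast
    obtain w' where w': "w' \<in> C'" "w * w' = 1" "w \<in> C'" using step.prems by (auto simp: unit_on_def)
    have zC': "z \<in> C'"
      using step(2) products_on_subset[OF C', of "{p. prime_on C' p}"] by (auto simp: prime_on_def)
    have ceq: "c = q' * (e' * w * z)" using step.prems by (simp add: qe' algebra_simps)
    then have "dvd_on C' q' c"
      using e w' zC' subring_on_mult[OF C'] by (auto simp: dvd_on_def)
    then have "dvd_on C q' c" using desc step.prems q' by blast
    then obtain c' where c': "c' \<in> C" "c = q' * c'" by (auto simp: dvd_on_def)
    have "c' = e' * w * z" using c' ceq pq' by (auto simp: prime_on_def)
    moreover have "unit_on C' (e' * w)"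
      using e step.prems by (intro unit_on_mult[OF C']) (auto simp: unit_on_def mult.commute)
    moreover have "\<not> dvd_on C \<pi> c'" if "\<pi> \<in> \<Gamma>" for \<pi>
    proof
      assume "dvd_on C \<pi> c'"
      then obtain x where "x \<in> C" "c' = \<pi> * x" by (auto simp: dvd_on_def)
      then have "c = \<pi> * (q' * x)" "q' * x \<in> C" using c' q' subring_on_mult[OF C] by auto
      then show False using step.prems that by (auto simp: dvd_on_def)
    qed
    ultimately have "c' \<in> products_on C ?P" using step.IH c' by blast
    then show ?case unfolding c'(2) using pq' by (intro products_on.step) auto
  qed
  show ?thesis
    unfolding ufd_on_def
  proof (intro ballI impI)
    fix c assume "c \<in> C" "c \<noteq> 0"
    then obtain s c' where c': "s \<in> ?S" "c' \<in> C" "c = s * c'" "\<And>\<pi>. \<pi> \<in> \<Gamma> \<Longrightarrow> \<not> dvd_on C \<pi> c'"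
      using sat by blast
    then have "c' \<noteq> 0" using \<open>c \<noteq> 0\<close> by auto
    then have "c' \<in> products_on C' {p. prime_on C' p}"
      using ufd c' sub by (auto simp: ufd_on_def)
    then have "c' \<in> products_on C ?P"
      using main[of c' c' 1] c' subring_on_1[OF C'] by (auto simp: unit_on_def)
    then show "c \<in> products_on C ?P" using c' SP products_on_mult[OF C] by blast
  qed
qed

text \<open>Localising a factorial ring: \<open>C'\<close> consists of fractions of \<open>C\<close> with denominators powers of \<open>u\<close>.\<close>

lemma ufd_on_localization:
  fixes C C' :: "'a::idom set"
  assumes C: "subring_on C" and C': "subring_on C'" and sub: "C \<subseteq> C'"
    and u: "prime_on C u" and inv: "unit_on C' u"
    and loc: "\<And>y. y \<in> C' \<Longrightarrow> \<exists>k. u ^ k * y \<in> C"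
    and ufd: "ufd_on C"
  shows "ufd_on C'"
proof -
  obtain ui where ui: "ui \<in> C'" "u * ui = 1" and uC': "u \<in> C'" using inv by (auto simp: unit_on_def)
  have uu: "u ^ k * ui ^ k = 1" for k using ui by (metis power_mult_distrib power_one)
  have upow: "unit_on C' (ui ^ k)" "unit_on C' (u ^ k)" for k
    using uu[of k] subring_on_power[OF C' ui(1), of k] subring_on_power[OF C' uC', of k]
    unfolding unit_on_def by (metis mult.commute)+
  have pr: "unit_on C' p \<or> prime_on C' p" if p: "prime_on C p" for p
  proof (rule disjCI)
    assume np: "\<not> prime_on C' p"
    have pC: "p \<in> C" "p \<in> C'" "p \<noteq> 0" using p sub by (auto simp: prime_on_def)
    show "unit_on C' p"
    proof (rule ccontr)
      assume nu: "\<not> unit_on C' p"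
      have up: "\<not> dvd_on C p (u ^ k)" for k
      proof
        assume "dvd_on C p (u ^ k)"
        then obtain c where "c \<in> C" "u ^ k = p * c" by (auto simp: dvd_on_def)
        then have "p * (c * ui ^ k) = 1" "c * ui ^ k \<in> C'"
          using uu[of k] sub ui subring_on_closed[OF C'] by (auto simp: mult.assoc)
        then show False using nu pC by (auto simp: unit_on_def)
      qed
      have "prime_on C' p"
        unfolding prime_on_def
      proof (intro conjI ballI impI)
        fix a b assume ab: "a \<in> C'" "b \<in> C'" "dvd_on C' p (a * b)"
        obtain c where c: "c \<in> C'" "a * b = p * c" using ab by (auto simp: dvd_on_def)
        obtain i j k where ijk: "u ^ i * a \<in> C" "u ^ j * b \<in> C" "u ^ k * c \<in> C"
          using loc ab c by metis
        have uk: "u ^ n \<in> C" for n using u subring_on_power[OF C] by (auto simp: prime_on_def)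
        have eq: "u ^ k * ((u ^ i * a) * (u ^ j * b)) = p * (u ^ (i + j) * (u ^ k * c))"
          using c by (simp add: power_add algebra_simps)
        have "dvd_on C p (u ^ k * ((u ^ i * a) * (u ^ j * b)))"
          unfolding eq dvd_on_def using uk ijk subring_on_mult[OF C] by blast
        then have "dvd_on C p (u ^ i * a) \<or> dvd_on C p (u ^ j * b)"
          using p up uk ijk subring_on_mult[OF C] unfolding prime_on_def by blast
        moreover have "dvd_on C' p x" if d: "dvd_on C p (u ^ n * x)" for n x
        proof -
          obtain y where y: "y \<in> C" "u ^ n * x = p * y" using d by (auto simp: dvd_on_def)
          have "x = (u ^ n * ui ^ n) * x" using uu[of n] by simp
          also have "\<dots> = ui ^ n * (u ^ n * x)" by (simp only: mult_ac)
          finally have "x = ui ^ n * (u ^ n * x)" .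
          then have "x = p * (ui ^ n * y)" unfolding y(2) by (simp add: mult_ac)
          moreover have "ui ^ n * y \<in> C'"
            using y(1) sub ui(1) by (intro subring_on_mult[OF C'] subring_on_power[OF C']) auto
          ultimately show ?thesis unfolding dvd_on_def by blast
        qed
        ultimately show "dvd_on C' p a \<or> dvd_on C' p b" by blast
      qed (use pC nu in auto)
      then show False using np by simp
    qed
  qed
  have "c \<in> products_on C' {p. prime_on C' p}" if "c \<in> products_on C {p. prime_on C p}" for c
    using that
  proof (induction rule: products_on.induct)
    case (unit a)
    then show ?case using sub by (intro products_on.unit) (auto simp: unit_on_def)
  next
    case (step p a)
    then show ?case
      using pr[of p] products_on.step[of p "{p. prime_on C' p}" a C']
        products_on_mult[OF C' products_on.unit[of C' p] step.IH] by auto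
  qed note mem = this
  show ?thesis
    unfolding ufd_on_def
  proof (intro ballI impI)
    fix y assume y: "y \<in> C'" "y \<noteq> 0"
    obtain k where k: "u ^ k * y \<in> C" using loc y by blast
    have "u ^ k \<noteq> 0" using uu[of k] mult_zero_left zero_neq_one by metis
    then have "u ^ k * y \<in> products_on C' {p. prime_on C' p}"
      using ufd k y mem by (auto simp: ufd_on_def)
    then have "ui ^ k * (u ^ k * y) \<in> products_on C' {p. prime_on C' p}"
      using products_on_mult[OF C' products_on.unit[OF upow(1)]] by blast
    moreover have "ui ^ k * (u ^ k * y) = (u ^ k * ui ^ k) * y" by (simp only: mult_ac)
    ultimately show "y \<in> products_on C' {p. prime_on C' p}" using uu[of k] by simp
  qed
qed

text \<open>A factorial domain is integrally closed: a denominator dividing out of an integral equation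
  loses its prime factors one at a time.\<close>

lemma dvd_on_power:
  assumes "prime_on C p" "subring_on C" "a \<in> C" "dvd_on C p (a ^ n)"
  shows "dvd_on C p a"
  using assms(4)
proof (induction n)
  case 0
  then show ?case using assms by (auto simp: prime_on_def dvd_on_def unit_on_def)
next
  case (Suc n)
  then show ?case using assms subring_on_power[OF assms(2,3)] by (auto simp: prime_on_def)
qed

lemma ufd_on_integrally_closed:
  fixes C :: "'a::idom set"
  assumes C: "subring_on C" and ufd: "ufd_on C"
    and ab: "a \<in> C" "b \<in> C" "b \<noteq> 0"
    and c: "\<And>i. c i \<in> C"
    and eq: "a ^ n = (\<Sum>i<n. c i * a ^ i * b ^ (n - i))"
  shows "dvd_on C b a"
proof -
  have "b \<in> products_on C {p. prime_on C p}" using ufd ab by (auto simp: ufd_on_def)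
  then show ?thesis
    using ab eq
  proof (induction arbitrary: a rule: products_on.induct)
    case (unit b)
    then obtain b' where "b' \<in> C" "b * b' = 1" by (auto simp: unit_on_def)
    moreover from this have "a = b * (b' * a)" by (simp flip: mult.assoc)
    moreover have "b' * a \<in> C" using \<open>b' \<in> C\<close> unit subring_on_mult[OF C] by blast
    ultimately show ?case unfolding dvd_on_def by blast
  next
    case (step p b)
    have p: "prime_on C p" using step by simp
    have bC: "b \<in> C" using step(2) products_on_subset[OF C, of "{p. prime_on C p}"] by (auto simp: prime_on_def)
    have pC: "p \<in> C" using p by (auto simp: prime_on_def)
    note cl = subring_on_closed[OF C]
    have "a ^ n = p * (\<Sum>i<n. c i * a ^ i * (b * (p * b) ^ (n - i - 1)))"
      unfolding step.prems(4) sum_distrib_left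
    proof (intro sum.cong refl)
      fix i assume "i \<in> {..<n}"
      then have "(p * b) ^ (n - i) = (p * b) * (p * b) ^ (n - i - 1)"
        by (metis Suc_diff_Suc diff_Suc_eq_diff_pred diff_commute lessThan_iff power_Suc)
      then show "c i * a ^ i * (p * b) ^ (n - i) = p * (c i * a ^ i * (b * (p * b) ^ (n - i - 1)))"
        by (simp add: algebra_simps)
    qed
    moreover have "(\<Sum>i<n. c i * a ^ i * (b * (p * b) ^ (n - i - 1))) \<in> C"
      using c step.prems bC pC by (intro subring_on_sum[OF C] cl) auto
    ultimately have "dvd_on C p (a ^ n)" by (auto simp: dvd_on_def)
    then have "dvd_on C p a" using dvd_on_power[OF p C] step.prems by blast
    then obtain a' where a': "a' \<in> C" "a = p * a'" by (auto simp: dvd_on_def)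
    have "p ^ n * a' ^ n = p ^ n * (\<Sum>i<n. c i * a' ^ i * b ^ (n - i))"
    proof -
      have "p ^ n * a' ^ n = a ^ n" by (simp add: a' power_mult_distrib)
      also have "\<dots> = (\<Sum>i<n. p ^ n * (c i * a' ^ i * b ^ (n - i)))"
        unfolding step.prems(4)
      proof (intro sum.cong refl)
        fix i assume "i \<in> {..<n}"
        then have "p ^ n = p ^ i * p ^ (n - i)" by (simp flip: power_add)
        then show "c i * a ^ i * (p * b) ^ (n - i) = p ^ n * (c i * a' ^ i * b ^ (n - i))"
          by (simp add: a' power_mult_distrib algebra_simps)
      qed
      finally show ?thesis by (simp add: sum_distrib_left)
    qed
    then have "a' ^ n = (\<Sum>i<n. c i * a' ^ i * b ^ (n - i))" using p by (auto simp: prime_on_def)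
    moreover have "b \<noteq> 0" using step.prems by auto
    ultimately have "dvd_on C b a'" using step.IH a' bC by blast
    then show ?case by (auto simp: dvd_on_def a' mult.assoc)
  qed
qed

subsection \<open>Factorial rings in the sense of divisibility monoids\<close>

lemma factorial_domain_ring_on:
  fixes C :: "'a::idom set"
  assumes C: "subring_on C" and ufd: "ufd_on C"
  shows "factorial_domain (ring_on C)"
proof -
  interpret D: domain "ring_on C" by (rule domain_ring_on[OF C])
  let ?M = "mult_of (ring_on C)"
  have carr: "carrier ?M = C - {0}" and mult: "x \<otimes>\<^bsub>?M\<^esub> y = x * y" and one: "\<one>\<^bsub>?M\<^esub> = 1" for x y
    by simp_all
  have dvd: "a divides\<^bsub>?M\<^esub> b \<longleftrightarrow> dvd_on C a b" if "b \<in> C - {0}" for a b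
    using that by (auto simp: factor_def dvd_on_def)
  have Un: "a \<in> Units ?M \<longleftrightarrow> unit_on C a" for a
    using D.Units_mult_eq_Units by (auto simp: unit_on_def Units_def mult.commute)
  have pr: "Divisibility.prime ?M p" if p: "prime_on C p" for p
    unfolding Divisibility.prime_def Un
  proof (intro conjI ballI impI)
    fix a b assume ab: "a \<in> carrier ?M" "b \<in> carrier ?M" "p divides\<^bsub>?M\<^esub> (a \<otimes>\<^bsub>?M\<^esub> b)"
    then have "a * b \<in> C - {0}" using subring_on_mult[OF C] by auto
    then have "dvd_on C p (a * b)" using ab dvd[of "a * b" p] by simp
    then have "dvd_on C p a \<or> dvd_on C p b" using p ab(1,2) unfolding prime_on_def by simp
    then show "p divides\<^bsub>?M\<^esub> a \<or> p divides\<^bsub>?M\<^esub> b"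
      using ab(1,2) dvd[of a p] dvd[of b p] by simp
  qed (use p in \<open>auto simp: prime_on_def\<close>)
  have irr: "Divisibility.irreducible ?M p" if "prime_on C p" for p
    using D.mult_of.prime_irreducible[OF pr[OF that]] .
  have pc: "p \<in> carrier ?M" if "prime_on C p" for p
    using that by (auto simp: prime_on_def)
  have wf: "a \<noteq> 0 \<and> a \<in> C \<and> (\<exists>fs. set fs \<subseteq> carrier ?M \<and> wfactors ?M fs a)"
    if "a \<in> products_on C {p. prime_on C p}" for a
    using that
  proof (induction rule: products_on.induct)
    case (unit a)
    have "a \<noteq> 0" "a \<in> C" using unit by (auto simp: unit_on_def)
    then have "1 divides\<^bsub>?M\<^esub> a" by (subst dvd) (auto simp: dvd_on_def)
    moreover have "a divides\<^bsub>?M\<^esub> 1"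
      using unit subring_on_1[OF C] by (subst dvd) (auto simp: dvd_on_def unit_on_def dest: sym)
    ultimately have "1 \<sim>\<^bsub>?M\<^esub> a" by (simp only: associated_def)
    then have "wfactors ?M [] a"
      by (simp add: wfactors_def)
    then show ?case using unit by (auto simp: unit_on_def intro!: exI[of _ "[]"])
  next
    case (step p a)
    then obtain fs where fs: "set fs \<subseteq> carrier ?M" "wfactors ?M fs a" and a: "a \<in> C - {0}" by auto
    have p: "prime_on C p" using step by simp
    have "wfactors ?M (p # fs) (p \<otimes>\<^bsub>?M\<^esub> a)"
      using D.mult_of.wfactors_mult_single[OF irr[OF p] fs(2) pc[OF p] _ fs(1)] a by simp
    then show ?case using fs a p pc[OF p] subring_on_mult[OF C]
      by (auto simp: prime_on_def intro!: exI[of _ "p # fs"])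
  qed
  have "primeness_condition_monoid ?M"
  proof (unfold_locales, goal_cases)
    case (1 a)
    then have aC: "a \<in> C - {0}" by simp
    then have "a \<in> products_on C {p. prime_on C p}" using ufd by (auto simp: ufd_on_def)
    then show ?case
    proof (cases rule: products_on.cases)
      case unit
      then show ?thesis using 1 Un by (auto simp: Divisibility.irreducible_def)
    next
      case (step p s)
      have p: "prime_on C p" "p \<in> C - {0}" using step pc by auto
      have sC: "s \<in> C" using step products_on_subset[OF C, of "{p. prime_on C p}"] by (auto simp: prime_on_def)
      have pa: "p divides\<^bsub>?M\<^esub> a" using dvd[OF aC] step sC by (auto simp: dvd_on_def)
      have "a divides\<^bsub>?M\<^esub> p"
      proof (rule ccontr)
        assume "\<not> a divides\<^bsub>?M\<^esub> p"
        then have "p \<in> Units ?M"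
          using 1 pa pc[OF p(1)] by (auto simp: Divisibility.irreducible_def properfactor_def)
        then show False using p Un by (auto simp: prime_on_def)
      qed
      then have "p \<sim>\<^bsub>?M\<^esub> a" using pa by (auto simp: associated_def)
      then show ?thesis using D.mult_of.prime_cong[OF pr[OF p(1)]] pc[OF p(1)] 1 by blast
    qed
  qed
  then interpret P: primeness_condition_monoid ?M .
  have "factorial_monoid ?M"
  proof (rule D.mult_of.factorial_monoidI)
    fix a assume "a \<in> carrier ?M" "a \<notin> Units ?M"
    then show "\<exists>fs. set fs \<subseteq> carrier ?M \<and> wfactors ?M fs a"
      using wf[of a] ufd by (auto simp: ufd_on_def)
  next
    fix a fs fs' assume "a \<in> carrier ?M" "set fs \<subseteq> carrier ?M" "set fs' \<subseteq> carrier ?M"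
        "wfactors ?M fs a" "wfactors ?M fs' a"
    then show "essentially_equal ?M fs fs'" using P.wfactors_unique by blast
  qed
  then show ?thesis
    using D.domain_axioms by (simp add: factorial_domain_def)
qed

lemma unit_on_UNIV: "unit_on UNIV p \<longleftrightarrow> p dvd 1"
  by (auto simp: unit_on_def dvd_def)

text \<open>An additive size that vanishes only on units makes every nonzero element a product of
  irreducible elements, which are assumed to lie in \<open>\<Gamma>\<close>.\<close>

lemma product_of_irreducibles:
  fixes size :: "'a::idom \<Rightarrow> nat" and \<Gamma> :: "'a set" and r :: 'a
  assumes irr: "\<And>p. Factorial_Ring.irreducible p \<Longrightarrow> p \<in> \<Gamma>"
    and mult: "\<And>a b :: 'a. a \<noteq> 0 \<Longrightarrow> b \<noteq> 0 \<Longrightarrow> size (a * b) = size a + size b"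
    and unit: "\<And>a :: 'a. a \<noteq> 0 \<Longrightarrow> size a = 0 \<Longrightarrow> a dvd 1"
    and "r \<noteq> 0"
  shows "r \<in> products_on UNIV \<Gamma>"
  using \<open>r \<noteq> 0\<close>
proof (induction "size r" arbitrary: r rule: less_induct)
  case less
  consider "r dvd 1" | "Factorial_Ring.irreducible r" | a b where "r = a * b" "\<not> a dvd 1" "\<not> b dvd 1"
    using less.prems unfolding Factorial_Ring.irreducible_def by blast
  then show ?case
  proof cases
    case 1
    then show ?thesis by (intro products_on.unit) (simp only: unit_on_UNIV)
  next
    case 2
    then have "r * 1 \<in> products_on UNIV \<Gamma>"
      by (intro products_on.step irr products_on.unit) (simp_all add: unit_on_UNIV)
    then show ?thesis by simp
  next
    case (3 a b)
    have nz: "a \<noteq> 0" "b \<noteq> 0" using 3(1) less.prems by auto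
    then have "size a > 0" "size b > 0" using 3 unit by blast+
    then have "size a < size r" "size b < size r" using nz by (simp_all add: 3(1) mult)
    then have "a * b \<in> products_on UNIV \<Gamma>" by (intro products_on_mult[OF subring_on_UNIV] less.hyps nz)
    then show ?thesis by (simp only: 3(1))
  qed
qed

lemma ufd_on_field_poly: "ufd_on (UNIV :: 'k::field poly set)"
  unfolding ufd_on_def
proof (intro ballI impI product_of_irreducibles[where size = Polynomial.degree])
  show "p \<in> {p. prime_on UNIV p}" if "Factorial_Ring.irreducible p" for p :: "'k poly"
    using field_poly_irreducible_imp_prime[OF that]
    by (auto simp: prime_on_def prime_elem_def dvd_on_def dvd_def unit_on_UNIV)
qed (auto simp: degree_mult_eq is_unit_iff_degree)

subsection \<open>Hilbert's basis theorem\<close>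

text \<open>The ideals \<open>lead I n\<close> of coefficients of \<open>X\<^sup>n\<close> in the elements of \<open>I\<close> of degree at most \<open>n\<close> increase
  with \<open>n\<close> and become stationary at some \<open>M\<close>. Polynomials realising finite generating sets of the first
  \<open>M + 1\<close> of them generate \<open>I\<close>.\<close>

theorem noeth_on_poly:
  assumes N: "noeth_on (UNIV :: 'a::comm_ring_1 set)"
  shows "noeth_on (UNIV :: 'a poly set)"
  unfolding noeth_on_def
proof (intro allI impI)
  fix I :: "'a poly set" assume I: "ideal_on UNIV I"
  define le where "le n f \<longleftrightarrow> (\<forall>i>n. Polynomial.coeff f i = 0)" for n and f :: "'a poly"
  define lead where "lead H n = {Polynomial.coeff f n | f. f \<in> H \<and> le n f}" for H :: "'a poly set" and n
  have idl: "ideal_on UNIV (lead H n)" if H: "ideal_on UNIV H" for H n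
  proof (rule ideal_onI)
    show "0 \<in> lead H n" using ideal_onD(2)[OF H] by (auto simp: lead_def le_def intro!: exI[of _ 0])
    fix a b assume "a \<in> lead H n" "b \<in> lead H n"
    then obtain f g where "f \<in> H" "g \<in> H" "le n f" "le n g" "a = Polynomial.coeff f n" "b = Polynomial.coeff g n"
      by (auto simp: lead_def)
    then show "a + b \<in> lead H n"
      using ideal_onD(3)[OF H] by (auto simp: lead_def le_def intro!: exI[of _ "f + g"])
  next
    fix s a assume "a \<in> lead H n"
    then obtain f where "f \<in> H" "le n f" "a = Polynomial.coeff f n" by (auto simp: lead_def)
    then show "s * a \<in> lead H n"
      using ideal_onD(4)[OF H, of "[:s:]" f] by (auto simp: lead_def le_def intro!: exI[of _ "[:s:] * f"])
  qed auto
  have mono: "lead H n \<subseteq> lead H (n + k)" if H: "ideal_on UNIV H" for H n k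
  proof
    fix a assume "a \<in> lead H n"
    then obtain f where "f \<in> H" "le n f" "a = Polynomial.coeff f n" by (auto simp: lead_def)
    then show "a \<in> lead H (n + k)"
      using ideal_onD(4)[OF H, of "Polynomial.monom 1 k" f]
      by (auto simp: lead_def le_def coeff_monom_mult intro!: exI[of _ "Polynomial.monom 1 k * f"])
  qed
  have mono': "lead H m \<subseteq> lead H n" if "ideal_on UNIV H" "m \<le> n" for H m n
    using mono[OF that(1), of m "n - m"] that(2) by simp
  define L where "L = (\<Union>n. lead I n)"
  have L: "ideal_on UNIV L"
  proof (rule ideal_onI)
    show "0 \<in> L" using ideal_onD(2)[OF idl[OF I]] by (auto simp: L_def)
    fix a b assume "a \<in> L" "b \<in> L"
    then obtain m n where "a \<in> lead I m" "b \<in> lead I n" by (auto simp: L_def)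
    then have "a \<in> lead I (max m n)" "b \<in> lead I (max m n)"
      using mono'[OF I, of m "max m n"] mono'[OF I, of n "max m n"] by auto
    then show "a + b \<in> L" using ideal_onD(3)[OF idl[OF I]] by (auto simp: L_def)
  qed (use ideal_onD(4)[OF idl[OF I]] in \<open>auto simp: L_def\<close>)
  obtain F where F: "finite F" "F \<subseteq> L" "\<forall>H. ideal_on UNIV H \<longrightarrow> F \<subseteq> H \<longrightarrow> L \<subseteq> H"
    using noeth_onD[OF N L] by blast
  have "\<exists>n. F \<subseteq> lead I n" using F(1,2)
  proof (induction rule: finite_induct)
    case (insert x F)
    then obtain m n where "F \<subseteq> lead I m" "x \<in> lead I n" by (auto simp: L_def)
    then have "insert x F \<subseteq> lead I (max m n)"
      using mono'[OF I, of m "max m n"] mono'[OF I, of n "max m n"] by auto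
    then show ?case by blast
  qed auto
  then obtain M where M: "F \<subseteq> lead I M" by blast
  have stab: "lead I n \<subseteq> lead I M" for n
    using F(3) idl[OF I, of M] M by (auto simp: L_def)
  have "\<exists>G. finite G \<and> G \<subseteq> I \<and> (\<forall>H. ideal_on UNIV H \<longrightarrow> G \<subseteq> H \<longrightarrow> lead I n \<subseteq> lead (H \<inter> I) n)" for n
  proof -
    obtain F where F: "finite F" "F \<subseteq> lead I n" "\<forall>H. ideal_on UNIV H \<longrightarrow> F \<subseteq> H \<longrightarrow> lead I n \<subseteq> H"
      using noeth_onD[OF N idl[OF I, of n]] by blast
    have "\<forall>a\<in>F. \<exists>f. f \<in> I \<and> le n f \<and> a = Polynomial.coeff f n" using F(2) by (auto simp: lead_def)
    from bchoice[OF this] obtain f where f: "\<And>a. a \<in> F \<Longrightarrow> f a \<in> I \<and> le n (f a) \<and> a = Polynomial.coeff (f a) n"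
      by auto
    show ?thesis
    proof (intro exI[of _ "f ` F"] conjI allI impI)
      fix H assume H: "ideal_on UNIV H" "f ` F \<subseteq> H"
      have HI: "ideal_on UNIV (H \<inter> I)" using H(1) I by (auto simp: ideal_on_def)
      have "F \<subseteq> lead (H \<inter> I) n"
      proof
        fix a assume "a \<in> F"
        then show "a \<in> lead (H \<inter> I) n"
          unfolding lead_def using f[of a] H(2) by blast
      qed
      then show "lead I n \<subseteq> lead (H \<inter> I) n" using F(3) idl[OF HI] by blast
    qed (use F f in auto)
  qed
  then obtain G where G: "\<And>n. finite (G n)" "\<And>n. G n \<subseteq> I"
    "\<And>n H. ideal_on UNIV H \<Longrightarrow> G n \<subseteq> H \<Longrightarrow> lead I n \<subseteq> lead (H \<inter> I) n"
    by metis
  show "\<exists>F. finite F \<and> F \<subseteq> I \<and> (\<forall>H. ideal_on UNIV H \<longrightarrow> F \<subseteq> H \<longrightarrow> I \<subseteq> H)"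
  proof (intro exI[of _ "\<Union>n\<le>M. G n"] conjI allI impI)
    fix H assume H: "ideal_on UNIV H" "(\<Union>n\<le>M. G n) \<subseteq> H"
    have HI: "ideal_on UNIV (H \<inter> I)" using H(1) I by (auto simp: ideal_on_def)
    have sub: "lead I n \<subseteq> lead (H \<inter> I) n" for n
    proof (cases "n \<le> M")
      case True
      then show ?thesis using G(3)[OF H(1), of n] H(2) by blast
    next
      case False
      have "lead I n \<subseteq> lead I M" by (rule stab)
      also have "\<dots> \<subseteq> lead (H \<inter> I) M" using G(3)[OF H(1), of M] H(2) by blast
      also have "\<dots> \<subseteq> lead (H \<inter> I) n" using mono'[OF HI] False by simp
      finally show ?thesis .
    qed
    have "f \<in> H" if "f \<in> I" "\<And>i. i \<ge> n \<Longrightarrow> Polynomial.coeff f i = 0" for n f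
      using that
    proof (induction n arbitrary: f)
      case 0
      then have "f = 0" by (intro poly_eqI) auto
      then show ?case using ideal_onD(2)[OF H(1)] by simp
    next
      case (Suc n)
      then have "Polynomial.coeff f n \<in> lead I n" by (auto simp: lead_def le_def)
      then obtain g where g: "g \<in> H" "g \<in> I" "le n g" "Polynomial.coeff g n = Polynomial.coeff f n"
        using sub[of n] by (auto simp: lead_def)
      have "f - g \<in> I" using ideal_on_diff[OF I subring_on_UNIV] Suc g by blast
      moreover have "Polynomial.coeff (f - g) i = 0" if "i \<ge> n" for i
        using that g Suc.prems(2)[of i] by (cases "i = n") (auto simp: le_def)
      ultimately have "f - g \<in> H" using Suc.IH by blast
      then have "(f - g) + g \<in> H" using ideal_onD(3)[OF H(1)] g by blast
      then show ?case by simp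
    qed
    moreover have "Polynomial.coeff f i = 0" if "i \<ge> Suc (Polynomial.degree f)" for f :: "'a poly" and i
      using that by (simp add: coeff_eq_0)
    ultimately show "I \<subseteq> H" by blast
  qed (use G in auto)
qed

section \<open>The ring of power series in two variables\<close>

unbundle fps_syntax

text \<open>The order in \<open>v\<close> of the lowest nonzero coefficient with respect to \<open>u\<close>.\<close>

abbreviation low_order :: "power_series_uv \<Rightarrow> nat"
  where "low_order f \<equiv> subdegree (f $ subdegree f)"

text \<open>Weierstrass division by \<open>g\<close>, as far as it is needed: the division of \<open>x\<close> by \<open>g\<close> either comes
  out even or stops at a remainder whose lowest coefficient is not divisible by that of \<open>g\<close>.\<close>

lemma power_series_division:
  fixes g x :: power_series_uv
  assumes g: "g $ 0 \<noteq> 0"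
  shows "g dvd x \<or> (\<exists>q m r. x = q * g + fps_X ^ m * r \<and> r $ 0 \<noteq> 0 \<and> subdegree (r $ 0) < subdegree (g $ 0))"
proof -
  \<comment> \<open>The quotient is built up coefficient by coefficient in \<open>u\<close>; \<open>r n\<close> is the current remainder divided by \<open>u\<^sup>n\<close>.\<close>
  define r where "r = rec_nat x (\<lambda>_ r. fps_shift 1 (r - fps_const (r $ 0 div g $ 0) * g))"
  have r0: "r 0 = x" and rS: "r (Suc n) = fps_shift 1 (r n - fps_const (r n $ 0 div g $ 0) * g)" for n
    by (simp_all add: r_def)
  define c where "c n = r n $ 0 div g $ 0" for n
  have step: "r n = fps_const (c n) * g + fps_X * r (Suc n)" if "g $ 0 dvd r n $ 0" for n
  proof (rule fps_ext)
    fix k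
    show "r n $ k = (fps_const (c n) * g + fps_X * r (Suc n)) $ k"
      using that by (cases k) (auto simp: rS c_def)
  qed
  have inv: "x = (\<Sum>i<n. fps_const (c i) * fps_X ^ i) * g + fps_X ^ n * r n"
    if "\<forall>i<n. g $ 0 dvd r i $ 0" for n
    using that
  proof (induction n)
    case (Suc n)
    then have "x = (\<Sum>i<n. fps_const (c i) * fps_X ^ i) * g + fps_X ^ n * r n" by simp
    also have "r n = fps_const (c n) * g + fps_X * r (Suc n)" using Suc by (intro step) auto
    finally show ?case by (simp add: algebra_simps)
  qed (simp add: r0)
  show ?thesis
  proof (cases "\<forall>n. g $ 0 dvd r n $ 0")
    case True
    have "x = Abs_fps c * g"
    proof (rule fps_ext)
      fix n
      have co: "(\<Sum>i<Suc n. fps_const (c i) * fps_X ^ i) $ k = (if k \<le> n then c k else 0)" for k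
        by (auto simp: fps_sum_nth fps_X_power_iff if_distrib cong: if_cong)
      have "x $ n = ((\<Sum>i<Suc n. fps_const (c i) * fps_X ^ i) * g) $ n"
        by (subst inv[of "Suc n"])
          (use True in \<open>auto simp: fps_X_power_mult_nth mult.assoc simp del: sum.lessThan_Suc power_Suc\<close>)
      also have "\<dots> = (Abs_fps c * g) $ n"
        unfolding fps_mult_nth co by (intro sum.cong) auto
      finally show "x $ n = (Abs_fps c * g) $ n" .
    qed
    then show ?thesis by simp
  next
    case False
    define n where "n = (LEAST n. \<not> g $ 0 dvd r n $ 0)"
    have "\<exists>n. \<not> g $ 0 dvd r n $ 0" using False by simp
    from LeastI_ex[OF this] have n: "\<not> g $ 0 dvd r n $ 0" "\<forall>i<n. g $ 0 dvd r i $ 0"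
      using not_less_Least[of _ "\<lambda>n. \<not> g $ 0 dvd r n $ 0"] unfolding n_def by blast+
    have "r n $ 0 \<noteq> 0" using n(1) by auto
    moreover have "subdegree (r n $ 0) < subdegree (g $ 0)"
      using n(1) g calculation by (simp add: fps_dvd_iff)
    ultimately show ?thesis using inv[OF n(2)] by blast
  qed
qed

lemma power_series_decompose:
  fixes f :: power_series_uv
  shows "f = fps_X ^ subdegree f * fps_shift (subdegree f) f"
  using subdegree_decompose[of f] by (simp add: mult.commute)

text \<open>After inverting \<open>u\<close>, every ideal of \<open>\<complex>[[u,v]]\<close> is principal: the generator is an element \<open>w\<close> of the ideal
  for which \<open>low_order w\<close> is least, and \<open>g\<close> is \<open>w\<close> divided by the highest possible power of \<open>u\<close>.\<close>

lemma power_series_ideal: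
  fixes I :: "power_series_uv set"
  assumes I: "ideal_on UNIV I" and "I \<noteq> {0}"
  shows "\<exists>g k. g $ 0 \<noteq> 0 \<and> fps_X ^ k * g \<in> I \<and> (\<forall>x\<in>I. g dvd x)"
proof -
  have "\<exists>w. w \<in> I \<and> w \<noteq> 0" using assms ideal_onD(2)[OF I] by blast
  then obtain w where w: "w \<in> I" "w \<noteq> 0" "\<And>y. y \<in> I \<Longrightarrow> y \<noteq> 0 \<Longrightarrow> low_order w \<le> low_order y"
    using ex_has_least_nat[of "\<lambda>w. w \<in> I \<and> w \<noteq> 0" _ low_order] by blast
  define k where "k = subdegree w"
  define g where "g = fps_shift k w"
  have wg: "w = fps_X ^ k * g" unfolding k_def g_def by (rule power_series_decompose)
  have g0: "g $ 0 = w $ subdegree w" by (simp add: g_def k_def)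
  have g0': "g $ 0 \<noteq> 0" using w(2) by (simp add: g0)
  show ?thesis
  proof (intro exI[of _ g] exI[of _ k] conjI ballI)
    show "fps_X ^ k * g \<in> I" using w wg by simp
    fix x assume x: "x \<in> I"
    show "g dvd x"
    proof (rule ccontr)
      assume "\<not> g dvd x"
      then obtain q m r where qmr: "x = q * g + fps_X ^ m * r" "r $ 0 \<noteq> 0"
        "subdegree (r $ 0) < subdegree (g $ 0)"
        using power_series_division[OF g0', of x] by blast
      have "fps_X ^ (k + m) * r = fps_X ^ k * x - q * w"
        by (simp add: qmr(1) wg power_add algebra_simps)
      also have "\<dots> \<in> I" using ideal_on_diff[OF I subring_on_UNIV] ideal_onD(4)[OF I] x w by blast
      finally have "fps_X ^ (k + m) * r \<in> I" .
      moreover have r: "r \<noteq> 0" using qmr by auto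
      then have "fps_X ^ (k + m) * r \<noteq> 0" by simp
      moreover have "subdegree (fps_X ^ (k + m) * r) = k + m"
        using r qmr(2) by simp
      then have "low_order (fps_X ^ (k + m) * r) = subdegree (r $ 0)"
        by (simp add: fps_X_power_mult_nth)
      ultimately show False using w(3)[of "fps_X ^ (k + m) * r"] qmr(3) by (simp add: g0)
    qed
  qed (fact g0')
qed

text \<open>With \<open>g\<close> and \<open>k\<close> as above, the elements of \<open>I\<close> divisible by \<open>u\<^sup>k\<close> are the multiples of \<open>u\<^sup>k g\<close>. One further
  generator is needed for each \<open>l < k\<close>: an element of \<open>I\<close> divisible by \<open>u\<^sup>l\<close> whose coefficient of \<open>u\<^sup>l\<close> has
  minimal order in \<open>v\<close>.\<close>

lemma noeth_on_power_series: "noeth_on (UNIV :: power_series_uv set)"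
  unfolding noeth_on_def
proof (intro allI impI)
  fix I :: "power_series_uv set" assume I: "ideal_on UNIV I"
  show "\<exists>F. finite F \<and> F \<subseteq> I \<and> (\<forall>H. ideal_on UNIV H \<longrightarrow> F \<subseteq> H \<longrightarrow> I \<subseteq> H)"
  proof (cases "I = {0}")
    case True
    then show ?thesis by (intro exI[of _ "{}"]) (auto simp: ideal_on_def)
  next
    case False
    obtain g k where g: "g $ 0 \<noteq> 0" "fps_X ^ k * g \<in> I" "\<And>x. x \<in> I \<Longrightarrow> g dvd x"
      using power_series_ideal[OF I False] by auto
    have "\<exists>F. finite F \<and> F \<subseteq> I \<and>
        (\<forall>H x. ideal_on UNIV H \<longrightarrow> F \<subseteq> H \<longrightarrow> x \<in> I \<longrightarrow> (\<forall>i<k - j. x $ i = 0) \<longrightarrow> x \<in> H)" for j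
    proof (induction j)
      case 0
      show ?case
      proof (intro exI[of _ "{fps_X ^ k * g}"] conjI allI impI)
        fix H x assume H: "ideal_on UNIV H" "{fps_X ^ k * g} \<subseteq> H" and x: "x \<in> I" "\<forall>i<k - 0. x $ i = 0"
        obtain y where y: "x = g * y" using g(3)[OF x(1)] by (auto elim: dvdE)
        show "x \<in> H"
        proof (cases "x = 0")
          case False
          then have "k \<le> subdegree x" using x(2) by (intro subdegree_geI) auto
          also have "subdegree x = subdegree y" using False g(1) y by (auto simp: y)
          finally have "y = fps_shift k y * fps_X ^ k" by (simp add: fps_shift_times_fps_X_power)
          then have "x = fps_shift k y * (fps_X ^ k * g)" by (simp add: y mult_ac)
          then show ?thesis using ideal_onD(4)[OF H(1), of "fps_shift k y"] H(2) by simp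
        qed (use ideal_onD(2)[OF H(1)] in simp)
      qed (use g in auto)
    next
      case (Suc j)
      then obtain F where F: "finite F" "F \<subseteq> I"
        "\<And>H x. ideal_on UNIV H \<Longrightarrow> F \<subseteq> H \<Longrightarrow> x \<in> I \<Longrightarrow> (\<forall>i<k - j. x $ i = 0) \<Longrightarrow> x \<in> H"
        by metis
      define l where "l = k - Suc j"
      show ?case
      proof (cases "j < k \<and> (\<exists>f\<in>I. (\<forall>i<l. f $ i = 0) \<and> f $ l \<noteq> 0)")
        case True
        have "j < k" using True by blast
        then have kj: "k - j = Suc l" by (simp add: l_def)
        define Q where "Q f \<longleftrightarrow> f \<in> I \<and> (\<forall>i<l. f $ i = 0) \<and> f $ l \<noteq> 0" for f
        obtain f0 where "Q f0" using True by (auto simp: Q_def)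
        from ex_has_least_nat[of Q, OF this, of "\<lambda>f. subdegree (f $ l)"]
        obtain f where Qf: "Q f" "\<And>y. Q y \<Longrightarrow> subdegree (f $ l) \<le> subdegree (y $ l)" by blast
        then have f: "f \<in> I" "\<forall>i<l. f $ i = 0" "f $ l \<noteq> 0"
          "\<And>y. y \<in> I \<Longrightarrow> \<forall>i<l. y $ i = 0 \<Longrightarrow> y $ l \<noteq> 0 \<Longrightarrow> subdegree (f $ l) \<le> subdegree (y $ l)"
          by (simp_all add: Q_def)
        show ?thesis
        proof (intro exI[of _ "insert f F"] conjI allI impI)
          fix H x assume H: "ideal_on UNIV H" "insert f F \<subseteq> H" and x: "x \<in> I" "\<forall>i<k - Suc j. x $ i = 0"
          have "f $ l dvd x $ l"
            using f(3,4) x by (cases "x $ l = 0") (auto simp: fps_dvd_iff l_def)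
          then obtain c where c: "x $ l = f $ l * c" by (auto elim: dvdE)
          define y where "y = x - fps_const c * f"
          have "y \<in> I" unfolding y_def
            using ideal_on_diff[OF I subring_on_UNIV x(1)] ideal_onD(4)[OF I _ f(1)] by blast
          moreover have "\<forall>i<k - j. y $ i = 0"
            unfolding kj y_def using f(2) x(2) c by (auto simp: less_Suc_eq mult.commute l_def)
          ultimately have "y \<in> H" using F(3) H by blast
          moreover have "fps_const c * f \<in> H" using ideal_onD(4)[OF H(1)] H(2) by blast
          ultimately have "y + fps_const c * f \<in> H" using ideal_onD(3)[OF H(1)] by blast
          then show "x \<in> H" by (simp add: y_def)
        qed (use F f in auto)
      next
        case False
        have "\<forall>i<k - j. x $ i = 0" if x: "x \<in> I" "\<forall>i<k - Suc j. x $ i = 0" for x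
        proof (intro allI impI)
          fix i assume i: "i < k - j"
          then have "j < k" by simp
          then have "x $ l = 0" using False x by (auto simp: l_def)
          moreover have "i < l \<or> i = l" using i by (auto simp: l_def)
          ultimately show "x $ i = 0" using x(2) by (auto simp: l_def)
        qed
        then show ?thesis using F by (intro exI[of _ F]) blast
      qed
    qed
    from this[of k] show ?thesis by (auto simp: subset_eq)
  qed
qed

subsection \<open>Unique factorisation\<close>

lemma is_unit_power_series:
  fixes r :: power_series_uv
  assumes "r $ 0 \<noteq> 0" "subdegree (r $ 0) = 0"
  shows "r dvd 1"
  using power_series_division[OF assms(1), of 1] assms(2) by auto

lemma u_dvd_iff: "fps_X dvd x \<longleftrightarrow> x $ 0 = 0" for x :: power_series_uv
proof
  assume "x $ 0 = 0"
  then have "x = fps_X * fps_shift 1 x" by (intro fps_ext) (auto simp: )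
  then show "fps_X dvd x" by (metis dvd_triv_left)
qed (auto elim!: dvdE)

lemma prime_elem_u: "prime_elem (fps_X :: power_series_uv)"
  by (rule prime_elemI) (auto simp: u_dvd_iff)

text \<open>If \<open>u\<close> does not divide the irreducible \<open>r\<close> and \<open>r\<close> does not divide \<open>b\<close>, then the ideal generated by
  \<open>r\<close> and \<open>b\<close> contains a power of \<open>u\<close>; this power can be cancelled from \<open>r\<close> dividing a multiple of it.\<close>

lemma power_series_irreducible_imp_prime:
  fixes r :: power_series_uv
  assumes r: "Factorial_Ring.irreducible r"
  shows "prime_elem r"
proof (cases "fps_X dvd r")
  case True
  then obtain s where s: "r = fps_X * s" by (auto elim: dvdE)
  then have "s dvd 1"
    using r prime_elem_u by (auto simp: Factorial_Ring.irreducible_def prime_elem_def)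
  then obtain t where t: "s * t = 1" by (metis dvdE)
  have "r dvd y \<longleftrightarrow> fps_X dvd y" for y
  proof
    assume "fps_X dvd y"
    then obtain z where "y = fps_X * z" by (auto elim: dvdE)
    then have "y = fps_X * ((s * t) * z)" by (simp add: t)
    then have "y = r * (t * z)" by (simp only: s mult.assoc)
    then show "r dvd y" by simp
  qed (auto simp: s elim: dvd_mult_left)
  then show ?thesis
    using prime_elem_u r unfolding prime_elem_def Factorial_Ring.irreducible_def by blast
next
  case False
  show ?thesis
  proof (rule prime_elemI)
    fix a b assume "r dvd a * b"
    show "r dvd a \<or> r dvd b"
    proof (rule disjCI)
      assume nb: "\<not> r dvd b"
      let ?I = "{x * r + y * b | x y. True}"
      have mem: "x * r + y * b \<in> ?I" for x y by blast
      have I: "ideal_on UNIV ?I"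
      proof (rule ideal_onI)
        show "0 \<in> ?I" using mem[of 0 0] by simp
        fix p q assume "p \<in> ?I" "q \<in> ?I"
        then obtain x y x' y' where "p = x * r + y * b" "q = x' * r + y' * b" by blast
        then have "p + q = (x + x') * r + (y + y') * b" by (simp add: algebra_simps)
        then show "p + q \<in> ?I" by blast
      next
        fix s p assume "p \<in> ?I"
        then obtain x y where "p = x * r + y * b" by blast
        then have "s * p = (s * x) * r + (s * y) * b" by (simp add: algebra_simps)
        then show "s * p \<in> ?I" by blast
      qed simp
      have rb: "r \<in> ?I" "b \<in> ?I" using mem[of 1 0] mem[of 0 1] by auto
      moreover have "r \<noteq> 0" using r by (simp add: Factorial_Ring.irreducible_def)
      ultimately have nz: "?I \<noteq> {0}" by blast
      then obtain g k where g: "g $ 0 \<noteq> 0" "fps_X ^ k * g \<in> ?I" "\<forall>x\<in>?I. g dvd x"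
        using power_series_ideal[OF I nz] by (elim exE conjE) (rule that)
      obtain f where f: "r = g * f" using g(3) rb(1) by (auto elim: dvdE)
      have "\<not> f dvd 1"
      proof
        assume "f dvd 1"
        then have "r dvd g" by (simp add: f)
        then show False using g(3) rb(2) nb dvd_trans by blast
      qed
      then have "g dvd 1" using r f by (auto simp: Factorial_Ring.irreducible_def)
      then obtain g' where g': "g * g' = 1" by (metis dvdE)
      obtain x y where xy: "fps_X ^ k * g = x * r + y * b" using g(2) by blast
      have "fps_X ^ k * a = (fps_X ^ k * g) * g' * a" using g' by (simp add: mult.assoc)
      also have "\<dots> = r * (x * g' * a) + (a * b) * (y * g')" unfolding xy by (simp add: algebra_simps)
      finally have "r dvd fps_X ^ k * a" using \<open>r dvd a * b\<close> by simp
      then obtain z where z: "fps_X ^ k * a = r * z" by (auto elim: dvdE)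
      have "fps_X ^ k dvd z"
      proof -
        have "r $ 0 \<noteq> 0" using False by (simp add: u_dvd_iff)
        show ?thesis
        proof (cases "z = 0")
          case False
          have r0: "r \<noteq> 0" using \<open>r $ 0 \<noteq> 0\<close> by auto
          have "r * z \<noteq> 0" using r0 False by simp
          then have "a \<noteq> 0" using z by auto
          then have "k \<le> subdegree (fps_X ^ k * a)" by simp
          also have "\<dots> = subdegree z" unfolding z using False r0 \<open>r $ 0 \<noteq> 0\<close> by simp
          finally have "z = fps_shift k z * fps_X ^ k" by (simp add: fps_shift_times_fps_X_power)
          then show ?thesis by (metis dvd_triv_right)
        qed simp
      qed
      then obtain z' where "z = fps_X ^ k * z'" by (auto elim: dvdE)
      then have "fps_X ^ k * a = fps_X ^ k * (r * z')" using z by (simp add: algebra_simps)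
      then have "a = r * z'" by simp
      then show "r dvd a" by simp
    qed
  qed (use r in \<open>auto simp: Factorial_Ring.irreducible_def\<close>)
qed

text \<open>An additive size which is \<open>0\<close> exactly for the units among the nonzero series.\<close>

definition series_size :: "power_series_uv \<Rightarrow> nat"
  where "series_size r = subdegree r + low_order r"

lemma series_size_mult:
  assumes "a \<noteq> 0" "b \<noteq> 0" shows "series_size (a * b) = series_size a + series_size b"
  using assms by (simp add: series_size_def)

lemma series_size_0_imp_unit:
  assumes "r \<noteq> 0" "series_size r = 0" shows "r dvd 1"
  using assms by (intro is_unit_power_series) (auto simp: series_size_def subdegree_eq_0_iff)

lemma power_series_prime_factors:
  fixes r :: power_series_uv
  assumes "r \<noteq> 0"
  shows "r \<in> products_on UNIV {p. prime_elem p}"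
  using assms
  by (intro product_of_irreducibles[where size = series_size] series_size_mult series_size_0_imp_unit)
    (simp_all add: power_series_irreducible_imp_prime)

section \<open>A criterion for faithful flatness\<close>

text \<open>On formal sums, the map \<open>n \<otimes> y \<mapsto> \<phi>(y) n\<close> from \<open>N \<otimes> A\<close> to \<open>N\<close> for a functional \<open>\<phi> : A \<rightarrow> R\<close>. It is defined for
  every function \<open>\<phi>\<close>; linearity of \<open>\<phi>\<close> is only used where a relation is to be killed.\<close>

definition contract ::
    "('r, 'n, 'z) module_scheme \<Rightarrow> 'm set \<Rightarrow> ('m \<Rightarrow> 'r) \<Rightarrow> ('n \<times> 'm \<Rightarrow>\<^sub>0 int) \<Rightarrow> 'n"
  where "contract N A \<phi> = (SOME h. h \<in> hom (free_Abelian_group (carrier N \<times> A)) (add_monoid N) \<and>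
    (\<forall>n\<in>carrier N. \<forall>y\<in>A. h (frag_of (n, y)) = \<phi> y \<odot>\<^bsub>N\<^esub> n))"

context
  fixes S A :: "'a::comm_ring_1 set"
  assumes S: "subring_on S" and A: "subring_on A" and SA: "S \<subseteq> A"
begin

lemma carrier_ring_on: "carrier (ring_on S) = S"
  by simp

lemma module_on_simps [simp]:
  "carrier (module_on A) = A" "x \<oplus>\<^bsub>module_on A\<^esub> y = x + y" "\<zero>\<^bsub>module_on A\<^esub> = 0"
  "x \<odot>\<^bsub>module_on A\<^esub> y = x * y"
  by (simp_all add: module_on_def)

lemma module_module_on: "module (ring_on S) (module_on A)"
proof -
  note cl = subring_on_closed[OF A]
  interpret R: cring "ring_on S" by (rule cring_ring_on[OF S])
  have "\<exists>y\<in>A. x + y = 0" if "x \<in> A" for x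
    using cl(5)[OF that] by (intro bexI[of _ "- x"]) auto
  then have ag: "abelian_group (module_on A)"
    using cl by (intro abelian_groupI) (auto simp: algebra_simps)
  show ?thesis
    by (rule moduleI[OF R.cring_axioms ag]) (use SA cl in \<open>auto simp: algebra_simps subset_eq\<close>)
qed

context
  fixes N :: "('a, 'n, 'z) module_scheme"
  assumes N: "module (ring_on S) N"
begin

interpretation N: module "ring_on S" N by (rule N)

lemma contract_props:
  assumes \<phi>: "\<And>y. y \<in> A \<Longrightarrow> \<phi> y \<in> S"
  shows "contract N A \<phi> \<in> hom (free_Abelian_group (carrier N \<times> A)) (add_monoid N)"
    and "n \<in> carrier N \<Longrightarrow> y \<in> A \<Longrightarrow> contract N A \<phi> (frag_of (n, y)) = \<phi> y \<odot>\<^bsub>N\<^esub> n"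
proof -
  interpret G: comm_group "add_monoid N" by (rule N.a_comm_group)
  let ?P = "\<lambda>h. h \<in> hom (free_Abelian_group (carrier N \<times> A)) (add_monoid N) \<and>
    (\<forall>n\<in>carrier N. \<forall>y\<in>A. h (frag_of (n, y)) = \<phi> y \<odot>\<^bsub>N\<^esub> n)"
  have im: "(\<lambda>(n, y). \<phi> y \<odot>\<^bsub>N\<^esub> n) ` (carrier N \<times> A) \<subseteq> carrier (add_monoid N)"
    using \<phi> N.smult_closed by auto
  obtain h where h: "h \<in> hom (free_Abelian_group (carrier N \<times> A)) (add_monoid N)"
    "\<And>x. x \<in> carrier N \<times> A \<Longrightarrow> h (frag_of x) = (\<lambda>(n, y). \<phi> y \<odot>\<^bsub>N\<^esub> n) x"
    using comm_group.free_Abelian_group_universal[OF N.a_comm_group im] by metis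
  have "?P h" using h by auto
  then have "?P (contract N A \<phi>)" unfolding contract_def by (rule someI[of ?P h])
  then show "contract N A \<phi> \<in> hom (free_Abelian_group (carrier N \<times> A)) (add_monoid N)"
    "n \<in> carrier N \<Longrightarrow> y \<in> A \<Longrightarrow> contract N A \<phi> (frag_of (n, y)) = \<phi> y \<odot>\<^bsub>N\<^esub> n" by auto
qed

abbreviation (input) "formal x \<equiv> Poly_Mapping.keys x \<subseteq> carrier N \<times> A"

lemma contract_hom:
  assumes \<phi>: "\<And>y. y \<in> A \<Longrightarrow> \<phi> y \<in> S"
  shows "formal x \<Longrightarrow> contract N A \<phi> x \<in> carrier N"
    and "contract N A \<phi> 0 = \<zero>\<^bsub>N\<^esub>"
    and "formal x \<Longrightarrow> formal y \<Longrightarrow> contract N A \<phi> (x + y) = contract N A \<phi> x \<oplus>\<^bsub>N\<^esub> contract N A \<phi> y"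
    and "formal x \<Longrightarrow> formal y \<Longrightarrow> contract N A \<phi> (x - y) = contract N A \<phi> x \<ominus>\<^bsub>N\<^esub> contract N A \<phi> y"
    and "formal x \<Longrightarrow> contract N A \<phi> (- x) = \<ominus>\<^bsub>N\<^esub> contract N A \<phi> x"
proof -
  interpret G: comm_group "add_monoid N" by (rule N.a_comm_group)
  interpret h: group_hom "free_Abelian_group (carrier N \<times> A)" "add_monoid N" "contract N A \<phi>"
    by (intro group_hom.intro group_hom_axioms.intro group_free_Abelian_group N.a_group
      contract_props(1) \<phi>)
  show 1: "formal x \<Longrightarrow> contract N A \<phi> x \<in> carrier N" for x
    using h.hom_closed[of x] by simp
  show "contract N A \<phi> 0 = \<zero>\<^bsub>N\<^esub>" using h.hom_one by simp
  show 2: "formal x \<Longrightarrow> formal y \<Longrightarrow> contract N A \<phi> (x + y) = contract N A \<phi> x \<oplus>\<^bsub>N\<^esub> contract N A \<phi> y" for x y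
    using h.hom_mult[of x y] by simp
  show 3: "formal x \<Longrightarrow> contract N A \<phi> (- x) = \<ominus>\<^bsub>N\<^esub> contract N A \<phi> x" for x
    using h.hom_inv[of x] by (simp add: a_inv_def)
  show "contract N A \<phi> (x - y) = contract N A \<phi> x \<ominus>\<^bsub>N\<^esub> contract N A \<phi> y" if "formal x" "formal y"
    using 2[of x "- y"] 3[of y] that by (simp add: a_minus_def)
qed

abbreviation (input) "K \<equiv> tensor_rel (ring_on S) N (module_on A)"

lemma tensor_rel_formal: "x \<in> K \<Longrightarrow> formal x"
  and tensor_rel_0: "0 \<in> K"
  and tensor_rel_add: "x \<in> K \<Longrightarrow> y \<in> K \<Longrightarrow> x + y \<in> K"
  and tensor_rel_uminus: "x \<in> K \<Longrightarrow> - x \<in> K"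
  and tensor_rel_diff: "x \<in> K \<Longrightarrow> y \<in> K \<Longrightarrow> x - y \<in> K"
proof -
  let ?G = "free_Abelian_group (carrier N \<times> A)"
  interpret G: comm_group ?G by (rule abelian_free_Abelian_group)
  have dk: "formal x \<Longrightarrow> formal y \<Longrightarrow> formal (x - y)" for x y :: "'n \<times> 'a \<Rightarrow>\<^sub>0 int"
    using keys_diff[of x y] by blast
  have sg: "subgroup K ?G"
    unfolding tensor_rel_def module_on_simps
  proof (rule G.generate_is_subgroup, intro Un_least subsetI)
    fix z assume "z \<in> {frag_of (x \<oplus>\<^bsub>N\<^esub> x', y) - frag_of (x, y) - frag_of (x', y) | x x' y.
        x \<in> carrier N \<and> x' \<in> carrier N \<and> y \<in> A}"
    then obtain x x' y where z: "z = frag_of (x \<oplus>\<^bsub>N\<^esub> x', y) - frag_of (x, y) - frag_of (x', y)"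
      "x \<in> carrier N" "x' \<in> carrier N" "y \<in> A" by blast
    have "formal z" unfolding z(1) by (intro dk) (use z in auto)
    then show "z \<in> carrier ?G" by simp
  next
    fix z assume "z \<in> {frag_of (x, y + y') - frag_of (x, y) - frag_of (x, y') | x y y'.
        x \<in> carrier N \<and> y \<in> A \<and> y' \<in> A}"
    then obtain x y y' where z: "z = frag_of (x, y + y') - frag_of (x, y) - frag_of (x, y')"
      "x \<in> carrier N" "y \<in> A" "y' \<in> A" by blast
    have "formal z" unfolding z(1) by (intro dk) (use z subring_on_add[OF A] in auto)
    then show "z \<in> carrier ?G" by simp
  next
    fix z assume "z \<in> {frag_of (r \<odot>\<^bsub>N\<^esub> x, y) - frag_of (x, r * y) | r x y.
        r \<in> carrier (ring_on S) \<and> x \<in> carrier N \<and> y \<in> A}"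
    then obtain r x y where z: "z = frag_of (r \<odot>\<^bsub>N\<^esub> x, y) - frag_of (x, r * y)"
      "r \<in> S" "x \<in> carrier N" "y \<in> A" unfolding carrier_ring_on by blast
    have "r * y \<in> A" using subring_on_mult[OF A] SA z(2,4) by blast
    then have "formal z" unfolding z(1) by (intro dk) (use z in auto)
    then show "z \<in> carrier ?G" by simp
  qed
  show f: "x \<in> K \<Longrightarrow> formal x" for x using subgroup.mem_carrier[OF sg, of x] by simp
  show "0 \<in> K" using subgroup.one_closed[OF sg] by simp
  show a: "x \<in> K \<Longrightarrow> y \<in> K \<Longrightarrow> x + y \<in> K" for x y using subgroup.m_closed[OF sg, of x y] by simp
  show u: "x \<in> K \<Longrightarrow> - x \<in> K" for x using subgroup.m_inv_closed[OF sg, of x] f[of x] by simp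
  show "x \<in> K \<Longrightarrow> y \<in> K \<Longrightarrow> x - y \<in> K" for x y using a[of x "- y"] u[of y] by simp
qed

lemma tensor_rel_gens:
  shows "x \<in> carrier N \<Longrightarrow> x' \<in> carrier N \<Longrightarrow> y \<in> A \<Longrightarrow>
      frag_of (x \<oplus>\<^bsub>N\<^esub> x', y) - frag_of (x, y) - frag_of (x', y) \<in> K"
    and "x \<in> carrier N \<Longrightarrow> y \<in> A \<Longrightarrow> y' \<in> A \<Longrightarrow>
      frag_of (x, y + y') - frag_of (x, y) - frag_of (x, y') \<in> K"
    and "r \<in> S \<Longrightarrow> x \<in> carrier N \<Longrightarrow> y \<in> A \<Longrightarrow>
      frag_of (r \<odot>\<^bsub>N\<^esub> x, y) - frag_of (x, r * y) \<in> K"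
  unfolding tensor_rel_def module_on_simps carrier_ring_on
  by (rule generate.incl, blast)+

lemma tensor_rel_zero_left:
  assumes "y \<in> A" shows "frag_of (\<zero>\<^bsub>N\<^esub>, y) \<in> K"
  using tensor_rel_uminus[OF tensor_rel_gens(1)[of "\<zero>\<^bsub>N\<^esub>" "\<zero>\<^bsub>N\<^esub>" y]] assms by simp

lemma tensor_rel_zero_right:
  assumes "x \<in> carrier N" shows "frag_of (x, 0) \<in> K"
  using tensor_rel_uminus[OF tensor_rel_gens(2)[of x 0 0]] assms subring_on_0[OF A] by simp

lemma tensor_rel_minus_left:
  assumes "x \<in> carrier N" "x' \<in> carrier N" "y \<in> A"
  shows "frag_of (x \<ominus>\<^bsub>N\<^esub> x', y) - frag_of (x, y) + frag_of (x', y) \<in> K"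
proof -
  have "(x \<ominus>\<^bsub>N\<^esub> x') \<oplus>\<^bsub>N\<^esub> x' = x" using assms by (simp add: a_minus_def N.a_assoc N.l_neg)
  then have "frag_of (x, y) - frag_of (x \<ominus>\<^bsub>N\<^esub> x', y) - frag_of (x', y) \<in> K"
    using tensor_rel_gens(1)[of "x \<ominus>\<^bsub>N\<^esub> x'" x' y] assms by simp
  from tensor_rel_uminus[OF this] show ?thesis by (simp add: algebra_simps)
qed

lemma tensor_rel_sum_right:
  assumes "finite J" "n \<in> carrier N" "\<And>j. j \<in> J \<Longrightarrow> r j \<in> S" "\<And>j. j \<in> J \<Longrightarrow> e j \<in> A"
  shows "frag_of (n, \<Sum>j\<in>J. r j * e j) - (\<Sum>j\<in>J. frag_of (r j \<odot>\<^bsub>N\<^esub> n, e j)) \<in> K"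
  using assms(1,3,4)
proof (induction J rule: finite_induct)
  case empty
  then show ?case using tensor_rel_zero_right assms by simp
next
  case (insert j J)
  let ?s = "\<Sum>j\<in>J. r j * e j"
  have re: "r i * e i \<in> A" if "i \<in> insert j J" for i
    using insert.prems[OF that] SA subring_on_mult[OF A] by blast
  have "?s \<in> A" using re by (intro subring_on_sum[OF A]) auto
  then have h1: "frag_of (n, r j * e j + ?s) - frag_of (n, r j * e j) - frag_of (n, ?s) \<in> K"
    using re assms by (intro tensor_rel_gens(2)) auto
  have h2: "frag_of (r j \<odot>\<^bsub>N\<^esub> n, e j) - frag_of (n, r j * e j) \<in> K"
    using insert assms by (intro tensor_rel_gens(3)) auto
  have h3: "frag_of (n, ?s) - (\<Sum>j\<in>J. frag_of (r j \<odot>\<^bsub>N\<^esub> n, e j)) \<in> K"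
    using insert.IH insert.prems by auto
  show ?case
    using tensor_rel_add[OF tensor_rel_diff[OF h1 h2] h3] insert(1,2) by (simp add: algebra_simps)
qed

lemma tensor_rel_sum: "(\<And>j. j \<in> J \<Longrightarrow> f j \<in> K) \<Longrightarrow> (\<Sum>j\<in>J. f j) \<in> K"
  by (induction J rule: infinite_finite_induct) (auto simp: tensor_rel_0 tensor_rel_add)

text \<open>A formal sum is determined modulo the relations by its contractions, provided that the
  functionals express the identity of \<open>A\<close> on the elements involved.\<close>

lemma contract_decompose:
  assumes J: "\<And>s. finite (J s)" and e: "\<And>s j. e s j \<in> A"
    and \<phi>: "\<And>s j y. y \<in> A \<Longrightarrow> \<phi> s j y \<in> S"
    and rep: "\<And>y. y \<in> A \<Longrightarrow> \<forall>\<^sub>F s in sequentially. y = (\<Sum>j\<in>J s. \<phi> s j y * e s j)"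
    and x: "formal x"
  shows "\<forall>\<^sub>F s in sequentially. x - (\<Sum>j\<in>J s. frag_of (contract N A (\<phi> s j) x, e s j)) \<in> K"
  using x
proof (induction x rule: free_Abelian_group_induct[consumes 1, case_names zero diff gen])
  case zero
  have "(\<Sum>j\<in>J s. frag_of (contract N A (\<phi> s j) 0, e s j)) \<in> K" for s
    using \<phi> e by (intro tensor_rel_sum) (simp add: contract_hom tensor_rel_zero_left)
  then show ?case using tensor_rel_uminus by simp
next
  case (diff x y)
  show ?case using diff(3,4)
  proof eventually_elim
    case (elim s)
    let ?c = "\<lambda>j. contract N A (\<phi> s j)"
    have "frag_of (?c j (x - y), e s j) - frag_of (?c j x, e s j) + frag_of (?c j y, e s j) \<in> K" for j
      using tensor_rel_minus_left[of "?c j x" "?c j y" "e s j"] contract_hom[of "\<phi> s j"] diff(1,2) \<phi> e by simp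
    then have "(\<Sum>j\<in>J s. frag_of (?c j (x - y), e s j) - frag_of (?c j x, e s j) + frag_of (?c j y, e s j)) \<in> K"
      by (intro tensor_rel_sum)
    from tensor_rel_diff[OF tensor_rel_diff[OF elim] this] show ?case
      by (simp add: sum.distrib sum_subtractf algebra_simps)
  qed
next
  case (gen a)
  obtain n y where a: "a = (n, y)" "n \<in> carrier N" "y \<in> A" using gen by auto
  show ?case using rep[OF a(3)]
  proof eventually_elim
    case (elim s)
    have "frag_of (n, \<Sum>j\<in>J s. \<phi> s j y * e s j) -
        (\<Sum>j\<in>J s. frag_of (\<phi> s j y \<odot>\<^bsub>N\<^esub> n, e s j)) \<in> K"
      using J a \<phi> e by (intro tensor_rel_sum_right) auto
    then show ?case
      unfolding a(1) using elim[symmetric] a \<phi> by (simp add: contract_props)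
  qed
qed

text \<open>Functionals that are linear up to finitely many terms of the sequence kill relations, again
  up to finitely many terms.\<close>

lemma contract_kills:
  assumes \<phi>: "\<And>s j y. y \<in> A \<Longrightarrow> \<phi> s j y \<in> S"
    and add: "\<And>y y'. y \<in> A \<Longrightarrow> y' \<in> A \<Longrightarrow>
      \<forall>\<^sub>F s in sequentially. \<forall>j\<in>J s. \<phi> s j (y + y') = \<phi> s j y + \<phi> s j y'"
    and smult: "\<And>r y. r \<in> S \<Longrightarrow> y \<in> A \<Longrightarrow>
      \<forall>\<^sub>F s in sequentially. \<forall>j\<in>J s. \<phi> s j (r * y) = r * \<phi> s j y"
    and x: "x \<in> K"
  shows "\<forall>\<^sub>F s in sequentially. \<forall>j\<in>J s. contract N A (\<phi> s j) x = \<zero>\<^bsub>N\<^esub>"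
proof -
  have dk: "formal x \<Longrightarrow> formal y \<Longrightarrow> formal (x - y)" for x y :: "'n \<times> 'a \<Rightarrow>\<^sub>0 int"
    using keys_diff[of x y] by blast
  have c: "contract N A (\<phi> s j) (frag_of (n, y)) = \<phi> s j y \<odot>\<^bsub>N\<^esub> n" if "n \<in> carrier N" "y \<in> A" for s j n y
    using contract_props(2)[of "\<phi> s j"] \<phi> that by simp
  have d: "contract N A (\<phi> s j) (x - y) = contract N A (\<phi> s j) x \<ominus>\<^bsub>N\<^esub> contract N A (\<phi> s j) y"
    if "formal x" "formal y" for x y s j using contract_hom(4)[of "\<phi> s j"] \<phi> that by simp
  have gen: "\<forall>\<^sub>F s in sequentially. \<forall>j\<in>J s. contract N A (\<phi> s j) g = \<zero>\<^bsub>N\<^esub>"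
    if "g \<in> {frag_of (x \<oplus>\<^bsub>N\<^esub> x', y) - frag_of (x, y) - frag_of (x', y) | x x' y.
        x \<in> carrier N \<and> x' \<in> carrier N \<and> y \<in> carrier (module_on A)} \<union>
     {frag_of (x, y \<oplus>\<^bsub>module_on A\<^esub> y') - frag_of (x, y) - frag_of (x, y') | x y y'.
        x \<in> carrier N \<and> y \<in> carrier (module_on A) \<and> y' \<in> carrier (module_on A)} \<union>
     {frag_of (r \<odot>\<^bsub>N\<^esub> x, y) - frag_of (x, r \<odot>\<^bsub>module_on A\<^esub> y) | r x y.
        r \<in> carrier (ring_on S) \<and> x \<in> carrier N \<and> y \<in> carrier (module_on A)}" for g
    using that
  proof (elim UnE CollectE exE conjE)
    fix x x' y assume g: "g = frag_of (x \<oplus>\<^bsub>N\<^esub> x', y) - frag_of (x, y) - frag_of (x', y)"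
      and xy: "x \<in> carrier N" "x' \<in> carrier N" "y \<in> carrier (module_on A)"
    have "contract N A (\<phi> s j) g = \<zero>\<^bsub>N\<^esub>" for s j
      unfolding g using xy \<phi>[of y s j]
      by (simp add: d c dk N.smult_r_distr a_minus_def) (simp add: N.a_ac N.r_neg N.r_neg1 N.r_neg2)
    then show ?thesis by simp
  next
    fix x y y' assume g: "g = frag_of (x, y \<oplus>\<^bsub>module_on A\<^esub> y') - frag_of (x, y) - frag_of (x, y')"
      and xy: "x \<in> carrier N" "y \<in> carrier (module_on A)" "y' \<in> carrier (module_on A)"
    have yy: "y \<in> A" "y' \<in> A" "y + y' \<in> A" using xy subring_on_add[OF A] by auto
    show ?thesis using add[OF yy(1,2)]
    proof eventually_elim
      case (elim s)
      show ?case
      proof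
        fix j assume "j \<in> J s"
        then have "\<phi> s j (y + y') = \<phi> s j y + \<phi> s j y'" using elim by blast
        moreover have "(\<phi> s j y + \<phi> s j y') \<odot>\<^bsub>N\<^esub> x = \<phi> s j y \<odot>\<^bsub>N\<^esub> x \<oplus>\<^bsub>N\<^esub> \<phi> s j y' \<odot>\<^bsub>N\<^esub> x"
          using N.smult_l_distr[of "\<phi> s j y" "\<phi> s j y'" x] \<phi> yy xy by simp
        ultimately show "contract N A (\<phi> s j) g = \<zero>\<^bsub>N\<^esub>"
          unfolding g using xy yy \<phi>[of y s j] \<phi>[of y' s j]
          by (simp add: d c dk a_minus_def) (simp add: N.a_ac N.r_neg N.r_neg1 N.r_neg2)
      qed
    qed
  next
    fix r x y assume g: "g = frag_of (r \<odot>\<^bsub>N\<^esub> x, y) - frag_of (x, r \<odot>\<^bsub>module_on A\<^esub> y)"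
      and xy: "r \<in> carrier (ring_on S)" "x \<in> carrier N" "y \<in> carrier (module_on A)"
    have yy: "y \<in> A" "r \<in> S" "r * y \<in> A" using xy subring_on_mult[OF A] SA by auto
    show ?thesis using smult[OF yy(2,1)]
    proof eventually_elim
      case (elim s)
      show ?case
      proof
        fix j assume "j \<in> J s"
        then have "\<phi> s j (r * y) = \<phi> s j y * r" using elim by (simp add: mult.commute)
        moreover have "(\<phi> s j y * r) \<odot>\<^bsub>N\<^esub> x = \<phi> s j y \<odot>\<^bsub>N\<^esub> (r \<odot>\<^bsub>N\<^esub> x)"
          using N.smult_assoc1[of "\<phi> s j y" r x] \<phi> yy xy by simp
        ultimately show "contract N A (\<phi> s j) g = \<zero>\<^bsub>N\<^esub>"
          unfolding g using xy yy \<phi>[of y s j] N.smult_closed[of r x]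
          by (simp add: d c dk a_minus_def N.r_neg)
      qed
    qed
  qed
  have "(\<forall>\<^sub>F s in sequentially. \<forall>j\<in>J s. contract N A (\<phi> s j) x = \<zero>\<^bsub>N\<^esub>) \<and> formal x"
    using x[unfolded tensor_rel_def]
  proof (induction rule: generate.induct)
    case one
    then show ?case using contract_hom(2) \<phi> by simp
  next
    case (incl g)
    have "g \<in> K" unfolding tensor_rel_def using incl by (rule generate.incl)
    then show ?case using gen[OF incl] tensor_rel_formal by blast
  next
    case (inv g)
    have "g \<in> K" unfolding tensor_rel_def using inv by (rule generate.incl)
    then have f: "formal g" by (rule tensor_rel_formal)
    from gen[OF inv] have "\<forall>\<^sub>F s in sequentially. \<forall>j\<in>J s. contract N A (\<phi> s j) (- g) = \<zero>\<^bsub>N\<^esub>"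
      by eventually_elim (use contract_hom(5)[OF _ f] \<phi> in simp)
    then show ?case using f by simp
  next
    case (eng a b)
    then have f: "formal a" "formal b" by auto
    from eng have "\<forall>\<^sub>F s in sequentially. (\<forall>j\<in>J s. contract N A (\<phi> s j) a = \<zero>\<^bsub>N\<^esub>) \<and>
        (\<forall>j\<in>J s. contract N A (\<phi> s j) b = \<zero>\<^bsub>N\<^esub>)"
      by (intro eventually_conj) auto
    then have "\<forall>\<^sub>F s in sequentially. \<forall>j\<in>J s. contract N A (\<phi> s j) (a + b) = \<zero>\<^bsub>N\<^esub>"
      by eventually_elim (use contract_hom(3)[OF _ f] \<phi> in simp)
    then show ?case using f keys_add[of a b] by auto
  qed
  then show ?thesis ..
qed

end

lemma contract_natural:
  fixes N :: "('a, 'n, 'z) module_scheme" and N' :: "('a, 'n2, 'z2) module_scheme"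
  assumes N: "module (ring_on S) N" and N': "module (ring_on S) N'"
    and g: "g \<in> module_homs (ring_on S) N N'"
    and \<phi>: "\<And>y. y \<in> A \<Longrightarrow> \<phi> y \<in> S"
    and x: "Poly_Mapping.keys x \<subseteq> carrier N \<times> A"
  shows "Poly_Mapping.keys (frag_extend (\<lambda>(x, y). frag_of (g x, y)) x) \<subseteq> carrier N' \<times> A \<and>
    contract N' A \<phi> (frag_extend (\<lambda>(x, y). frag_of (g x, y)) x) = g (contract N A \<phi> x)"
proof -
  interpret N: module "ring_on S" N by (rule N)
  interpret N': module "ring_on S" N' by (rule N')
  have gc: "a \<in> carrier N \<Longrightarrow> g a \<in> carrier N'"
    and gadd: "a \<in> carrier N \<Longrightarrow> b \<in> carrier N \<Longrightarrow> g (a \<oplus>\<^bsub>N\<^esub> b) = g a \<oplus>\<^bsub>N'\<^esub> g b"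
    and gs: "r \<in> S \<Longrightarrow> a \<in> carrier N \<Longrightarrow> g (r \<odot>\<^bsub>N\<^esub> a) = r \<odot>\<^bsub>N'\<^esub> g a" for a b r
    using g by (auto simp: module_homs_def)
  have "g \<zero>\<^bsub>N\<^esub> \<oplus>\<^bsub>N'\<^esub> g \<zero>\<^bsub>N\<^esub> = g \<zero>\<^bsub>N\<^esub>"
    using gadd[of "\<zero>\<^bsub>N\<^esub>" "\<zero>\<^bsub>N\<^esub>"] by simp
  then have g0: "g \<zero>\<^bsub>N\<^esub> = \<zero>\<^bsub>N'\<^esub>"
    using N'.r_neg1[of "g \<zero>\<^bsub>N\<^esub>" "g \<zero>\<^bsub>N\<^esub>"] N'.l_neg[of "g \<zero>\<^bsub>N\<^esub>"] gc[of "\<zero>\<^bsub>N\<^esub>"] by simp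
  have gd: "g (a \<ominus>\<^bsub>N\<^esub> b) = g a \<ominus>\<^bsub>N'\<^esub> g b" if ab: "a \<in> carrier N" "b \<in> carrier N" for a b
  proof -
    have "g a = g ((a \<ominus>\<^bsub>N\<^esub> b) \<oplus>\<^bsub>N\<^esub> b)" using ab by (simp add: a_minus_def N.a_assoc N.l_neg)
    also have "\<dots> = g (a \<ominus>\<^bsub>N\<^esub> b) \<oplus>\<^bsub>N'\<^esub> g b" using ab by (intro gadd) auto
    finally show ?thesis using ab gc by (simp add: a_minus_def N'.a_assoc N'.r_neg)
  qed
  show ?thesis using x
  proof (induction x rule: free_Abelian_group_induct[consumes 1, case_names zero diff gen])
    case zero
    then show ?case by (simp add: contract_hom(2)[OF N] contract_hom(2)[OF N'] \<phi> g0)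
  next
    case (diff x y)
    let ?F = "frag_extend (\<lambda>(x, y). frag_of (g x, y))"
    have "Poly_Mapping.keys (?F x - ?F y) \<subseteq> carrier N' \<times> A"
      using diff(3,4) keys_diff[of "?F x" "?F y"] by blast
    then show ?case
      using diff \<phi> gd contract_hom(1)[OF N, of \<phi>]
      by (simp add: frag_extend_diff contract_hom(4)[OF N] contract_hom(4)[OF N'])
  next
    case (gen a)
    then show ?case using gc gs \<phi> contract_props(2)[OF N, of \<phi>] contract_props(2)[OF N', of \<phi>] by auto
  qed
qed

text \<open>Exactness of the tensored sequence in terms of formal sums instead of cosets of relations.\<close>

lemma exact_pair_tensor_iff:
  fixes N1 N2 N3 :: "('a, 'n) module"
  assumes N1: "module (ring_on S) N1" and N2: "module (ring_on S) N2" and N3: "module (ring_on S) N3"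
    and f: "f \<in> module_homs (ring_on S) N1 N2" and g: "g \<in> module_homs (ring_on S) N2 N3"
  defines "F \<equiv> frag_extend (\<lambda>(x, y). frag_of (f x, y))" and "G \<equiv> frag_extend (\<lambda>(x, y). frag_of (g x, y))"
  shows "exact_pair (tensor_product (ring_on S) N1 (module_on A)) (tensor_map (ring_on S) N2 (module_on A) f)
      (tensor_product (ring_on S) N2 (module_on A)) (tensor_map (ring_on S) N3 (module_on A) g)
      (tensor_product (ring_on S) N3 (module_on A)) \<longleftrightarrow>
    (\<forall>x :: 'n \<times> 'a \<Rightarrow>\<^sub>0 int. Poly_Mapping.keys x \<subseteq> carrier N1 \<times> A \<longrightarrow> G (F x) \<in> tensor_rel (ring_on S) N3 (module_on A)) \<and>
    (\<forall>x. Poly_Mapping.keys x \<subseteq> carrier N2 \<times> A \<longrightarrow> G x \<in> tensor_rel (ring_on S) N3 (module_on A) \<longrightarrow>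
      (\<exists>z. Poly_Mapping.keys z \<subseteq> carrier N1 \<times> A \<and> x - F z \<in> tensor_rel (ring_on S) N2 (module_on A)))"
proof -
  let ?K1 = "tensor_rel (ring_on S) N1 (module_on A)" and ?K2 = "tensor_rel (ring_on S) N2 (module_on A)"
    and ?K3 = "tensor_rel (ring_on S) N3 (module_on A)"
  have F: "Poly_Mapping.keys (F x) \<subseteq> carrier N2 \<times> A" if "Poly_Mapping.keys x \<subseteq> carrier N1 \<times> A" for x
    using contract_natural[OF N1 N2 f, of "\<lambda>_. 0"] that subring_on_0[OF S] unfolding F_def by blast
  define co where "co K' x = {k + x | k. k \<in> K'}" for K' and x :: "'n \<times> 'a \<Rightarrow>\<^sub>0 int"
  have cosets: "K' #>\<^bsub>tensor_free N' (module_on A)\<^esub> x = {k + x | k. k \<in> K'}"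
    for K' x and N' :: "('a, 'n) module"
    by (auto simp: r_coset_def)
  then have cosets': "K' #>\<^bsub>free_Abelian_group (carrier N' \<times> A)\<^esub> x = {k + x | k. k \<in> K'}"
    for K' x and N' :: "('a, 'n) module"
    by simp
  have eqc: "{k + x | k. k \<in> tensor_rel (ring_on S) N' (module_on A)} =
      {k + y | k. k \<in> tensor_rel (ring_on S) N' (module_on A)} \<longleftrightarrow> x - y \<in> tensor_rel (ring_on S) N' (module_on A)"
    if N': "module (ring_on S) N'" for x y and N' :: "('a, 'n) module"
  proof
    let ?K' = "tensor_rel (ring_on S) N' (module_on A)"
    assume eq: "{k + x | k. k \<in> ?K'} = {k + y | k. k \<in> ?K'}"
    have "0 + x \<in> {k + x | k. k \<in> ?K'}" using tensor_rel_0[OF N'] by blast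
    then obtain k where "k \<in> ?K'" "x = k + y" unfolding eq by auto
    then show "x - y \<in> ?K'" by simp
  next
    let ?K' = "tensor_rel (ring_on S) N' (module_on A)"
    assume d: "x - y \<in> ?K'"
    show "{k + x | k. k \<in> ?K'} = {k + y | k. k \<in> ?K'}"
    proof (intro equalityI subsetI)
      fix z assume "z \<in> {k + x | k. k \<in> ?K'}"
      then obtain k where "k \<in> ?K'" "z = (k + (x - y)) + y" by auto
      then show "z \<in> {k + y | k. k \<in> ?K'}" using tensor_rel_add[OF N' _ d] by blast
    next
      fix z assume "z \<in> {k + y | k. k \<in> ?K'}"
      then obtain k where "k \<in> ?K'" "z = (k - (x - y)) + x" by auto
      then show "z \<in> {k + x | k. k \<in> ?K'}" using tensor_rel_diff[OF N' _ d] by blast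
    qed
  qed
  have tp: "carrier (tensor_product (ring_on S) N' (module_on A)) =
      {co (tensor_rel (ring_on S) N' (module_on A)) x | x. Poly_Mapping.keys x \<subseteq> carrier N' \<times> A}"
    "\<one>\<^bsub>tensor_product (ring_on S) N' (module_on A)\<^esub> = co (tensor_rel (ring_on S) N' (module_on A)) 0"
    for N' :: "('a, 'n) module"
  proof -
    have "C \<in> carrier (tensor_product (ring_on S) N' (module_on A)) \<longleftrightarrow>
        (\<exists>x. C = co (tensor_rel (ring_on S) N' (module_on A)) x \<and> Poly_Mapping.keys x \<subseteq> carrier N' \<times> A)" for C
      unfolding tensor_product_def FactGroup_def RCOSETS_def by (auto simp: cosets' co_def) (rule exI, rule conjI, rule refl, assumption)
    then show "carrier (tensor_product (ring_on S) N' (module_on A)) =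
      {co (tensor_rel (ring_on S) N' (module_on A)) x | x. Poly_Mapping.keys x \<subseteq> carrier N' \<times> A}"
      by (simp only: set_eq_iff mem_Collect_eq simp_thms)
    show "\<one>\<^bsub>tensor_product (ring_on S) N' (module_on A)\<^esub> = co (tensor_rel (ring_on S) N' (module_on A)) 0"
      by (simp add: tensor_product_def FactGroup_def co_def)
  qed
  have TF: "tensor_map (ring_on S) N2 (module_on A) f (co ?K1 x) = co ?K2 (F x)" for x
    using tensor_map_coset[OF N1 module_module_on f, of x] unfolding cosets F_def co_def .
  have TG: "tensor_map (ring_on S) N3 (module_on A) g (co ?K2 x) = co ?K3 (G x)" for x
    using tensor_map_coset[OF N2 module_module_on g, of x] unfolding cosets G_def co_def .
  have "exact_pair (tensor_product (ring_on S) N1 (module_on A)) (tensor_map (ring_on S) N2 (module_on A) f)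
      (tensor_product (ring_on S) N2 (module_on A)) (tensor_map (ring_on S) N3 (module_on A) g)
      (tensor_product (ring_on S) N3 (module_on A)) \<longleftrightarrow>
    {co ?K2 (F x) | x :: 'n \<times> 'a \<Rightarrow>\<^sub>0 int. Poly_Mapping.keys x \<subseteq> carrier N1 \<times> A} =
    {co ?K2 x | x. Poly_Mapping.keys x \<subseteq> carrier N2 \<times> A \<and> co ?K3 (G x) = co ?K3 0}"
  proof -
    have "tensor_map (ring_on S) N2 (module_on A) f ` carrier (tensor_product (ring_on S) N1 (module_on A)) =
        {co ?K2 (F x) | x :: 'n \<times> 'a \<Rightarrow>\<^sub>0 int. Poly_Mapping.keys x \<subseteq> carrier N1 \<times> A}"
      unfolding tp(1) image_Collect TF[symmetric] by blast
    moreover have "kernel (tensor_product (ring_on S) N2 (module_on A)) (tensor_product (ring_on S) N3 (module_on A))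
        (tensor_map (ring_on S) N3 (module_on A) g) =
        {co ?K2 x | x. Poly_Mapping.keys x \<subseteq> carrier N2 \<times> A \<and> co ?K3 (G x) = co ?K3 0}"
      unfolding kernel_def tp TG[symmetric] by blast
    ultimately show ?thesis unfolding exact_pair_def by simp
  qed
  also have "\<dots> \<longleftrightarrow>
    (\<forall>x :: 'n \<times> 'a \<Rightarrow>\<^sub>0 int. Poly_Mapping.keys x \<subseteq> carrier N1 \<times> A \<longrightarrow> G (F x) \<in> ?K3) \<and>
    (\<forall>x. Poly_Mapping.keys x \<subseteq> carrier N2 \<times> A \<longrightarrow> G x \<in> ?K3 \<longrightarrow>
      (\<exists>z. Poly_Mapping.keys z \<subseteq> carrier N1 \<times> A \<and> x - F z \<in> ?K2))" (is "?L = ?R \<longleftrightarrow> ?c1 \<and> ?c2")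
  proof
    assume eq: "?L = ?R"
    show "?c1 \<and> ?c2"
    proof (intro conjI allI impI)
      fix x :: "'n \<times> 'a \<Rightarrow>\<^sub>0 int" assume "Poly_Mapping.keys x \<subseteq> carrier N1 \<times> A"
      then have "co ?K2 (F x) \<in> ?R" unfolding eq[symmetric] by blast
      then obtain y where y: "co ?K2 (F x) = co ?K2 y" "co ?K3 (G y) = co ?K3 0" by blast
      have "co ?K3 (G (F x)) = co ?K3 (G y)" unfolding TG[symmetric] y(1) ..
      then show "G (F x) \<in> ?K3" using y(2) eqc[OF N3, of "G (F x)" 0] by (simp add: co_def)
    next
      fix x assume x: "Poly_Mapping.keys x \<subseteq> carrier N2 \<times> A" "G x \<in> ?K3"
      then have "co ?K3 (G x) = co ?K3 0" using eqc[OF N3, of "G x" 0] by (simp add: co_def)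
      then have "co ?K2 x \<in> ?L" unfolding eq using x by blast
      then show "\<exists>z. Poly_Mapping.keys z \<subseteq> carrier N1 \<times> A \<and> x - F z \<in> ?K2"
        using eqc[OF N2] unfolding co_def by blast
    qed
  next
    assume c: "?c1 \<and> ?c2"
    show "?L = ?R"
    proof (intro equalityI subsetI)
      fix C assume "C \<in> ?L"
      then obtain x where x: "C = co ?K2 (F x)" "Poly_Mapping.keys x \<subseteq> carrier N1 \<times> A" by blast
      then have "G (F x) \<in> ?K3" using c by blast
      then have "co ?K3 (G (F x)) = co ?K3 0" using eqc[OF N3, of "G (F x)" 0] by (simp add: co_def)
      then show "C \<in> ?R" using x F by blast
    next
      fix C assume "C \<in> ?R"
      then obtain x where x: "C = co ?K2 x" "Poly_Mapping.keys x \<subseteq> carrier N2 \<times> A" "co ?K3 (G x) = co ?K3 0"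
        by blast
      then have "G x \<in> ?K3" using eqc[OF N3, of "G x" 0] by (simp add: co_def)
      then obtain z where z: "Poly_Mapping.keys z \<subseteq> carrier N1 \<times> A" "x - F z \<in> ?K2" using c x by blast
      then have "C = co ?K2 (F z)" using eqc[OF N2, of x "F z"] x by (simp add: co_def)
      then show "C \<in> ?L" using z by blast
    qed
  qed
  finally show ?thesis .
qed

text \<open>Flatness: if a formal sum \<open>x\<close> is mapped to a relation by \<open>g\<close>, then for some \<open>s\<close> all its contractions
  lie in the kernel of \<open>g\<close>, hence in the image of \<open>f\<close>, and they determine \<open>x\<close> modulo the relations. The
  functionals need only be linear eventually, so that coefficients with denominators are allowed as
  long as each element acquires integral coefficients for large \<open>s\<close>. Faithfulness: the retraction
  \<open>\<epsilon>\<close> makes \<open>n \<mapsto> n \<otimes> 1\<close> injective, compatibly with linear maps.\<close>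

theorem faithfully_flat_criterion:
  fixes T :: "'n itself" and J :: "nat \<Rightarrow> 'j set"
  assumes J: "\<And>s. finite (J s)" and e: "\<And>s j. e s j \<in> A"
    and \<phi>: "\<And>s j y. y \<in> A \<Longrightarrow> \<phi> s j y \<in> S"
    and add: "\<And>y y'. y \<in> A \<Longrightarrow> y' \<in> A \<Longrightarrow>
      \<forall>\<^sub>F s in sequentially. \<forall>j\<in>J s. \<phi> s j (y + y') = \<phi> s j y + \<phi> s j y'"
    and smult: "\<And>r y. r \<in> S \<Longrightarrow> y \<in> A \<Longrightarrow>
      \<forall>\<^sub>F s in sequentially. \<forall>j\<in>J s. \<phi> s j (r * y) = r * \<phi> s j y"
    and rep: "\<And>y. y \<in> A \<Longrightarrow> \<forall>\<^sub>F s in sequentially. y = (\<Sum>j\<in>J s. \<phi> s j y * e s j)"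
    and \<epsilon>: "\<And>y. y \<in> A \<Longrightarrow> \<epsilon> y \<in> S" "\<And>y y'. y \<in> A \<Longrightarrow> y' \<in> A \<Longrightarrow> \<epsilon> (y + y') = \<epsilon> y + \<epsilon> y'"
      "\<And>r y. r \<in> S \<Longrightarrow> y \<in> A \<Longrightarrow> \<epsilon> (r * y) = r * \<epsilon> y" "\<epsilon> 1 = 1"
  shows "faithfully_flat T (ring_on S) (module_on A)"
  unfolding faithfully_flat_def
proof (intro conjI module_module_on allI impI)
  fix N1 N2 N3 :: "('a, 'n) module" and f g
  assume N1: "module (ring_on S) N1" and N2: "module (ring_on S) N2" and N3: "module (ring_on S) N3"
    and f: "f \<in> module_homs (ring_on S) N1 N2" and g: "g \<in> module_homs (ring_on S) N2 N3"
  interpret N1: module "ring_on S" N1 by (rule N1)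
  interpret N2: module "ring_on S" N2 by (rule N2)
  interpret N3: module "ring_on S" N3 by (rule N3)
  let ?K1 = "tensor_rel (ring_on S) N1 (module_on A)" and ?K2 = "tensor_rel (ring_on S) N2 (module_on A)"
    and ?K3 = "tensor_rel (ring_on S) N3 (module_on A)"
  define F where "F = frag_extend (\<lambda>(x, y). frag_of (f x, y :: 'a))"
  define G where "G = frag_extend (\<lambda>(x, y). frag_of (g x, y :: 'a))"
  have fc: "f n \<in> carrier N2" if "n \<in> carrier N1" for n
    using f that by (auto simp: module_homs_def)
  have gc: "g n \<in> carrier N3" if "n \<in> carrier N2" for n
    using g that by (auto simp: module_homs_def)
  have ex: "exact_pair (add_monoid N1) f (add_monoid N2) g (add_monoid N3) \<longleftrightarrow>
      f ` carrier N1 = {n \<in> carrier N2. g n = \<zero>\<^bsub>N3\<^esub>}"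
    by (simp add: exact_pair_def kernel_def)
  have A1: "1 \<in> A" by (rule subring_on_1[OF A])
  have kill: "contract N A \<epsilon> x = \<zero>\<^bsub>N\<^esub>"
    if N: "module (ring_on S) N" "x \<in> tensor_rel (ring_on S) N (module_on A)" for N :: "('a, 'n) module" and x
  proof -
    have "\<forall>\<^sub>F s::nat in sequentially. \<forall>j\<in>{()}. contract N A ((\<lambda>s j. \<epsilon>) s j) x = \<zero>\<^bsub>N\<^esub>"
      using N \<epsilon> by (intro contract_kills) auto
    then show ?thesis by simp
  qed
  have cone: "contract N A \<epsilon> (frag_of (n, 1)) = n" if "module (ring_on S) N" "n \<in> carrier N"
    for N :: "('a, 'n) module" and n
    using contract_props(2)[OF that(1), of \<epsilon> n 1] \<epsilon> A1 that(2) module.smult_one[OF that] by simp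
  have FK: "Poly_Mapping.keys (F x) \<subseteq> carrier N2 \<times> A" "contract N2 A \<psi> (F x) = f (contract N1 A \<psi> x)"
    if "Poly_Mapping.keys x \<subseteq> carrier N1 \<times> A" "\<And>y. y \<in> A \<Longrightarrow> \<psi> y \<in> S" for x \<psi>
    using contract_natural[OF N1 N2 f that(2,1)] unfolding F_def by auto
  have GK: "contract N3 A \<psi> (G x) = g (contract N2 A \<psi> x)"
    if "Poly_Mapping.keys x \<subseteq> carrier N2 \<times> A" "\<And>y. y \<in> A \<Longrightarrow> \<psi> y \<in> S" for x \<psi>
    using contract_natural[OF N2 N3 g that(2,1)] unfolding G_def by auto
  show "exact_pair (add_monoid N1) f (add_monoid N2) g (add_monoid N3) \<longleftrightarrow>
    exact_pair (tensor_product (ring_on S) N1 (module_on A)) (tensor_map (ring_on S) N2 (module_on A) f)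
      (tensor_product (ring_on S) N2 (module_on A)) (tensor_map (ring_on S) N3 (module_on A) g)
      (tensor_product (ring_on S) N3 (module_on A))"
    unfolding exact_pair_tensor_iff[OF N1 N2 N3 f g] ex F_def[symmetric] G_def[symmetric]
  proof
    assume exact: "f ` carrier N1 = {n \<in> carrier N2. g n = \<zero>\<^bsub>N3\<^esub>}"
    show "(\<forall>x :: 'n \<times> 'a \<Rightarrow>\<^sub>0 int. Poly_Mapping.keys x \<subseteq> carrier N1 \<times> A \<longrightarrow> G (F x) \<in> ?K3) \<and>
      (\<forall>x. Poly_Mapping.keys x \<subseteq> carrier N2 \<times> A \<longrightarrow> G x \<in> ?K3 \<longrightarrow>
        (\<exists>z. Poly_Mapping.keys z \<subseteq> carrier N1 \<times> A \<and> x - F z \<in> ?K2))"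
    proof (intro conjI allI impI)
      fix x :: "'n \<times> 'a \<Rightarrow>\<^sub>0 int" assume "Poly_Mapping.keys x \<subseteq> carrier N1 \<times> A"
      then show "G (F x) \<in> ?K3"
      proof (induction x rule: free_Abelian_group_induct[consumes 1, case_names zero diff gen])
        case zero
        then show ?case by (simp add: F_def G_def tensor_rel_0[OF N3])
      next
        case (diff x y)
        then show ?case by (simp add: F_def G_def frag_extend_diff tensor_rel_diff[OF N3])
      next
        case (gen a)
        then obtain n y where a: "a = (n, y)" "n \<in> carrier N1" "y \<in> A" by auto
        then have "g (f n) = \<zero>\<^bsub>N3\<^esub>" using exact by auto
        then show ?case using a by (simp add: F_def G_def tensor_rel_zero_left[OF N3])
      qed
    next
      fix x assume x: "Poly_Mapping.keys x \<subseteq> carrier N2 \<times> A" "G x \<in> ?K3"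
      have "\<forall>\<^sub>F s in sequentially. x - (\<Sum>j\<in>J s. frag_of (contract N2 A (\<phi> s j) x, e s j)) \<in> ?K2"
        using J e \<phi> rep x(1) by (rule contract_decompose[OF N2])
      moreover have "\<forall>\<^sub>F s in sequentially. \<forall>j\<in>J s. contract N3 A (\<phi> s j) (G x) = \<zero>\<^bsub>N3\<^esub>"
        using \<phi> add smult x(2) by (rule contract_kills[OF N3])
      ultimately have "\<forall>\<^sub>F s in sequentially. x - (\<Sum>j\<in>J s. frag_of (contract N2 A (\<phi> s j) x, e s j)) \<in> ?K2 \<and>
          (\<forall>j\<in>J s. contract N3 A (\<phi> s j) (G x) = \<zero>\<^bsub>N3\<^esub>)"
        by (rule eventually_conj)
      then obtain s where s: "x - (\<Sum>j\<in>J s. frag_of (contract N2 A (\<phi> s j) x, e s j)) \<in> ?K2"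
          "\<forall>j\<in>J s. contract N3 A (\<phi> s j) (G x) = \<zero>\<^bsub>N3\<^esub>"
        using eventually_happens'[OF sequentially_bot] by blast
      have "\<forall>j\<in>J s. \<exists>n. n \<in> carrier N1 \<and> f n = contract N2 A (\<phi> s j) x"
      proof
        fix j assume "j \<in> J s"
        then have "g (contract N2 A (\<phi> s j) x) = \<zero>\<^bsub>N3\<^esub>" using s(2) GK[OF x(1), of "\<phi> s j"] \<phi> by simp
        then have "contract N2 A (\<phi> s j) x \<in> f ` carrier N1"
          unfolding exact using contract_hom(1)[OF N2 _ x(1), of "\<phi> s j"] \<phi> by simp
        then show "\<exists>n. n \<in> carrier N1 \<and> f n = contract N2 A (\<phi> s j) x" by auto
      qed
      from bchoice[OF this] obtain n where n: "\<forall>j\<in>J s. n j \<in> carrier N1 \<and> f (n j) = contract N2 A (\<phi> s j) x"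
        by blast
      define z where "z = (\<Sum>j\<in>J s. frag_of (n j, e s j))"
      have "z \<in> carrier (free_Abelian_group (carrier N1 \<times> A))"
        unfolding z_def using n e by (intro sum_closed_free_Abelian_group) auto
      moreover have "F z = (\<Sum>j\<in>J s. frag_of (contract N2 A (\<phi> s j) x, e s j))"
        unfolding F_def z_def using J n by (simp add: frag_extend_sum)
      ultimately show "\<exists>z. Poly_Mapping.keys z \<subseteq> carrier N1 \<times> A \<and> x - F z \<in> ?K2"
        using s(1) by auto
    qed
  next
    assume c: "(\<forall>x :: 'n \<times> 'a \<Rightarrow>\<^sub>0 int. Poly_Mapping.keys x \<subseteq> carrier N1 \<times> A \<longrightarrow> G (F x) \<in> ?K3) \<and>
      (\<forall>x. Poly_Mapping.keys x \<subseteq> carrier N2 \<times> A \<longrightarrow> G x \<in> ?K3 \<longrightarrow>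
        (\<exists>z. Poly_Mapping.keys z \<subseteq> carrier N1 \<times> A \<and> x - F z \<in> ?K2))"
    show "f ` carrier N1 = {n \<in> carrier N2. g n = \<zero>\<^bsub>N3\<^esub>}"
    proof (intro equalityI subsetI)
      fix m assume "m \<in> f ` carrier N1"
      then obtain n where n: "n \<in> carrier N1" "m = f n" by blast
      then have "G (F (frag_of (n, 1))) \<in> ?K3" using c A1 by simp
      then have "frag_of (g (f n), 1) \<in> ?K3" by (simp add: F_def G_def)
      then have "g (f n) = \<zero>\<^bsub>N3\<^esub>" using kill[OF N3] cone[OF N3 gc[OF fc[OF n(1)]]] by metis
      then show "m \<in> {n \<in> carrier N2. g n = \<zero>\<^bsub>N3\<^esub>}" using n fc by simp
    next
      fix m assume "m \<in> {n \<in> carrier N2. g n = \<zero>\<^bsub>N3\<^esub>}"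
      then have m: "m \<in> carrier N2" "g m = \<zero>\<^bsub>N3\<^esub>" by auto
      have "G (frag_of (m, 1)) \<in> ?K3" using m tensor_rel_zero_left[OF N3 A1] by (simp add: G_def)
      moreover have "Poly_Mapping.keys (frag_of (m, 1 :: 'a)) \<subseteq> carrier N2 \<times> A" using m A1 by simp
      ultimately obtain z where z: "Poly_Mapping.keys z \<subseteq> carrier N1 \<times> A" "frag_of (m, 1) - F z \<in> ?K2"
        using c by blast
      have zc: "contract N1 A \<epsilon> z \<in> carrier N1" using contract_hom(1)[OF N1 \<epsilon>(1) z(1)] by simp
      have "\<zero>\<^bsub>N2\<^esub> = contract N2 A \<epsilon> (frag_of (m, 1) - F z)" using kill[OF N2 z(2)] by simp
      also have "\<dots> = contract N2 A \<epsilon> (frag_of (m, 1)) \<ominus>\<^bsub>N2\<^esub> contract N2 A \<epsilon> (F z)"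
        using m A1 FK(1)[OF z(1) \<epsilon>(1)] \<epsilon>(1) by (intro contract_hom(4)[OF N2]) auto
      also have "\<dots> = m \<ominus>\<^bsub>N2\<^esub> f (contract N1 A \<epsilon> z)"
        using cone[OF N2 m(1)] FK(2)[OF z(1) \<epsilon>(1)] by simp
      finally have eq: "m \<ominus>\<^bsub>N2\<^esub> f (contract N1 A \<epsilon> z) = \<zero>\<^bsub>N2\<^esub>" by simp
      have "m = (m \<ominus>\<^bsub>N2\<^esub> f (contract N1 A \<epsilon> z)) \<oplus>\<^bsub>N2\<^esub> f (contract N1 A \<epsilon> z)"
        using m(1) fc[OF zc] by (simp add: a_minus_def N2.a_assoc N2.l_neg)
      then have "m = f (contract N1 A \<epsilon> z)" unfolding eq using fc[OF zc] by simp
      then show "m \<in> f ` carrier N1" using zc by blast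
    qed
  qed
qed

end

section \<open>Roots of \<open>v\<close> over the field of Laurent series\<close>

subsection \<open>Evaluation homomorphisms\<close>

text \<open>The value at \<open>x\<close> of a polynomial whose coefficients are first mapped by \<open>h\<close>.\<close>

definition eval_map :: "('a::comm_ring_1 \<Rightarrow> 'b::comm_ring_1) \<Rightarrow> 'b \<Rightarrow> 'a poly \<Rightarrow> 'b"
  where "eval_map h x p = poly (map_poly h p) x"

context
  fixes h :: "'a::comm_ring_1 \<Rightarrow> 'b::comm_ring_1"
  assumes h0: "h 0 = 0" and h_add: "\<And>a b. h (a + b) = h a + h b" and h_mult: "\<And>a b. h (a * b) = h a * h b"
begin

lemma eval_map_pCons: "eval_map h x (pCons c p) = h c + x * eval_map h x p"
  by (simp add: eval_map_def map_poly_pCons h0)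

lemma eval_map_0: "eval_map h x 0 = 0"
  by (simp add: eval_map_def)

lemma eval_map_add: "eval_map h x (p + q) = eval_map h x p + eval_map h x q"
  by (induction p q rule: poly_induct2) (simp_all add: eval_map_0 eval_map_pCons h_add algebra_simps)

lemma eval_map_smult: "eval_map h x (Polynomial.smult c p) = h c * eval_map h x p"
  by (induction p) (simp_all add: eval_map_0 eval_map_pCons h_mult algebra_simps)

lemma eval_map_mult: "eval_map h x (p * q) = eval_map h x p * eval_map h x q"
  by (induction p) (simp_all add: eval_map_0 eval_map_pCons eval_map_add eval_map_smult h0 algebra_simps)

lemma eval_map_uminus: "eval_map h x (- p) = - eval_map h x p"
  using eval_map_add[of x p "- p"] by (simp add: eval_map_0 eq_neg_iff_add_eq_0 add.commute)

lemma eval_map_diff: "eval_map h x (p - q) = eval_map h x p - eval_map h x q"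
  using eval_map_add[of x p "- q"] by (simp add: eval_map_uminus)

lemma eval_map_sum: "eval_map h x (\<Sum>i\<in>I. f i) = (\<Sum>i\<in>I. eval_map h x (f i))"
  by (induction I rule: infinite_finite_induct) (simp_all add: eval_map_0 eval_map_add)

lemma eval_map_monom: "eval_map h x (Polynomial.monom c n) = h c * x ^ n"
  by (simp add: eval_map_def map_poly_monom h0 poly_monom)

lemma eval_map_power:
  assumes "h 1 = 1" shows "eval_map h x (p ^ n) = eval_map h x p ^ n"
proof (induction n)
  case 0
  show ?case using assms by (simp add: eval_map_def)
next
  case (Suc n)
  then show ?case by (simp add: eval_map_mult)
qed

end

lemma eval_map_to_ac:
  fixes w :: "'k::field alg_closure"
  shows "eval_map to_ac w 0 = 0" "eval_map to_ac w (pCons c p) = to_ac c + w * eval_map to_ac w p"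
    "eval_map to_ac w (p + q) = eval_map to_ac w p + eval_map to_ac w q"
    "eval_map to_ac w (p - q) = eval_map to_ac w p - eval_map to_ac w q"
    "eval_map to_ac w (p * q) = eval_map to_ac w p * eval_map to_ac w q"
    "eval_map to_ac w (p ^ n) = eval_map to_ac w p ^ n"
    "eval_map to_ac w (Polynomial.monom c n) = to_ac c * w ^ n"
    "eval_map to_ac w (sum f I) = (\<Sum>i\<in>I. eval_map to_ac w (f i))"
  by (simp_all add: eval_map_0 eval_map_pCons eval_map_add eval_map_diff eval_map_mult
      eval_map_power eval_map_monom eval_map_sum)

subsection \<open>The substitution \<open>v \<mapsto> t\<^sup>N\<close>\<close>

abbreviation subst_root :: "nat \<Rightarrow> complex fls poly \<Rightarrow> complex fls"
  where "subst_root N \<equiv> eval_map (\<lambda>c. fls_compose_power c N) fls_X"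

lemma subst_root_simps:
  assumes "N > 0"
  shows "subst_root N 0 = 0" "subst_root N (pCons c p) = fls_compose_power c N + fls_X * subst_root N p"
    "subst_root N (p + q) = subst_root N p + subst_root N q"
    "subst_root N (p - q) = subst_root N p - subst_root N q"
    "subst_root N (p * q) = subst_root N p * subst_root N q"
    "subst_root N (p ^ n) = subst_root N p ^ n"
    "subst_root N (Polynomial.monom c n) = fls_compose_power c N * fls_X ^ n"
    "subst_root N (sum f I) = (\<Sum>i\<in>I. subst_root N (f i))"
  using assms by (simp_all add: eval_map_0 eval_map_pCons eval_map_add eval_map_diff eval_map_mult
      eval_map_power eval_map_monom eval_map_sum)

lemma fls_mult_X_power_nth: "fls_nth (f * fls_X ^ n) k = fls_nth f (k - int n)"
  for f :: "complex fls"
proof (induction n arbitrary: f k)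
  case (Suc n)
  have "f * fls_X ^ Suc n = (f * fls_X) * fls_X ^ n" by (simp only: power_Suc mult.assoc)
  then have "fls_nth (f * fls_X ^ Suc n) k = fls_nth (f * fls_X) (k - int n)" by (simp only: Suc)
  also have "\<dots> = fls_nth f (k - int (Suc n))"
    by (simp add: fls_X_times_conv_shift algebra_simps)
  finally show ?case .
qed simp

text \<open>Exponents in different classes modulo \<open>N\<close> cannot cancel in a combination over series in \<open>t\<^sup>N\<close>.\<close>

lemma compose_power_independent:
  fixes c :: "'i \<Rightarrow> complex fls" and a :: "'i \<Rightarrow> nat"
  assumes N: "N > 0" and I: "finite I"
    and a: "\<And>i j. i \<in> I \<Longrightarrow> j \<in> I \<Longrightarrow> int N dvd int (a i) - int (a j) \<Longrightarrow> i = j"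
    and eq: "(\<Sum>i\<in>I. fls_compose_power (c i) N * fls_X ^ a i) = 0" and i: "i \<in> I"
  shows "c i = 0"
proof (rule fls_eqI)
  fix m
  have "0 = (\<Sum>j\<in>I. fls_nth (fls_compose_power (c j) N * fls_X ^ a j) (int N * m + int (a i)))"
    using arg_cong[OF eq, of "\<lambda>f. fls_nth f (int N * m + int (a i))"] by (simp add: fls_nth_sum)
  also have "\<dots> = (\<Sum>j\<in>I. if j = i then fls_nth (c i) m else 0)"
  proof (rule sum.cong[OF refl])
    fix j assume j: "j \<in> I"
    show "fls_nth (fls_compose_power (c j) N * fls_X ^ a j) (int N * m + int (a i)) =
        (if j = i then fls_nth (c i) m else 0)"
    proof (cases "j = i")
      case True
      then show ?thesis using N by (simp add: fls_mult_X_power_nth fls_nth_compose_power)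
    next
      case False
      then have "\<not> int N dvd int (a i) - int (a j)" using a[OF i j] by auto
      then have "\<not> int N dvd int N * m + (int (a i) - int (a j))"
        by (metis dvd_add_triv_left_iff dvd_triv_left dvd_add_right_iff)
      then have "\<not> int N dvd int N * m + int (a i) - int (a j)" by (simp add: algebra_simps)
      then show ?thesis using N False by (simp add: fls_mult_X_power_nth fls_nth_compose_power)
    qed
  qed
  also have "\<dots> = fls_nth (c i) m" using I i by simp
  finally show "fls_nth (c i) m = fls_nth 0 m" by simp
qed

lemma subst_root_eq_0:
  assumes N: "N > 0" and deg: "Polynomial.degree P < N" and eq: "subst_root N P = 0"
  shows "P = 0"
proof (rule poly_eqI)
  fix i
  have "P = (\<Sum>i<N. Polynomial.monom (Polynomial.coeff P i) i)"
    using deg by (subst poly_as_sum_of_monoms'[of P "N - 1", symmetric])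
      (use N in \<open>auto intro!: sum.cong simp: lessThan_Suc_atMost[symmetric]\<close>)
  then have "subst_root N P = (\<Sum>i<N. fls_compose_power (Polynomial.coeff P i) N * fls_X ^ i)"
    by (metis (no_types, lifting) subst_root_simps(7,8)[OF N] sum.cong)
  then have eq': "(\<Sum>i<N. fls_compose_power (Polynomial.coeff P i) N * fls_X ^ i) = 0" using eq by simp
  have inj: "i = j" if "i \<in> {..<N}" "j \<in> {..<N}" "int N dvd int i - int j" for i j
  proof -
    have "\<bar>int i - int j\<bar> < int N" using that by auto
    then show ?thesis using that(3) dvd_imp_le_int[of "int i - int j" "int N"] by auto
  qed
  show "Polynomial.coeff P i = Polynomial.coeff 0 i"
  proof (cases "i < N")
    case True
    then show ?thesis
      using compose_power_independent[OF N _ inj eq', of i] by simp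
  next
    case False
    then show ?thesis using deg by (simp add: coeff_eq_0)
  qed
qed

text \<open>The kernel of \<open>P \<mapsto> P(w)\<close> for a root \<open>w\<close> of \<open>T\<^sup>N - v\<close> is contained in that of the substitution
  \<open>v \<mapsto> t\<^sup>N\<close>, \<open>T \<mapsto> t\<close>; equivalently, \<open>T\<^sup>N - v\<close> is irreducible.\<close>

lemma root_relation_imp_subst_root:
  fixes w :: "complex fls alg_closure"
  assumes N: "N > 0" and w: "w ^ N = to_ac fls_X" and P: "eval_map to_ac w P = 0"
  shows "subst_root N P = 0"
proof -
  define W :: "complex fls poly" where "W = Polynomial.monom 1 N + [:- fls_X:]"
  have Ww: "eval_map to_ac w W = 0" by (simp add: W_def eval_map_to_ac w)
  have XN: "fls_X_intpow (int N) = (fls_X :: complex fls) ^ N"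
    by (simp add: fls_X_power_conv_shift_1)
  have WN: "subst_root N W = 0" using N by (simp add: W_def subst_root_simps XN)
  have degW: "Polynomial.degree W = N"
    unfolding W_def using N by (subst degree_add_eq_left) (auto simp: degree_monom_eq)
  have W0: "W \<noteq> 0" using degW N by auto
  have small: "m = 0" if "Polynomial.degree m < N" "eval_map to_ac w m = 0" for m
  proof (rule ccontr)
    assume "m \<noteq> 0"
    define Q where "Q m \<longleftrightarrow> m \<noteq> 0 \<and> eval_map to_ac w m = 0" for m
    have "Q m" using that \<open>m \<noteq> 0\<close> by (simp add: Q_def)
    from ex_has_least_nat[of Q, OF this, of Polynomial.degree]
    obtain k where k: "Q k" "\<And>n. Q n \<Longrightarrow> Polynomial.degree k \<le> Polynomial.degree n" by blast
    have k0: "k \<noteq> 0" "eval_map to_ac w k = 0" using k(1) by (auto simp: Q_def)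
    have degk: "Polynomial.degree k < N" using k(2)[OF \<open>Q m\<close>] that by simp
    define q r where "q = W div k" and "r = W mod k"
    have W: "W = k * q + r" by (simp add: q_def r_def)
    have "eval_map to_ac w r = 0" using Ww unfolding W by (simp add: eval_map_to_ac k0)
    have "r = 0"
    proof (rule ccontr)
      assume "r \<noteq> 0"
      then have "Q r" using \<open>eval_map to_ac w r = 0\<close> by (simp add: Q_def)
      moreover have "Polynomial.degree r < Polynomial.degree k"
        using \<open>r \<noteq> 0\<close> k0 unfolding r_def by (simp add: degree_mod_less')
      ultimately show False using k(2)[of r] by simp
    qed
    then have Wq: "W = k * q" using W by simp
    then have q0: "q \<noteq> 0" using W0 by auto
    have "Polynomial.degree k \<noteq> 0"
    proof
      assume "Polynomial.degree k = 0"
      then obtain c where "k = [:c:]" by (rule degree_eq_zeroE)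
      then show False using k0 by (simp add: eval_map_to_ac)
    qed
    moreover have "Polynomial.degree k + Polynomial.degree q = N"
      using degW unfolding Wq using k0(1) q0 by (simp add: degree_mult_eq)
    ultimately have degq: "Polynomial.degree q < N" by simp
    have "subst_root N k * subst_root N q = 0" using WN unfolding Wq using N by (simp add: subst_root_simps)
    then show False using subst_root_eq_0[OF N degk] subst_root_eq_0[OF N degq] k0 q0 by auto
  qed
  define q r where "q = P div W" and "r = P mod W"
  have PW: "P = W * q + r" by (simp add: q_def r_def)
  have "eval_map to_ac w r = 0" using P unfolding PW by (simp add: eval_map_to_ac Ww)
  moreover have "Polynomial.degree r < N"
    using degree_mod_less[OF W0, of P] N degW unfolding r_def by auto
  ultimately have "r = 0" by (rule small[rotated])
  then show ?thesis unfolding PW using N WN by (simp add: subst_root_simps)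
qed

lemma root_of_unity_const:
  fixes z :: "complex fls alg_closure"
  assumes N: "N > 0" and z: "z ^ N = 1"
  shows "\<exists>c. c \<noteq> 0 \<and> z = to_ac (fls_const c)"
proof -
  define p :: "complex poly" where "p = Polynomial.monom 1 N + [:- 1:]"
  define h :: "complex \<Rightarrow> complex fls alg_closure" where "h c = to_ac (fls_const c)" for c
  have h: "h 0 = 0" "h (a + b) = h a + h b" "h (a * b) = h a * h b" "h 1 = 1" for a b
    by (simp_all only: h_def fls_plus_const[symmetric] fls_const_mult_const[symmetric] to_ac_add to_ac_mult)
      simp_all
  have hm: "h (- a) = - h a" for a
    by (simp add: h_def flip: to_ac_minus)
  note ev = eval_map_0[of h] eval_map_pCons[of h] eval_map_add[of h] eval_map_mult[of h]
    eval_map_smult[of h] eval_map_diff[of h] eval_map_monom[of h]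
  have pz: "eval_map h z p = 0"
    using z h by (simp add: p_def ev hm)
  have "Polynomial.degree p = N"
    unfolding p_def using N by (subst degree_add_eq_left) (auto simp: degree_monom_eq)
  then have p0: "p \<noteq> 0" using N by auto
  then obtain A where A: "p = Polynomial.smult (lead_coeff p) (\<Prod>x\<in>#A. [:-x, 1:])"
    using alg_closed_imp_factorization[OF p0] by blast
  have prod: "\<exists>c. z = h c" if "eval_map h z (\<Prod>x\<in>#A. [:-x, 1:]) = 0" for A
    using that
  proof (induction A)
    case empty
    then show ?case using h by (simp add: ev one_pCons)
  next
    case (add x A)
    then have "eval_map h z ([:-x, 1:] * (\<Prod>x\<in>#A. [:-x, 1:])) = 0" by simp
    then have "eval_map h z [:-x, 1:] * eval_map h z (\<Prod>x\<in>#A. [:-x, 1:]) = 0"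
      using h by (simp only: ev)
    then show ?case
    proof (elim mult_eq_0_iff[THEN iffD1, THEN disjE])
      assume "eval_map h z [:-x, 1:] = 0"
      then have "z = h x" using h by (simp add: ev hm)
      then show ?thesis by auto
    qed (rule add.IH)
  qed
  have "h (lead_coeff p) * eval_map h z (\<Prod>x\<in>#A. [:-x, 1:]) = 0"
    using pz by (subst (asm) A) (use h in \<open>simp add: ev\<close>)
  moreover have "h (lead_coeff p) \<noteq> 0" using p0 by (simp add: h_def)
  ultimately obtain c where c: "z = h c" using prod by auto
  have "c \<noteq> 0" using c z N h(1) by (auto simp: zero_power)
  then show ?thesis using c by (auto simp: h_def)
qed

lemma root_eq_const_times_power:
  fixes w s :: "complex fls alg_closure"
  assumes N: "N > 0" and w: "w ^ N = to_ac fls_X" and s: "s ^ N = to_ac (fls_X ^ a)"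
  shows "\<exists>c. c \<noteq> 0 \<and> s = to_ac (fls_const c) * w ^ a"
proof -
  have w0: "w \<noteq> 0" using w N by (auto simp: zero_power)
  have "(s / w ^ a) ^ N = 1"
  proof -
    have "(w ^ a) ^ N = (w ^ N) ^ a" by (simp add: mult.commute flip: power_mult)
    then have "(w ^ a) ^ N = to_ac (fls_X ^ a)" by (simp add: w)
    then show ?thesis using s by (simp add: power_divide)
  qed
  then obtain c where "c \<noteq> 0" "s / w ^ a = to_ac (fls_const c)" using root_of_unity_const[OF N] by blast
  then show ?thesis using w0 by (intro exI[of _ c]) (simp add: field_simps)
qed

lemma root_exists: "N > 0 \<Longrightarrow> \<exists>w. w ^ N = to_ac (fls_X :: complex fls)"
  by (rule nth_root_exists)

text \<open>Kummer theory for radicals of \<open>v\<close>: radicals with exponents distinct modulo the integers are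
  linearly independent over \<open>\<complex>((v))\<close>.\<close>

lemma radicals_independent:
  fixes c :: "'i \<Rightarrow> complex fls" and s :: "'i \<Rightarrow> complex fls alg_closure" and a :: "'i \<Rightarrow> nat"
  assumes N: "N > 0" and I: "finite I"
    and a: "\<And>i j. i \<in> I \<Longrightarrow> j \<in> I \<Longrightarrow> int N dvd int (a i) - int (a j) \<Longrightarrow> i = j"
    and s: "\<And>i. i \<in> I \<Longrightarrow> s i ^ N = to_ac (fls_X ^ a i)"
    and eq: "(\<Sum>i\<in>I. to_ac (c i) * s i) = 0" and i: "i \<in> I"
  shows "c i = 0"
proof -
  obtain w where w: "w ^ N = to_ac (fls_X :: complex fls)" using root_exists[OF N] by blast
  have "\<forall>i\<in>I. \<exists>z. z \<noteq> 0 \<and> s i = to_ac (fls_const z) * w ^ a i"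
    using root_eq_const_times_power[OF N w s] by blast
  from bchoice[OF this] obtain z where z: "\<forall>i\<in>I. z i \<noteq> 0 \<and> s i = to_ac (fls_const (z i)) * w ^ a i"
    by blast
  define P where "P = (\<Sum>i\<in>I. Polynomial.monom (c i * fls_const (z i)) (a i))"
  have "eval_map to_ac w P = (\<Sum>i\<in>I. to_ac (c i) * s i)"
    unfolding P_def eval_map_to_ac by (intro sum.cong refl) (simp add: z mult.assoc)
  then have "subst_root N P = 0" using root_relation_imp_subst_root[OF N w] eq by simp
  then have "(\<Sum>i\<in>I. fls_compose_power (c i * fls_const (z i)) N * fls_X ^ a i) = 0"
    by (simp only: P_def subst_root_simps[OF N])
  then have "c i * fls_const (z i) = 0" 
    using compose_power_independent[where c = "\<lambda>i. c i * fls_const (z i)", OF N I a _ i] by blast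
  then show ?thesis using z i by simp
qed

subsection \<open>The subfields generated by finitely many radicals\<close>

text \<open>Elements that are polynomials in every \<open>N\<close>-th root of \<open>v\<close>.\<close>

definition radical_ext :: "nat \<Rightarrow> complex fls alg_closure set"
  where "radical_ext N = {z. \<forall>w. w ^ N = to_ac fls_X \<longrightarrow> (\<exists>P. z = eval_map to_ac w P)}"

lemma radical_ext_const: "to_ac c \<in> radical_ext N"
  unfolding radical_ext_def by (auto intro!: exI[of _ "[:c:]"] simp: eval_map_to_ac)

lemma subring_on_radical_ext: "subring_on (radical_ext N)"
proof (rule subring_onI)
  show "1 \<in> radical_ext N" using radical_ext_const[of 1 N] by simp
  show "a - b \<in> radical_ext N" if "a \<in> radical_ext N" "b \<in> radical_ext N" for a b
    using that unfolding radical_ext_def mem_Collect_eq by (metis eval_map_to_ac(4))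
  show "a * b \<in> radical_ext N" if "a \<in> radical_ext N" "b \<in> radical_ext N" for a b
    using that unfolding radical_ext_def mem_Collect_eq by (metis eval_map_to_ac(5))
qed

lemma radical_ext_mono:
  assumes "N dvd M" shows "radical_ext N \<subseteq> radical_ext M"
proof
  fix z assume z: "z \<in> radical_ext N"
  obtain k where M: "M = N * k" using assms by (auto elim: dvdE)
  show "z \<in> radical_ext M"
    unfolding radical_ext_def
  proof (intro CollectI allI impI)
    fix w :: "complex fls alg_closure" assume "w ^ M = to_ac fls_X"
    then have "(w ^ k) ^ N = to_ac fls_X" by (simp add: M mult.commute flip: power_mult)
    then obtain P where P: "z = eval_map to_ac (w ^ k) P" using z by (auto simp: radical_ext_def)
    have "eval_map to_ac (w ^ k) P = eval_map to_ac w (pcompose P (Polynomial.monom 1 k))"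
      by (induction P) (simp_all add: eval_map_to_ac pcompose_pCons)
    then show "\<exists>P. z = eval_map to_ac w P" using P by blast
  qed
qed

lemma root_in_radical_ext:
  assumes "p > 0" "r ^ p = to_ac fls_X" shows "r \<in> radical_ext p"
  unfolding radical_ext_def
proof (intro CollectI allI impI)
  fix w :: "complex fls alg_closure" assume w: "w ^ p = to_ac fls_X"
  obtain c where "r = to_ac (fls_const c) * w"
    using root_eq_const_times_power[OF assms(1) w, of r 1] assms(2) by auto
  then show "\<exists>P. r = eval_map to_ac w P"
    by (intro exI[of _ "Polynomial.monom (fls_const c) 1"]) (simp add: eval_map_to_ac)
qed

text \<open>If \<open>r = P(w)\<close> were a \<open>p\<close>-th root of \<open>v\<close>, the substitution would turn \<open>P\<close> into a \<open>p\<close>-th root of \<open>t\<^sup>N\<close>, and \<open>p\<close>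
  would divide the order \<open>N\<close>.\<close>

lemma root_notin_radical_ext:
  assumes N: "N > 0" and r: "r ^ p = to_ac fls_X" and p: "\<not> p dvd N"
  shows "r \<notin> radical_ext N"
proof
  assume "r \<in> radical_ext N"
  moreover obtain w where w: "w ^ N = to_ac (fls_X :: complex fls)" using root_exists[OF N] by blast
  ultimately obtain P where P: "r = eval_map to_ac w P" by (auto simp: radical_ext_def)
  have "eval_map to_ac w (P ^ p - [:fls_X:]) = 0" by (simp add: eval_map_to_ac r flip: P)
  then have "subst_root N (P ^ p - [:fls_X:]) = 0" by (rule root_relation_imp_subst_root[OF N w])
  then have "subst_root N P ^ p = fls_X_intpow (int N)" using N by (simp add: subst_root_simps)
  then have "fls_subdegree (subst_root N P ^ p) = int N" by simp
  then have "int p dvd int N" by (metis dvd_triv_left fls_subdegree_pow)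
  then show False using p by simp
qed

lemma inverse_in_algebraic_subring:
  fixes V :: "'k::field alg_closure set"
  assumes V: "subring_on V" "range to_ac \<subseteq> V" and z: "z \<in> V" "z \<noteq> 0"
  shows "inverse z \<in> V"
proof -
  note cl = subring_on_closed[OF V(1)]
  have "to_ac c \<in> V" for c using V(2) by blast
  then have ev: "eval_map to_ac z q \<in> V" for q
    by (induction q) (use z cl in \<open>auto simp: eval_map_to_ac\<close>)
  obtain p where "p \<noteq> 0" "eval_map to_ac z p = 0"
    using alg_closure_algebraic[of z] unfolding eval_map_def by blast
  then show ?thesis
  proof (induction p)
    case (pCons c q)
    show ?case
    proof (cases "c = 0")
      case True
      then show ?thesis using pCons z by (auto simp: eval_map_to_ac)
    next
      case False
      then have "z * eval_map to_ac z q = - to_ac c"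
        using pCons.prems by (simp add: eval_map_to_ac eq_neg_iff_add_eq_0 add.commute)
      moreover have "z * (- eval_map to_ac z q * to_ac (inverse c)) =
          - (z * eval_map to_ac z q) * to_ac (inverse c)" by (simp add: mult.assoc)
      ultimately have "z * (- eval_map to_ac z q * to_ac (inverse c)) = 1" using False by simp
      then have "inverse z = - eval_map to_ac z q * to_ac (inverse c)" by (rule inverse_unique)
      moreover have "to_ac (inverse c) \<in> V" using V(2) by blast
      ultimately show ?thesis using ev cl by metis
    qed
  qed simp
qed

subsection \<open>The primes and the mixed radix monomials\<close>

lemma prime_nth_prime: "Factorial_Ring.prime (nth_prime n)"
  using enumerate_in_set[OF primes_infinite, of "n - 1"] by (simp add: nth_prime_def)

lemma nth_prime_ge_2: "nth_prime n \<ge> 2"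
  using prime_nth_prime by (rule prime_ge_2_nat)

lemma nth_prime_pos: "nth_prime n > 0"
  using nth_prime_ge_2[of n] by simp

lemma nth_prime_inj: "n > 0 \<Longrightarrow> m > 0 \<Longrightarrow> nth_prime n = nth_prime m \<Longrightarrow> n = m"
proof -
  assume nm: "n > 0" "m > 0" "nth_prime n = nth_prime m"
  have "n - 1 = m - 1"
    using nm(3) strict_mono_enumerate[OF primes_infinite, THEN strict_mono_eq]
    by (simp add: nth_prime_def)
  then show ?thesis using nm by simp
qed

text \<open>The product of \<open>l\<close> consecutive primes, beginning with the \<open>n\<close>-th.\<close>

definition prime_block :: "nat \<Rightarrow> nat \<Rightarrow> nat"
  where "prime_block n l = (\<Prod>i\<in>{n..<n + l}. nth_prime i)"

lemma prime_block_0: "prime_block n 0 = 1"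
  by (simp add: prime_block_def)

lemma prime_block_Suc: "prime_block n (Suc l) = nth_prime n * prime_block (Suc n) l"
  by (simp add: prime_block_def prod.atLeast_Suc_lessThan)

lemma prime_block_pos: "prime_block n l > 0"
  by (simp add: prime_block_def nth_prime_pos prod_pos)

lemma prime_block_ge: "l < prime_block n l"
proof (induction l arbitrary: n)
  case (Suc l)
  have "Suc l \<le> prime_block (Suc n) l" using Suc.IH[of "Suc n"] by simp
  then have "Suc l < 2 * prime_block (Suc n) l" using prime_block_pos[of "Suc n" l] by linarith
  also have "\<dots> \<le> prime_block n (Suc l)" unfolding prime_block_Suc using nth_prime_ge_2[of n] by simp
  finally show ?case .
qed (simp add: prime_block_0)

lemma nth_prime_not_dvd_block:
  assumes "m > 0" "n > 0" "m \<notin> {n..<n + l}"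
  shows "\<not> nth_prime m dvd prime_block n l"
proof
  assume "nth_prime m dvd prime_block n l"
  then obtain i where i: "i \<in> {n..<n + l}" "nth_prime m dvd nth_prime i"
    unfolding prime_block_def using prime_dvd_prod_iff[OF _ prime_nth_prime[of m], of "{n..<n + l}" nth_prime]
    by auto
  have "nth_prime m = nth_prime i"
    using primes_dvd_imp_eq[OF prime_nth_prime prime_nth_prime i(2)] .
  moreover have "i > 0" using i(1) assms(2) by simp
  ultimately have "m = i" using nth_prime_inj[of m i] assms(1) by blast
  then show False using i assms by simp
qed

text \<open>The monomial \<open>x\<^sub>n\<^sup>e\<^sup>0 x\<^sub>n\<^sub>+\<^sub>1\<^sup>e\<^sup>1 \<dots>\<close> whose exponents are the digits of \<open>k\<close> in the mixed radix system with
  radices \<open>p\<^sub>n\<close>, \<open>p\<^sub>n\<^sub>+\<^sub>1\<close>, and so on.\<close>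

function mixed_monomial :: "(nat \<Rightarrow> 'b::comm_ring_1) \<Rightarrow> nat \<Rightarrow> nat \<Rightarrow> 'b" where
  "mixed_monomial x n k = (if k = 0 then 1
    else x n ^ (k mod nth_prime n) * mixed_monomial x (Suc n) (k div nth_prime n))"
  by auto
termination
proof (relation "measure (\<lambda>(x, n, k). k)")
  fix x :: "nat \<Rightarrow> 'b" and n k :: nat assume "k \<noteq> 0"
  then show "((x, Suc n, k div nth_prime n), (x, n, k)) \<in> measure (\<lambda>(x, n, k). k)"
    using nth_prime_ge_2[of n] by simp
qed simp

declare mixed_monomial.simps [simp del]

lemma mixed_monomial_0: "mixed_monomial x n 0 = 1"
  by (simp add: mixed_monomial.simps)

lemma mixed_monomial_step:
  "mixed_monomial x n k = x n ^ (k mod nth_prime n) * mixed_monomial x (Suc n) (k div nth_prime n)"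
  by (cases "k = 0") (simp_all add: mixed_monomial_0, simp add: mixed_monomial.simps[of x n k])

lemma mixed_monomial_digit:
  assumes "e < nth_prime n"
  shows "mixed_monomial x n (e + nth_prime n * q) = x n ^ e * mixed_monomial x (Suc n) q"
  using mixed_monomial_step[of x n "e + nth_prime n * q"] assms by simp

lemma mixed_monomial_shift: "mixed_monomial x (Suc n) k = mixed_monomial x n (nth_prime n * k)"
  using mixed_monomial_digit[of 0 n x k] nth_prime_pos[of n] by simp

lemma mixed_monomial_times:
  assumes "Suc (k mod nth_prime n) < nth_prime n"
  shows "x n * mixed_monomial x n k = mixed_monomial x n (Suc k)"
proof -
  have k: "Suc k = Suc (k mod nth_prime n) + nth_prime n * (k div nth_prime n)" by simp
  show ?thesis
    unfolding mixed_monomial_step[of x n k] k mixed_monomial_digit[OF assms] by (simp add: mult.assoc)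
qed

lemma mixed_monomial_carry:
  assumes "Suc (k mod nth_prime n) = nth_prime n"
  shows "x n * mixed_monomial x n k = x n ^ nth_prime n * mixed_monomial x (Suc n) (k div nth_prime n)"
  unfolding mixed_monomial_step[of x n k] by (subst assms[symmetric]) (simp add: mult.assoc)

text \<open>If every \<open>x\<^sub>i\<close> is a \<open>p\<^sub>i\<close>-th root of \<open>v\<close>, then raising a monomial with at most \<open>l\<close> digits to the
  power \<open>p\<^sub>n \<cdots> p\<^sub>n\<^sub>+\<^sub>l\<^sub>-\<^sub>1\<close> gives a power of \<open>v\<close>; this is its exponent.\<close>

primrec mixed_exponent :: "nat \<Rightarrow> nat \<Rightarrow> nat \<Rightarrow> nat" where
  "mixed_exponent 0 n k = 0"
| "mixed_exponent (Suc l) n k = (k mod nth_prime n) * prime_block (Suc n) l +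
    nth_prime n * mixed_exponent l (Suc n) (k div nth_prime n)"

lemma mixed_monomial_power:
  assumes x: "\<And>i. i > 0 \<Longrightarrow> x i ^ nth_prime i = v" and "n > 0" "k < prime_block n l"
  shows "mixed_monomial x n k ^ prime_block n l = v ^ mixed_exponent l n k"
  using assms(2,3)
proof (induction l arbitrary: n k)
  case 0
  then show ?case by (simp add: prime_block_0 mixed_monomial_0)
next
  case (Suc l)
  let ?p = "nth_prime n" and ?B = "prime_block (Suc n) l"
  have lt: "k div ?p < ?B"
    using Suc.prems nth_prime_pos[of n] by (simp add: prime_block_Suc less_mult_imp_div_less mult.commute)
  have "mixed_monomial x n k ^ prime_block n (Suc l) =
      (x n ^ ?p) ^ (k mod ?p * ?B) * (mixed_monomial x (Suc n) (k div ?p) ^ ?B) ^ ?p"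
    unfolding mixed_monomial_step[of x n k] prime_block_Suc power_mult_distrib
    by (simp add: mult_ac flip: power_mult)
  also have "\<dots> = v ^ (k mod ?p * ?B) * (v ^ mixed_exponent l (Suc n) (k div ?p)) ^ ?p"
    using x Suc lt by simp
  also have "\<dots> = v ^ mixed_exponent (Suc l) n k"
    by (simp add: power_add mult.commute flip: power_mult)
  finally show ?case .
qed

lemma mixed_exponent_inj:
  assumes "n > 0" "k < prime_block n l" "k' < prime_block n l"
    "int (prime_block n l) dvd int (mixed_exponent l n k) - int (mixed_exponent l n k')"
  shows "k = k'"
  using assms
proof (induction l arbitrary: n k k')
  case 0
  then show ?case by (simp add: prime_block_0)
next
  case (Suc l)
  let ?p = "nth_prime n" and ?B = "prime_block (Suc n) l"
  let ?e = "int (k mod ?p)" and ?e' = "int (k' mod ?p)"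
  let ?m = "int (mixed_exponent l (Suc n) (k div ?p))" and ?m' = "int (mixed_exponent l (Suc n) (k' div ?p))"
  have lt: "k div ?p < ?B" "k' div ?p < ?B"
    using Suc.prems nth_prime_pos[of n] by (simp_all add: prime_block_Suc less_mult_imp_div_less mult.commute)
  have d: "int ?p * int ?B dvd (?e - ?e') * int ?B + int ?p * (?m - ?m')"
    using Suc.prems(4) by (simp add: prime_block_Suc algebra_simps)
  have "coprime (int ?p) (int ?B)"
    using nth_prime_not_dvd_block[of n "Suc n" l] Suc.prems(1) prime_imp_coprime[OF prime_nth_prime[of n]]
    by (simp add: coprime_int_iff)
  moreover have "int ?p dvd (?e - ?e') * int ?B"
    using dvd_mult_left[OF d] by (simp add: dvd_add_left_iff)
  ultimately have "int ?p dvd ?e - ?e'" by (simp add: coprime_dvd_mult_left_iff)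
  moreover have "\<bar>?e - ?e'\<bar> < int ?p"
    using nth_prime_pos[of n] mod_less_divisor[of ?p k] mod_less_divisor[of ?p k'] by linarith
  ultimately have ee: "?e - ?e' = 0" using dvd_imp_le_int[of "?e - ?e'" "int ?p"] by auto
  then have "int ?p * int ?B dvd int ?p * (?m - ?m')" using d by simp
  then have "int ?B dvd ?m - ?m'" using nth_prime_pos[of n] by simp
  then have "k div ?p = k' div ?p" using Suc.IH lt by blast
  moreover have "k mod ?p = k' mod ?p" using ee by simp
  ultimately show ?case by (metis div_mult_mod_eq)
qed

text \<open>The monomials in the radicals \<open>\<rho>\<^sub>1\<close>, \<open>\<rho>\<^sub>2\<close>, \<open>\<dots>\<close> are linearly independent over \<open>\<complex>((v))\<close>.\<close>

lemma mixed_radicals_independent: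
  fixes \<rho> :: "nat \<Rightarrow> complex fls alg_closure"
  assumes \<rho>: "\<And>n. n > 0 \<Longrightarrow> \<rho> n ^ nth_prime n = to_ac fls_X"
    and eq: "(\<Sum>k<m. to_ac (c k) * mixed_monomial \<rho> 1 k) = 0" and k: "k < m"
  shows "c k = 0"
proof -
  have lt: "k < prime_block 1 m" if "k < m" for k
    using that prime_block_ge[of m 1] by simp
  show ?thesis
  proof (rule radicals_independent[where N = "prime_block 1 m" and I = "{..<m}" and s = "mixed_monomial \<rho> 1"
        and a = "mixed_exponent m 1"])
    show "i = j" if "i \<in> {..<m}" "j \<in> {..<m}"
      "int (prime_block 1 m) dvd int (mixed_exponent m 1 i) - int (mixed_exponent m 1 j)" for i j
      using mixed_exponent_inj[of 1 i m j] that lt by simp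
    show "mixed_monomial \<rho> 1 i ^ prime_block 1 m = to_ac (fls_X ^ mixed_exponent m 1 i)" if "i \<in> {..<m}" for i
      using mixed_monomial_power[OF \<rho>, of 1 i m] lt that by simp
  qed (use eq k prime_block_pos in auto)
qed

subsection \<open>The field \<open>L\<close>\<close>

lemma subring_on_L_field: "subring_on (L_field \<rho>)"
  unfolding L_field_def by (rule subring_on_generate_ring)

lemma L_field_gens: "to_ac c \<in> L_field \<rho>" "n > 0 \<Longrightarrow> \<rho> n \<in> L_field \<rho>"
  unfolding L_field_def by (auto intro!: generate_ring.incl)

lemma L_field_inverse: "z \<in> L_field \<rho> \<Longrightarrow> z \<noteq> 0 \<Longrightarrow> inverse z \<in> L_field \<rho>"
  using inverse_in_algebraic_subring[OF subring_on_L_field[of \<rho>]] L_field_gens(1) by blast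

lemma prime_block_dvd: "l \<le> m \<Longrightarrow> prime_block 1 l dvd prime_block 1 m"
  unfolding prime_block_def by (rule prod_dvd_prod_subset) auto

lemma L_field_radical_ext:
  fixes \<rho> :: "nat \<Rightarrow> complex fls alg_closure"
  assumes \<rho>: "\<And>n. n > 0 \<Longrightarrow> \<rho> n ^ nth_prime n = to_ac fls_X"
  shows "L_field \<rho> \<subseteq> (\<Union>l. radical_ext (prime_block 1 l))"
  unfolding L_field_def
proof (rule generate_ring_least)
  let ?V = "\<Union>l. radical_ext (prime_block 1 l)"
  have up: "\<exists>l. a \<in> radical_ext (prime_block 1 l) \<and> b \<in> radical_ext (prime_block 1 l)"
    if ab: "a \<in> ?V" "b \<in> ?V" for a b
  proof -
    obtain l m where "a \<in> radical_ext (prime_block 1 l)" "b \<in> radical_ext (prime_block 1 m)" using ab by auto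
    then show ?thesis
      using radical_ext_mono[OF prime_block_dvd[of l "max l m"]]
        radical_ext_mono[OF prime_block_dvd[of m "max l m"]] by auto
  qed
  show "subring_on ?V"
  proof (rule subring_onI)
    show "1 \<in> ?V" using radical_ext_const[of 1] by auto
    fix a b assume "a \<in> ?V" "b \<in> ?V"
    from up[OF this] obtain l where l: "a \<in> radical_ext (prime_block 1 l)" "b \<in> radical_ext (prime_block 1 l)"
      by blast
    show "a - b \<in> ?V" using subring_on_diff[OF subring_on_radical_ext l] by (rule UN_I[OF UNIV_I])
    show "a * b \<in> ?V" using subring_on_mult[OF subring_on_radical_ext l] by (rule UN_I[OF UNIV_I])
  qed
  have "\<rho> n \<in> ?V" if "n > 0" for n
  proof -
    have "nth_prime n dvd prime_block 1 n"
      unfolding prime_block_def using that by (intro dvd_prodI) auto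
    then show ?thesis
      using root_in_radical_ext[OF nth_prime_pos \<rho>[OF that]] radical_ext_mono by blast
  qed
  then show "range to_ac \<union> \<rho> ` {n. n > 0} \<subseteq> ?V" using radical_ext_const by auto
qed

text \<open>\<open>L\<close> is not finitely generated over \<open>\<complex>((v))\<close>: finitely many elements involve finitely many
  radicals, and a further prime does not divide the degree of the field that these generate.\<close>

lemma L_field_not_fin_gen:
  fixes \<rho> :: "nat \<Rightarrow> complex fls alg_closure"
  assumes \<rho>: "\<And>n. n > 0 \<Longrightarrow> \<rho> n ^ nth_prime n = to_ac fls_X"
    and F: "finite F" "F \<subseteq> L_field \<rho>"
  shows "\<exists>V. subring_on V \<and> range to_ac \<subseteq> V \<and> F \<subseteq> V \<and> (\<exists>n>0. \<rho> n \<notin> V)"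
proof -
  have "\<exists>l. F \<subseteq> radical_ext (prime_block 1 l)" using F
  proof (induction rule: finite_induct)
    case (insert x F)
    then obtain l where l: "F \<subseteq> radical_ext (prime_block 1 l)" by auto
    obtain m where m: "x \<in> radical_ext (prime_block 1 m)" using L_field_radical_ext[OF \<rho>] insert by blast
    have "insert x F \<subseteq> radical_ext (prime_block 1 (max l m))"
      using l m radical_ext_mono[OF prime_block_dvd[of l "max l m"]]
        radical_ext_mono[OF prime_block_dvd[of m "max l m"]] by auto
    then show ?case by blast
  qed auto
  then obtain l where l: "F \<subseteq> radical_ext (prime_block 1 l)" by blast
  have "\<rho> (Suc l) \<notin> radical_ext (prime_block 1 l)"
    using nth_prime_not_dvd_block[of "Suc l" 1 l]
    by (intro root_notin_radical_ext[OF prime_block_pos \<rho>]) auto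
  then show ?thesis using l subring_on_radical_ext radical_ext_const by blast
qed

section \<open>The ring \<open>D\<close>\<close>

subsection \<open>Generators and relations\<close>

lemma const_of_hom [simp]:
  "const_of 0 = 0" "const_of 1 = 1" "const_of (a + b) = const_of a + const_of b"
  "const_of (a - b) = const_of a - const_of b" "const_of (- a) = - const_of a"
  "const_of (a * b) = const_of a * const_of b"
  by (simp_all add: const_of_def one_pCons)

lemma const_of_power [simp]: "const_of (a ^ n) = const_of a ^ n"
  by (induction n) simp_all

lemma const_of_eq_iff [simp]: "const_of a = const_of b \<longleftrightarrow> a = b"
  by (simp add: const_of_def)

lemma const_of_eq_0_iff [simp]: "const_of a = 0 \<longleftrightarrow> a = 0"
  by (simp add: const_of_def)

lemma u_el_nonzero [simp]: "u_el \<noteq> 0" and v_el_nonzero [simp]: "v_el \<noteq> 0"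
  by (simp_all add: u_el_def v_el_def series_u_def series_v_def)

lemma u_inv_mult: "u_el * u_inv = 1"
  by (simp add: u_el_def u_inv_def const_of_def series_u_def one_pCons)

lemma u_inv_cancel: "u_el * (u_inv * x) = x"
  using u_inv_mult by (simp flip: mult.assoc)

lemma x_seq_relations:
  "x_seq 0 = u_el * [:0, 1:]" "v_el * x_seq 0 = 1 + u_el * x_seq 1"
  "n > 0 \<Longrightarrow> x_seq n ^ nth_prime n = v_el + u_el * x_seq (Suc n)"
proof -
  show "x_seq 0 = u_el * [:0, 1:]" by simp
  show "v_el * x_seq 0 = 1 + u_el * x_seq 1" by (simp only: One_nat_def x_seq.simps(2) u_inv_cancel) simp
  show "x_seq n ^ nth_prime n = v_el + u_el * x_seq (Suc n)" if "n > 0"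
    using that by (cases n) (simp_all add: u_inv_cancel)
qed

lemma subring_on_R_ring: "subring_on R_ring"
proof (rule subring_onI)
  show "1 \<in> R_ring" unfolding R_ring_def using const_of_hom(2) by (metis rangeI)
  show "a - b \<in> R_ring" "a * b \<in> R_ring" if "a \<in> R_ring" "b \<in> R_ring" for a b
    using that unfolding R_ring_def by (auto simp flip: const_of_hom)
qed

lemma subring_on_D_ring: "subring_on D_ring"
  unfolding D_ring_def by (rule subring_on_generate_ring)

lemma D_ring_gens: "const_of r \<in> D_ring" "x_seq n \<in> D_ring"
  unfolding D_ring_def R_ring_def by (auto intro: generate_ring.incl)

lemma R_ring_subset_D_ring: "R_ring \<subseteq> D_ring"
  using D_ring_gens by (auto simp: R_ring_def)

lemma u_v_in_D_ring: "u_el \<in> D_ring" "v_el \<in> D_ring"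
  by (simp_all add: u_el_def v_el_def D_ring_gens)

lemma degree_x_seq_1: "Polynomial.degree (x_seq 1) = 1"
proof -
  have nz: "to_fract series_v * to_fract series_u \<noteq> 0" "inverse (to_fract series_u) \<noteq> 0"
    by (simp_all add: series_u_def series_v_def)
  have "x_seq 1 = Polynomial.smult (inverse (to_fract series_u)) [:- 1, to_fract series_v * to_fract series_u:]"
    by (simp add: u_inv_def v_el_def u_el_def const_of_def one_pCons)
  then show ?thesis using nz by simp
qed

declare x_seq.simps [simp del]

lemma degree_x_seq_Suc:
  assumes "n > 0" "Polynomial.degree (x_seq n) > 0"
  shows "Polynomial.degree (x_seq (Suc n)) = nth_prime n * Polynomial.degree (x_seq n)"
proof -
  obtain m where n: "n = Suc m" using assms by (cases n) auto
  have nz: "x_seq n \<noteq> 0" using assms(2) by auto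
  have inz: "inverse (to_fract series_u) \<noteq> 0" by (simp add: series_u_def)
  have xp: "Polynomial.degree (x_seq n ^ nth_prime n) = nth_prime n * Polynomial.degree (x_seq n)"
    using nz by (simp add: degree_power_eq)
  have "x_seq (Suc n) = Polynomial.smult (inverse (to_fract series_u)) (x_seq n ^ nth_prime n + (- v_el))"
    unfolding n by (simp add: x_seq.simps(3) u_inv_def)
  moreover have "Polynomial.degree (- v_el) < Polynomial.degree (x_seq n ^ nth_prime n)"
    unfolding xp using assms(2) nth_prime_pos[of n] by (simp add: v_el_def const_of_def)
  ultimately have "Polynomial.degree (x_seq (Suc n)) = Polynomial.degree (x_seq n ^ nth_prime n)"
    using inz by (simp only: degree_smult_eq degree_add_eq_left) simp
  then show ?thesis by (simp only: xp)
qed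

lemma degree_x_seq_pos: "n > 0 \<Longrightarrow> Polynomial.degree (x_seq n) > 0"
proof (induction n)
  case (Suc n)
  show ?case
  proof (cases "n = 0")
    case True
    then show ?thesis using degree_x_seq_1 by simp
  next
    case False
    then show ?thesis using degree_x_seq_Suc[of n] Suc.IH nth_prime_pos[of n] by simp
  qed
qed simp

lemma degree_mixed_monomial:
  "n > 0 \<Longrightarrow> mixed_monomial x_seq n k \<noteq> 0 \<and>
    Polynomial.degree (mixed_monomial x_seq n k) = k * Polynomial.degree (x_seq n)"
proof (induction k arbitrary: n rule: less_induct)
  case (less k)
  show ?case
  proof (cases "k = 0")
    case True
    then show ?thesis by (simp add: mixed_monomial_0)
  next
    case False
    let ?p = "nth_prime n"
    have "k div ?p < k" using False nth_prime_ge_2[of n] by simp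
    then have IH: "mixed_monomial x_seq (Suc n) (k div ?p) \<noteq> 0"
      "Polynomial.degree (mixed_monomial x_seq (Suc n) (k div ?p)) = (k div ?p) * Polynomial.degree (x_seq (Suc n))"
      using less.IH by auto
    have d: "Polynomial.degree (x_seq n) > 0" using degree_x_seq_pos less.prems by blast
    then have nz: "x_seq n \<noteq> 0" by auto
    have "Polynomial.degree (mixed_monomial x_seq n k) =
        k mod ?p * Polynomial.degree (x_seq n) + (k div ?p) * (?p * Polynomial.degree (x_seq n))"
      unfolding mixed_monomial_step[of x_seq n k] using IH nz degree_x_seq_Suc[OF less.prems d]
      by (simp add: degree_mult_eq degree_power_eq)
    also have "\<dots> = (k mod ?p + (k div ?p) * ?p) * Polynomial.degree (x_seq n)"
      by (simp only: algebra_simps)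
    also have "\<dots> = k * Polynomial.degree (x_seq n)" by (simp only: mod_div_mult_eq)
    finally show ?thesis
      using IH(1) nz by (simp add: mixed_monomial_step[of x_seq n k])
  qed
qed

subsection \<open>A basis of \<open>R[x\<^sub>1, x\<^sub>2, \<dots>]\<close>\<close>

text \<open>The monomials \<open>b\<^sub>k\<close>, one of each degree in \<open>X\<close>.\<close>

abbreviation basis_el :: "nat \<Rightarrow> ambient"
  where "basis_el \<equiv> mixed_monomial x_seq 1"

lemma degree_basis_el: "Polynomial.degree (basis_el k) = k" "basis_el k \<noteq> 0"
  using degree_mixed_monomial[of 1 k] degree_x_seq_1 by simp_all

lemma mixed_monomial_in_D: "mixed_monomial x_seq n k \<in> D_ring"
proof (induction k arbitrary: n rule: less_induct)
  case (less k)
  show ?case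
  proof (cases "k = 0")
    case True
    then show ?thesis using subring_on_1[OF subring_on_D_ring] by (simp add: mixed_monomial_0)
  next
    case False
    then have "k div nth_prime n < k" using nth_prime_ge_2[of n] by simp
    then show ?thesis
      unfolding mixed_monomial_step[of x_seq n k]
      by (intro subring_on_mult[OF subring_on_D_ring] subring_on_power[OF subring_on_D_ring] D_ring_gens less.IH)
  qed
qed

text \<open>\<open>d\<close> is the combination of the basis elements with coefficients \<open>r\<close>.\<close>

definition basis_rep :: "ambient \<Rightarrow> (nat \<Rightarrow> power_series_uv) \<Rightarrow> bool"
  where "basis_rep d r \<longleftrightarrow> (\<exists>M. (\<forall>k\<ge>M. r k = 0) \<and> d = (\<Sum>k<M. const_of (r k) * basis_el k))"

lemma basis_rep_bound:
  assumes "basis_rep d r" "\<forall>k\<ge>N. r k = 0"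
  shows "d = (\<Sum>k<N. const_of (r k) * basis_el k)"
proof -
  obtain M where M: "\<forall>k\<ge>M. r k = 0" "d = (\<Sum>k<M. const_of (r k) * basis_el k)"
    using assms(1) by (auto simp: basis_rep_def)
  have "(\<Sum>k<M. const_of (r k) * basis_el k) = (\<Sum>k<N. const_of (r k) * basis_el k)"
  proof (cases "M \<le> N")
    case True
    then show ?thesis using M by (intro sum.mono_neutral_left) auto
  next
    case False
    then show ?thesis using assms(2) by (intro sum.mono_neutral_right) auto
  qed
  then show ?thesis using M by simp
qed

lemma basis_rep_finite: "basis_rep d r \<Longrightarrow> \<exists>M. \<forall>k\<ge>M. r k = 0"
  by (auto simp: basis_rep_def)

lemma basis_rep_smult: "basis_rep d r \<Longrightarrow> basis_rep (const_of s * d) (\<lambda>k. s * r k)"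
  unfolding basis_rep_def by (auto simp: sum_distrib_left mult.assoc)

lemma basis_rep_add:
  assumes "basis_rep d r" "basis_rep d' r'"
  shows "basis_rep (d + d') (\<lambda>k. r k + r' k)"
proof -
  obtain M M' where M: "\<forall>k\<ge>M. r k = 0" "\<forall>k\<ge>M'. r' k = 0" using assms[THEN basis_rep_finite] by blast
  have "d = (\<Sum>k<max M M'. const_of (r k) * basis_el k)" "d' = (\<Sum>k<max M M'. const_of (r' k) * basis_el k)"
    using M by (intro basis_rep_bound[OF assms(1)] basis_rep_bound[OF assms(2)]; simp)+
  then show ?thesis
    using M unfolding basis_rep_def by (intro exI[of _ "max M M'"]) (simp add: sum.distrib algebra_simps)
qed

lemma basis_rep_diff:
  assumes "basis_rep d r" "basis_rep d' r'"
  shows "basis_rep (d - d') (\<lambda>k. r k - r' k)"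
  using basis_rep_add[OF assms(1) basis_rep_smult[OF assms(2), of "-1"]] by simp

lemma independent_of_degrees:
  fixes f :: "nat \<Rightarrow> 'k::field poly"
  assumes f: "\<And>k. Polynomial.degree (f k) = k" "\<And>k. f k \<noteq> 0"
    and eq: "(\<Sum>k<M. Polynomial.smult (c k) (f k)) = 0" and "k < M"
  shows "c k = 0"
  using eq \<open>k < M\<close>
proof (induction M arbitrary: k)
  case (Suc M)
  have "0 = Polynomial.coeff (\<Sum>k<Suc M. Polynomial.smult (c k) (f k)) M" using Suc.prems by simp
  also have "\<dots> = (\<Sum>k<M. c k * Polynomial.coeff (f k) M) + c M * lead_coeff (f M)"
    by (simp add: coeff_sum f)
  also have "(\<Sum>k<M. c k * Polynomial.coeff (f k) M) = 0"
    by (intro sum.neutral ballI) (simp add: coeff_eq_0 f)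
  finally have "c M * lead_coeff (f M) = 0" by simp
  moreover have "lead_coeff (f M) \<noteq> 0" using f(2) by simp
  ultimately have "c M = 0" by (simp only: mult_eq_0_iff) simp
  then show ?case using Suc by (cases "k = M") auto
qed simp

lemma sum_delta_coeff:
  fixes h :: "'a::zero \<Rightarrow> 'b::comm_ring_1" and j N :: nat
  assumes "h 0 = 0" "j < N"
  shows "(\<Sum>k<N. h (if k = j then s else 0) * f k) = h s * f j"
proof -
  have "(\<Sum>k<N. h (if k = j then s else 0) * f k) = (\<Sum>k<N. if k = j then h s * f j else 0)"
    by (intro sum.cong refl) (simp add: assms)
  then show ?thesis using assms(2) sum.delta[of "{..<N}" j "\<lambda>_. h s * f j"] by simp
qed

lemma basis_rep_0:
  assumes "basis_rep 0 r" shows "r k = 0"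
proof -
  obtain M where M: "\<forall>k\<ge>M. r k = 0" "0 = (\<Sum>k<M. const_of (r k) * basis_el k)"
    using assms by (auto simp: basis_rep_def)
  have "(\<Sum>k<M. Polynomial.smult (to_fract (r k)) (basis_el k)) = 0"
    using M(2) by (simp add: const_of_def)
  from independent_of_degrees[OF degree_basis_el this] have "k < M \<Longrightarrow> to_fract (r k) = 0" .
  then show ?thesis using M(1) by (cases "k < M") auto
qed

lemma basis_rep_unique: "basis_rep d r \<Longrightarrow> basis_rep d r' \<Longrightarrow> r = r'"
  using basis_rep_0[of "\<lambda>k. r k - r' k"] basis_rep_diff[of d r d r'] by (auto simp: fun_eq_iff)

subsection \<open>Reduction modulo \<open>u\<close>\<close>

text \<open>The image of a power series under \<open>u \<mapsto> 0\<close>, in the algebraic closure of \<open>\<complex>((v))\<close>.\<close>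

definition reduce :: "power_series_uv \<Rightarrow> complex fls alg_closure"
  where "reduce r = to_ac (fps_to_fls (r $ 0))"

lemma reduce_hom:
  "reduce 0 = 0" "reduce 1 = 1" "reduce (a + b) = reduce a + reduce b"
  "reduce (a - b) = reduce a - reduce b" "reduce (- a) = - reduce a" "reduce (a * b) = reduce a * reduce b"
  by (simp_all add: reduce_def fls_times_fps_to_fls)

lemma reduce_u: "reduce series_u = 0" and reduce_v: "reduce series_v = to_ac fls_X"
  by (simp_all add: reduce_def series_u_def series_v_def)

lemma reduce_eq_0_iff: "reduce r = 0 \<longleftrightarrow> series_u dvd r"
  by (simp add: reduce_def series_u_def u_dvd_iff)

text \<open>A choice of the roots \<open>v\<^sup>1\<^sup>/\<^sup>p\<close>.\<close>

locale radical_system =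
  fixes \<rho> :: "nat \<Rightarrow> complex fls alg_closure"
  assumes roots: "\<And>n. n > 0 \<Longrightarrow> \<rho> n ^ nth_prime n = to_ac fls_X"
begin

text \<open>Simultaneous \<open>R\<close>-linear combinations of the monomials in the \<open>x\<^sub>i\<close> and of the corresponding monomials
  in the radicals \<open>\<rho>\<^sub>i\<close>, with indices \<open>i \<ge> n\<close>.\<close>

inductive paired :: "nat \<Rightarrow> ambient \<Rightarrow> complex fls alg_closure \<Rightarrow> bool" for n where
  zero: "paired n 0 0"
| step: "paired n d t \<Longrightarrow>
    paired n (const_of r * mixed_monomial x_seq n k + d) (reduce r * mixed_monomial \<rho> n k + t)"

lemma paired_monomial: "paired n (mixed_monomial x_seq n k) (mixed_monomial \<rho> n k)"
  using paired.step[OF paired.zero, of n 1 k] by (simp add: reduce_hom)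

lemma paired_add: "paired n d t \<Longrightarrow> paired n e s \<Longrightarrow> paired n (d + e) (t + s)"
  by (induction rule: paired.induct) (auto simp: add.assoc intro: paired.step)

lemma paired_smult: "paired n d t \<Longrightarrow> paired n (const_of r * d) (reduce r * t)"
proof (induction rule: paired.induct)
  case zero
  then show ?case using paired.zero by simp
next
  case (step d t r' k)
  then show ?case
    using paired.step[OF step.IH, of "r * r'" k] by (simp add: reduce_hom algebra_simps)
qed

lemma paired_diff: "paired n d t \<Longrightarrow> paired n e s \<Longrightarrow> paired n (d - e) (t - s)"
  using paired_add[of n d t "const_of (-1) * e" "reduce (-1) * s"] paired_smult[of n e s "-1"]
  by (simp add: reduce_hom)

lemma paired_Suc: "paired (Suc n) d t \<Longrightarrow> paired n d t"
proof (induction rule: paired.induct)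
  case (step d t r k)
  then show ?case
    using paired.step[OF step.IH, of r "nth_prime n * k"] by (simp only: mixed_monomial_shift)
qed (rule paired.zero)

lemma paired_linear_closure:
  assumes "\<And>k. paired n (a * mixed_monomial x_seq n k) (b * mixed_monomial \<rho> n k)" "paired n d t"
  shows "paired n (a * d) (b * t)"
  using assms(2)
proof (induction rule: paired.induct)
  case zero
  then show ?case using paired.zero by simp
next
  case (step d t r k)
  have "paired n (const_of r * (a * mixed_monomial x_seq n k) + a * d)
      (reduce r * (b * mixed_monomial \<rho> n k) + b * t)"
    by (intro paired_add paired_smult assms(1) step.IH)
  then show ?case by (simp add: algebra_simps)
qed

text \<open>A carry in the mixed radix system corresponds to the relation \<open>x\<^sub>n\<^sup>p = v + u x\<^sub>n\<^sub>+\<^sub>1\<close>, whose last term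
  disappears on the side of the radicals.\<close>

lemma paired_mult_x:
  assumes "n > 0"
  shows "paired n d t \<Longrightarrow> paired n (x_seq n * d) (\<rho> n * t)"
proof (rule paired_linear_closure)
  fix k
  show "paired n (x_seq n * mixed_monomial x_seq n k) (\<rho> n * mixed_monomial \<rho> n k)"
    using assms
  proof (induction k arbitrary: n rule: less_induct)
    case (less k)
    let ?p = "nth_prime n"
    define q where "q = k div ?p"
    have ep: "k mod ?p < ?p" using nth_prime_pos[of n] by simp
    show ?case
    proof (cases "Suc (k mod ?p) < ?p")
      case True
      then show ?thesis using paired_monomial[of n "Suc k"] by (simp only: mixed_monomial_times)
    next
      case False
      then have e: "Suc (k mod ?p) = ?p" using ep by simp
      have "k \<noteq> 0" using e nth_prime_ge_2[of n] by (intro notI) simp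
      then have "q < k" using nth_prime_ge_2[of n] by (simp add: q_def)
      have "paired n (const_of series_v * mixed_monomial x_seq (Suc n) q +
            const_of series_u * (x_seq (Suc n) * mixed_monomial x_seq (Suc n) q))
          (reduce series_v * mixed_monomial \<rho> (Suc n) q + reduce series_u * (\<rho> (Suc n) * mixed_monomial \<rho> (Suc n) q))"
        by (intro paired_add paired_smult paired_Suc[OF paired_monomial]
            paired_Suc[OF less.IH[OF \<open>q < k\<close>, of "Suc n"]]) simp
      then show ?thesis
        unfolding mixed_monomial_carry[OF e] q_def[symmetric] roots[OF less.prems] x_seq_relations(3)[OF less.prems]
        by (simp only: reduce_u reduce_v u_el_def[symmetric] v_el_def[symmetric] distrib_right mult.assoc
            mult_zero_left add_0_right)
    qed
  qed
qed

lemma paired_mult_x_power: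
  assumes "n > 0" "paired n d t"
  shows "paired n (x_seq n ^ e * d) (\<rho> n ^ e * t)"
  by (induction e) (use assms paired_mult_x in \<open>auto simp: mult.assoc\<close>)

lemma paired_mult_later:
  assumes "n > 0"
  shows "paired n d t \<Longrightarrow> paired n (x_seq (n + j) * d) (\<rho> (n + j) * t)"
  using assms
proof (induction j arbitrary: n d t)
  case 0
  then show ?case using paired_mult_x by simp
next
  case (Suc j)
  show ?case
  proof (rule paired_linear_closure[OF _ Suc.prems(1)])
    fix k
    let ?e = "k mod nth_prime n" and ?q = "k div nth_prime n"
    have "paired (Suc n) (x_seq (Suc n + j) * mixed_monomial x_seq (Suc n) ?q)
        (\<rho> (Suc n + j) * mixed_monomial \<rho> (Suc n) ?q)"
      by (intro Suc.IH paired_monomial) simp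
    from paired_mult_x_power[OF Suc.prems(2) paired_Suc[OF this], of ?e]
    show "paired n (x_seq (n + Suc j) * mixed_monomial x_seq n k) (\<rho> (n + Suc j) * mixed_monomial \<rho> n k)"
      unfolding mixed_monomial_step[of _ n k] by (simp add: algebra_simps)
  qed
qed

lemma paired_imp_rep:
  assumes "paired 1 d t"
  shows "\<exists>r M. basis_rep d r \<and> (\<forall>k\<ge>M. r k = 0) \<and> t = (\<Sum>k<M. reduce (r k) * mixed_monomial \<rho> 1 k)"
  using assms
proof (induction rule: paired.induct)
  case zero
  then show ?case
    unfolding basis_rep_def by (intro exI[of _ "\<lambda>_. 0"] exI[of _ 0]) (auto intro: exI[of _ 0])
next
  case (step d t s j)
  then obtain r M where r: "basis_rep d r" "\<forall>k\<ge>M. r k = 0" "t = (\<Sum>k<M. reduce (r k) * mixed_monomial \<rho> 1 k)"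
    by blast
  define r' where "r' k = (if k = j then s else 0)" for k
  define N where "N = max M (Suc j)"
  have jN: "j < N" by (simp add: N_def)
  have d: "(\<Sum>k<N. const_of (r' k) * basis_el k) = const_of s * basis_el j"
    "(\<Sum>k<N. reduce (r' k) * mixed_monomial \<rho> 1 k) = reduce s * mixed_monomial \<rho> 1 j"
    unfolding r'_def by (rule sum_delta_coeff[OF _ jN], simp add: reduce_hom)+
  have "\<forall>k\<ge>N. r' k = 0" by (auto simp: r'_def N_def)
  then have "basis_rep (const_of s * basis_el j) r'"
    unfolding basis_rep_def using d(1) by (intro exI[of _ N]) simp
  from basis_rep_add[OF this r(1)]
  have "basis_rep (const_of s * basis_el j + d) (\<lambda>k. r' k + r k)" .
  moreover have "\<forall>k\<ge>N. r' k + r k = 0" using r(2) by (auto simp: r'_def N_def)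
  moreover have "t = (\<Sum>k<N. reduce (r k) * mixed_monomial \<rho> 1 k)"
    unfolding r(3) using r(2) by (intro sum.mono_neutral_left) (auto simp: N_def reduce_hom)
  then have "reduce s * mixed_monomial \<rho> 1 j + t = (\<Sum>k<N. reduce (r' k + r k) * mixed_monomial \<rho> 1 k)"
    using d(2) by (simp add: reduce_hom sum.distrib algebra_simps)
  ultimately show ?case by blast
qed

subsection \<open>The homomorphism from \<open>D\<close> to \<open>L\<close>\<close>

abbreviation (input) "v_root \<equiv> (to_ac fls_X :: complex fls alg_closure)"

text \<open>The graph of the homomorphism is the subring of the product that is generated by the prescribed
  values on the generators of \<open>D\<close>.\<close>

inductive graph :: "ambient \<Rightarrow> complex fls alg_closure \<Rightarrow> bool" where
  const: "graph (const_of r) (reduce r)"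
| x0: "graph (x_seq 0) (inverse v_root)"
| x: "n > 0 \<Longrightarrow> graph (x_seq n) (\<rho> n)"
| diff: "graph a s \<Longrightarrow> graph b t \<Longrightarrow> graph (a - b) (s - t)"
| mult: "graph a s \<Longrightarrow> graph b t \<Longrightarrow> graph (a * b) (s * t)"

text \<open>Powers of \<open>v\<close> are admitted as denominators; they are needed for \<open>x\<^sub>0\<close>, which is not a combination of
  the monomials, whereas \<open>v x\<^sub>0 = 1 + u x\<^sub>1\<close> is one.\<close>

definition paired_loc :: "ambient \<Rightarrow> complex fls alg_closure \<Rightarrow> bool"
  where "paired_loc d t \<longleftrightarrow> (\<exists>m. paired 1 (v_el ^ m * d) (v_root ^ m * t))"

lemma v_el_power: "v_el ^ m = const_of (series_v ^ m)"
  by (simp add: v_el_def)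

lemma reduce_v_power: "reduce (series_v ^ m) = v_root ^ m"
  by (induction m) (simp_all add: reduce_hom reduce_v)

lemma paired_v_power: "paired 1 d t \<Longrightarrow> paired 1 (v_el ^ m * d) (v_root ^ m * t)"
  using paired_smult[of 1 d t "series_v ^ m"] by (simp only: v_el_power reduce_v_power)

lemma paired_loc_diff:
  assumes "paired_loc d t" "paired_loc e s" shows "paired_loc (d - e) (t - s)"
proof -
  obtain m n where p: "paired 1 (v_el ^ m * d) (v_root ^ m * t)" "paired 1 (v_el ^ n * e) (v_root ^ n * s)"
    using assms by (auto simp: paired_loc_def)
  have "paired 1 (v_el ^ n * (v_el ^ m * d) - v_el ^ m * (v_el ^ n * e))
      (v_root ^ n * (v_root ^ m * t) - v_root ^ m * (v_root ^ n * s))"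
    by (rule paired_diff[OF paired_v_power[OF p(1)] paired_v_power[OF p(2)]])
  then show ?thesis
    unfolding paired_loc_def by (intro exI[of _ "m + n"]) (simp add: power_add algebra_simps)
qed

text \<open>The pairs in the graph act by multiplication on the localised pairs. Applied to the pair \<open>(1, 1)\<close>
  this shows that the graph consists of localised pairs, which are functional by \<open>basis_rep_0\<close>.\<close>

lemma graph_mult_paired_loc: "graph a b \<Longrightarrow> paired_loc d t \<Longrightarrow> paired_loc (a * d) (b * t)"
proof (induction arbitrary: d t rule: graph.induct)
  case (const r)
  then obtain m where m: "paired 1 (v_el ^ m * d) (v_root ^ m * t)" by (auto simp: paired_loc_def)
  show ?case
    unfolding paired_loc_def using paired_smult[OF m, of r] by (intro exI[of _ m]) (simp add: algebra_simps)
next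
  case x0
  then obtain m where m: "paired 1 (v_el ^ m * d) (v_root ^ m * t)" by (auto simp: paired_loc_def)
  have p: "paired 1 (v_el ^ m * d + const_of series_u * (x_seq 1 * (v_el ^ m * d)))
      (v_root ^ m * t + reduce series_u * (\<rho> 1 * (v_root ^ m * t)))"
    using paired_add[OF m paired_smult[OF paired_mult_x[OF _ m]]] by simp
  have "v_el ^ m * d + const_of series_u * (x_seq 1 * (v_el ^ m * d)) =
      (1 + u_el * x_seq 1) * (v_el ^ m * d)"
    by (simp only: u_el_def distrib_right mult_1_left mult.assoc)
  also have "\<dots> = v_el ^ Suc m * (x_seq 0 * d)"
    by (simp only: x_seq_relations(2)[symmetric] power_Suc mult_ac)
  finally have A: "v_el ^ m * d + const_of series_u * (x_seq 1 * (v_el ^ m * d)) = v_el ^ Suc m * (x_seq 0 * d)" .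
  have B: "v_root ^ m * t + reduce series_u * (\<rho> 1 * (v_root ^ m * t)) =
      v_root ^ Suc m * (inverse v_root * t)"
    by (simp add: reduce_u)
  show ?case unfolding paired_loc_def using p[unfolded A B] by (rule exI)
next
  case (x n)
  then obtain m where m: "paired 1 (v_el ^ m * d) (v_root ^ m * t)" by (auto simp: paired_loc_def)
  show ?case
    unfolding paired_loc_def using paired_mult_later[OF _ m, of "n - 1"] x(1)
    by (intro exI[of _ m]) (simp add: algebra_simps)
next
  case (diff a s b r)
  show ?case
    using paired_loc_diff[OF diff.IH(1)[OF diff.prems] diff.IH(2)[OF diff.prems]]
    by (simp only: left_diff_distrib)
next
  case (mult a s b r)
  then show ?case by (simp add: mult.assoc)
qed

lemma paired_loc_1: "paired_loc 1 1"
  unfolding paired_loc_def using paired_monomial[of 1 0] by (intro exI[of _ 0]) (simp add: mixed_monomial_0)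

lemma graph_paired_loc: "graph d t \<Longrightarrow> paired_loc d t"
  using graph_mult_paired_loc[OF _ paired_loc_1] by simp

lemma paired_loc_0: "paired_loc 0 t \<Longrightarrow> t = 0"
proof -
  assume "paired_loc 0 t"
  then obtain m where "paired 1 0 (v_root ^ m * t)" by (auto simp: paired_loc_def)
  from paired_imp_rep[OF this] obtain r M where
    r: "basis_rep 0 r" "v_root ^ m * t = (\<Sum>k<M. reduce (r k) * mixed_monomial \<rho> 1 k)" by blast
  then have "v_root ^ m * t = 0" using basis_rep_0[OF r(1)] by (simp add: reduce_hom)
  then show "t = 0" by simp
qed

lemma graph_unique: "graph d t \<Longrightarrow> graph d s \<Longrightarrow> t = s"
  using paired_loc_0[of "t - s"] graph_paired_loc[OF graph.diff[of d t d s]] by simp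

lemma D_ring_graph: "d \<in> D_ring \<longleftrightarrow> (\<exists>t. graph d t)"
proof
  have "subring_on {d. \<exists>t. graph d t}"
  proof (rule subring_onI)
    show "1 \<in> {d. \<exists>t. graph d t}" using graph.const[of 1] by auto
  qed (auto intro: graph.intros)
  moreover have "x_seq n \<in> {d. \<exists>t. graph d t}" for n
    by (cases n) (auto intro: graph.x0 graph.x)
  moreover have "const_of r \<in> {d. \<exists>t. graph d t}" for r using graph.const by blast
  ultimately have "D_ring \<subseteq> {d. \<exists>t. graph d t}"
    unfolding D_ring_def R_ring_def by (intro generate_ring_least) auto
  then show "d \<in> D_ring \<Longrightarrow> \<exists>t. graph d t" by blast
next
  assume "\<exists>t. graph d t"
  then obtain t where "graph d t" by blast
  then show "d \<in> D_ring"
    by (induction rule: graph.induct)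
      (auto intro: D_ring_gens subring_on_diff[OF subring_on_D_ring] subring_on_mult[OF subring_on_D_ring])
qed

text \<open>The homomorphism from \<open>D\<close> to \<open>L\<close>; its value is arbitrary outside \<open>D\<close>.\<close>

definition to_L :: "ambient \<Rightarrow> complex fls alg_closure"
  where "to_L d = (THE t. graph d t)"

lemma to_L_eqI: "graph d t \<Longrightarrow> to_L d = t"
  unfolding to_L_def using graph_unique by blast

lemma graph_to_L: "d \<in> D_ring \<Longrightarrow> graph d (to_L d)"
  using D_ring_graph to_L_eqI by blast

lemma to_L_hom:
  "to_L (const_of r) = reduce r" "n > 0 \<Longrightarrow> to_L (x_seq n) = \<rho> n" "to_L (x_seq 0) = inverse v_root"
  "a \<in> D_ring \<Longrightarrow> b \<in> D_ring \<Longrightarrow> to_L (a - b) = to_L a - to_L b"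
  "a \<in> D_ring \<Longrightarrow> b \<in> D_ring \<Longrightarrow> to_L (a * b) = to_L a * to_L b"
  by (auto intro!: to_L_eqI graph.intros graph_to_L)

lemma to_L_0: "to_L 0 = 0" and to_L_1: "to_L 1 = 1"
  using to_L_hom(1)[of 0] to_L_hom(1)[of 1] by (simp_all add: reduce_hom)

lemma to_L_add: "a \<in> D_ring \<Longrightarrow> b \<in> D_ring \<Longrightarrow> to_L (a + b) = to_L a + to_L b"
  using to_L_hom(4)[of a "0 - b"] to_L_hom(4)[of 0 b] subring_on_closed[OF subring_on_D_ring]
  by (simp add: to_L_0)

lemma to_L_in_L: "d \<in> D_ring \<Longrightarrow> to_L d \<in> L_field \<rho>"
proof -
  note cl = subring_on_closed[OF subring_on_L_field]
  have "graph d t \<Longrightarrow> t \<in> L_field \<rho>" for t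
  proof (induction rule: graph.induct)
    case (const r)
    then show ?case by (simp add: reduce_def L_field_gens)
  next
    case x0
    then show ?case using L_field_gens(1)[of "inverse fls_X" \<rho>] by simp
  qed (auto intro: cl L_field_gens)
  then show "d \<in> D_ring \<Longrightarrow> to_L d \<in> L_field \<rho>" using graph_to_L by blast
qed

lemma to_L_image: "to_L ` D_ring = L_field \<rho>"
proof
  show "to_L ` D_ring \<subseteq> L_field \<rho>" using to_L_in_L by blast
  note cl = subring_on_closed[OF subring_on_D_ring]
  have "subring_on (to_L ` D_ring)"
  proof (rule subring_onI)
    show "1 \<in> to_L ` D_ring" using to_L_1 cl(1) by (metis imageI)
    show "a - b \<in> to_L ` D_ring" "a * b \<in> to_L ` D_ring" if "a \<in> to_L ` D_ring" "b \<in> to_L ` D_ring" for a b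
      using that to_L_hom(4,5) cl by (auto simp flip: to_L_hom(4,5))
  qed note sub = this
  have V: "inverse v_root \<in> to_L ` D_ring" using D_ring_gens(2)[of 0] to_L_hom(3) by (metis imageI)
  have "to_ac c \<in> to_L ` D_ring" for c
  proof -
    define k where "k = nat (- fls_subdegree c)"
    have "fls_subdegree c \<ge> - int k" by (simp add: k_def)
    then have "c * fls_X ^ k = fps_to_fls (fls_regpart (c * fls_X ^ k))"
      by (cases "c = 0") (simp_all add: fls_subdegree_mult fls_subdegree_pow)
    then have "to_ac c * v_root ^ k = reduce (fps_const (fls_regpart (c * fls_X ^ k)))"
      by (simp add: reduce_def flip: to_ac_mult to_ac_power)
    then have "to_ac c = reduce (fps_const (fls_regpart (c * fls_X ^ k))) * inverse v_root ^ k"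
      by (simp add: field_simps)
    moreover have "reduce r \<in> to_L ` D_ring" for r using D_ring_gens(1)[of r] to_L_hom(1) by (metis imageI)
    ultimately show ?thesis using V subring_on_mult[OF sub] subring_on_power[OF sub] by metis
  qed
  moreover have "\<rho> n \<in> to_L ` D_ring" if "n > 0" for n
    using D_ring_gens(2)[of n] to_L_hom(2)[OF that] by (metis imageI)
  ultimately show "L_field \<rho> \<subseteq> to_L ` D_ring"
    unfolding L_field_def by (intro generate_ring_least sub) auto
qed

subsection \<open>The kernel\<close>

lemma D_ring_rep:
  assumes "d \<in> D_ring"
  shows "\<exists>m r M. basis_rep (v_el ^ m * d) r \<and> (\<forall>k\<ge>M. r k = 0) \<and>
    v_root ^ m * to_L d = (\<Sum>k<M. reduce (r k) * mixed_monomial \<rho> 1 k)"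
  using graph_paired_loc[OF graph_to_L[OF assms]] paired_imp_rep unfolding paired_loc_def by blast

text \<open>Modulo \<open>u\<close>, the element \<open>v\<close> is invertible in \<open>D\<close> with inverse \<open>x\<^sub>0\<close>.\<close>

lemma v_power_cancel_mod_u:
  assumes "d \<in> D_ring" "\<exists>e\<in>D_ring. v_el ^ m * d = u_el * e"
  shows "\<exists>e\<in>D_ring. d = u_el * e"
  using assms(2)
proof (induction m)
  case (Suc m)
  note cl = subring_on_closed[OF subring_on_D_ring]
  obtain e where e: "e \<in> D_ring" "v_el ^ Suc m * d = u_el * e" using Suc by blast
  have one: "1 = v_el * x_seq 0 - u_el * x_seq 1" by (simp only: x_seq_relations(2)) simp
  have "v_el ^ m * d = (v_el * x_seq 0 - u_el * x_seq 1) * (v_el ^ m * d)" by (simp only: one[symmetric] mult_1_left)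
  also have "\<dots> = x_seq 0 * (v_el ^ Suc m * d) - u_el * (x_seq 1 * (v_el ^ m * d))"
    by (simp only: power_Suc left_diff_distrib right_diff_distrib mult_ac)
  also have "\<dots> = u_el * (x_seq 0 * e - x_seq 1 * (v_el ^ m * d))"
    unfolding e(2) by (simp only: right_diff_distrib mult_ac)
  finally have "v_el ^ m * d = u_el * (x_seq 0 * e - x_seq 1 * (v_el ^ m * d))" .
  moreover have "x_seq 0 * e - x_seq 1 * (v_el ^ m * d) \<in> D_ring"
    using e assms(1) u_v_in_D_ring D_ring_gens by (intro cl)
  ultimately show ?case using Suc.IH by blast
qed simp

text \<open>The reductions of the coefficients of an element of the kernel vanish because the monomials in the
  radicals are linearly independent, so all coefficients are divisible by \<open>u\<close>.\<close>

theorem to_L_kernel: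
  assumes d: "d \<in> D_ring"
  shows "to_L d = 0 \<longleftrightarrow> (\<exists>e\<in>D_ring. d = u_el * e)"
proof
  assume "\<exists>e\<in>D_ring. d = u_el * e"
  then show "to_L d = 0"
    using to_L_hom(1)[of series_u] u_v_in_D_ring by (auto simp: to_L_hom(5) reduce_u u_el_def[symmetric])
next
  assume 0: "to_L d = 0"
  obtain m r M where r: "basis_rep (v_el ^ m * d) r" "\<forall>k\<ge>M. r k = 0"
    "v_root ^ m * to_L d = (\<Sum>k<M. reduce (r k) * mixed_monomial \<rho> 1 k)"
    using D_ring_rep[OF d] by blast
  have "(\<Sum>k<M. to_ac (fps_to_fls (r k $ 0)) * mixed_monomial \<rho> 1 k) = 0"
    using r(3) 0 by (simp add: reduce_def)
  then have "fps_to_fls (r k $ 0) = 0" if "k < M" for k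
    using mixed_radicals_independent[where m = M and c = "\<lambda>k. fps_to_fls (r k $ 0)", OF roots] that by blast
  then have "reduce (r k) = 0" for k
    using r(2) by (cases "k < M") (auto simp: reduce_def)
  then have "\<forall>k. \<exists>s. r k = series_u * s" by (simp add: reduce_eq_0_iff dvd_def)
  then obtain s where s: "\<And>k. r k = series_u * s k" by metis
  have "v_el ^ m * d = (\<Sum>k<M. const_of (r k) * basis_el k)" by (rule basis_rep_bound[OF r(1,2)])
  also have "\<dots> = u_el * (\<Sum>k<M. const_of (s k) * basis_el k)"
    by (simp add: s u_el_def sum_distrib_left mult.assoc)
  finally have eq: "v_el ^ m * d = u_el * (\<Sum>k<M. const_of (s k) * basis_el k)" .
  have "(\<Sum>k<M. const_of (s k) * basis_el k) \<in> D_ring"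
    by (intro subring_on_sum[OF subring_on_D_ring] subring_on_mult[OF subring_on_D_ring] D_ring_gens mixed_monomial_in_D)
  then show "\<exists>e\<in>D_ring. d = u_el * e" using v_power_cancel_mod_u[OF d] eq by blast
qed

text \<open>\<open>D\<close> is \<open>u\<close>-adically separated, since \<open>D[1/v]\<close> is a free module over \<open>R[1/v]\<close>.\<close>

lemma D_ring_separated:
  assumes d: "d \<in> D_ring" and div: "\<And>j. \<exists>e\<in>D_ring. d = u_el ^ j * e"
  shows "d = 0"
proof -
  obtain m r where r: "basis_rep (v_el ^ m * d) r" using D_ring_rep[OF d] by blast
  have "r k = 0" for k
  proof (rule ccontr)
    assume rk: "r k \<noteq> 0"
    define j where "j = Suc (subdegree (r k))"
    obtain e where e: "e \<in> D_ring" "d = u_el ^ j * e" using div by blast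
    obtain n s where s: "basis_rep (v_el ^ n * e) s" using D_ring_rep[OF e(1)] by blast
    have "basis_rep (const_of (series_v ^ n) * (v_el ^ m * d)) (\<lambda>k. series_v ^ n * r k)"
      by (rule basis_rep_smult[OF r])
    moreover have "basis_rep (const_of (series_v ^ m * series_u ^ j) * (v_el ^ n * e)) (\<lambda>k. series_v ^ m * series_u ^ j * s k)"
      by (rule basis_rep_smult[OF s])
    moreover have "const_of (series_v ^ n) * (v_el ^ m * d) = const_of (series_v ^ m * series_u ^ j) * (v_el ^ n * e)"
      by (simp add: e(2) v_el_def u_el_def mult_ac)
    ultimately have "(\<lambda>k. series_v ^ n * r k) = (\<lambda>k. series_v ^ m * series_u ^ j * s k)"
      using basis_rep_unique by simp
    then have eq: "series_v ^ n * r k = series_v ^ m * series_u ^ j * s k" by (rule fun_cong)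
    have sv: "series_v ^ i \<noteq> 0" "subdegree (series_v ^ i) = 0" for i
      by (simp_all add: series_v_def)
    have "s k \<noteq> 0"
    proof
      assume "s k = 0"
      then have "series_v ^ n * r k = 0" using eq by simp
      then show False using rk sv(1)[of n] by (simp only: mult_eq_0_iff simp_thms)
    qed
    then have "subdegree (series_v ^ m * series_u ^ j * s k) = j + subdegree (s k)"
      using sv[of m] by (simp add: series_u_def)
    moreover have "subdegree (series_v ^ n * r k) = subdegree (r k)" using sv[of n] rk by simp
    ultimately show False using eq by (simp add: j_def)
  qed
  then have "v_el ^ m * d = 0" using basis_rep_bound[OF r, of 0] by simp
  then show ?thesis by simp
qed

end

section \<open>Polynomials over \<open>R\<close> and over \<open>R[1/u]\<close>\<close>

lemma R_X_eq: "R_X = range (map_poly to_fract :: power_series_uv poly \<Rightarrow> ambient)"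
proof (intro equalityI subsetI)
  fix y assume "y \<in> R_X"
  then have "\<forall>i. \<exists>r. Polynomial.coeff y i = to_fract r" by (auto simp: R_X_def polys_over_def)
  then obtain r where r: "\<And>i. Polynomial.coeff y i = to_fract (r i)" by metis
  have "y = map_poly to_fract (\<Sum>i\<le>Polynomial.degree y. Polynomial.monom (r i) i)"
  proof (rule poly_eqI)
    fix n
    have "Polynomial.coeff (\<Sum>i\<le>Polynomial.degree y. Polynomial.monom (r i) i) n =
        (if n \<le> Polynomial.degree y then r n else 0)"
      by (simp add: coeff_sum)
    then show "Polynomial.coeff y n = Polynomial.coeff (map_poly to_fract (\<Sum>i\<le>Polynomial.degree y. Polynomial.monom (r i) i)) n"
      using r[of n] by (auto simp: coeff_map_poly coeff_eq_0)
  qed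
  then show "y \<in> range (map_poly to_fract)" by blast
qed (auto simp: R_X_def polys_over_def coeff_map_poly)

lemma subring_on_R_X: "subring_on R_X"
proof (rule subring_onI)
  show "1 \<in> R_X" unfolding R_X_eq using fract_poly_1 by (metis rangeI)
  show "a - b \<in> R_X" "a * b \<in> R_X" if "a \<in> R_X" "b \<in> R_X" for a b
    using that unfolding R_X_eq by (auto simp flip: fract_poly_diff fract_poly_mult)
qed

lemma const_of_fract_poly: "const_of r = map_poly to_fract [:r:]"
  by (simp add: const_of_def map_poly_pCons)

lemma R_X_gens: "const_of r \<in> R_X" "[:0, 1:] \<in> R_X"
proof -
  show "const_of r \<in> R_X" unfolding R_X_eq const_of_fract_poly by blast
  have "[:0, 1:] = map_poly to_fract [:0, 1 :: power_series_uv:]" by (simp add: map_poly_pCons)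
  then show "[:0, 1:] \<in> R_X" unfolding R_X_eq by blast
qed

lemma R_X_least:
  assumes V: "subring_on V" "\<And>r. const_of r \<in> V" "[:0, 1:] \<in> V"
  shows "R_X \<subseteq> V"
proof
  fix y assume "y \<in> R_X"
  then obtain p :: "power_series_uv poly" where y: "y = map_poly to_fract p" by (auto simp: R_X_eq)
  show "y \<in> V" unfolding y
  proof (induction p)
    case 0
    then show ?case using subring_on_0[OF V(1)] by simp
  next
    case (pCons r p)
    have "map_poly to_fract (pCons r p) = const_of r + [:0, 1:] * map_poly to_fract p"
      by (simp add: map_poly_pCons const_of_def)
    then show ?case using pCons V subring_on_closed[OF V(1)] by metis
  qed
qed

lemma R_X_coeff: "y \<in> R_X \<Longrightarrow> [:Polynomial.coeff y i:] \<in> R_ring"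
proof -
  assume "y \<in> R_X"
  then obtain r where "Polynomial.coeff y i = to_fract r" by (auto simp: R_X_def polys_over_def)
  then have "[:Polynomial.coeff y i:] = const_of r" by (simp add: const_of_def)
  then show ?thesis by (simp add: R_ring_def)
qed

lemma noeth_on_R_X: "noeth_on R_X"
  unfolding R_X_eq by (rule noeth_on_image[OF noeth_on_poly[OF noeth_on_power_series]]) simp_all

subsection \<open>Factoriality\<close>

lemma dvd_on_R_X: "dvd_on R_X (map_poly to_fract p) (map_poly to_fract q) \<longleftrightarrow> p dvd q"
  for p q :: "power_series_uv poly"
proof
  assume "dvd_on R_X (map_poly to_fract p) (map_poly to_fract q)"
  then obtain c :: "power_series_uv poly" where "map_poly to_fract q = map_poly to_fract (p * c)"
    by (auto simp: dvd_on_def R_X_eq)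
  then show "p dvd q" by (simp only: fract_poly_eq_iff) simp
qed (auto simp: dvd_on_def R_X_eq elim!: dvdE)

lemma prime_on_R_X_const:
  assumes p: "prime_elem p" shows "prime_on R_X (const_of p)"
proof -
  have P: "prime_elem [:p:]" using p by (rule lift_prime_elem_poly)
  have un: "\<not> unit_on R_X (const_of p)"
  proof
    assume "unit_on R_X (const_of p)"
    then have "dvd_on R_X (map_poly to_fract [:p:]) (map_poly to_fract 1)"
      unfolding const_of_fract_poly unit_on_def dvd_on_def by (auto dest: sym)
    then have "[:p:] dvd 1" by (simp only: dvd_on_R_X)
    then show False using P by (simp add: prime_elem_def)
  qed
  show ?thesis
    unfolding prime_on_def
  proof (intro conjI ballI impI un R_X_gens)
    show "const_of p \<noteq> 0" using p by (simp add: prime_elem_def)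
    fix a b assume ab: "a \<in> R_X" "b \<in> R_X" "dvd_on R_X (const_of p) (a * b)"
    obtain a' b' :: "power_series_uv poly" where ab': "a = map_poly to_fract a'" "b = map_poly to_fract b'"
      using ab by (auto simp: R_X_eq)
    have "[:p:] dvd a' * b'" using ab(3) unfolding ab' const_of_fract_poly fract_poly_mult[symmetric] dvd_on_R_X .
    then have "[:p:] dvd a' \<or> [:p:] dvd b'" using P by (rule prime_elem_dvd_multD[rotated])
    then show "dvd_on R_X (const_of p) a \<or> dvd_on R_X (const_of p) b"
      unfolding ab' const_of_fract_poly dvd_on_R_X .
  qed
qed

lemma prime_on_R_X_u: "prime_on R_X u_el"
  unfolding u_el_def series_u_def by (rule prime_on_R_X_const[OF prime_elem_u])

text \<open>Gauss's lemma, as Nagata's criterion for \<open>R[X]\<close> in \<open>K[X]\<close> with the primes of \<open>R\<close>.\<close>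

theorem ufd_on_R_X: "ufd_on R_X"
proof (rule ufd_on_Nagata[OF subring_on_R_X subring_on_UNIV])
  let ?\<Gamma> = "const_of ` {p. prime_elem p}"
  have const: "const_of r \<in> products_on R_X ?\<Gamma>" if "r \<noteq> 0" for r
    using power_series_prime_factors[OF that]
  proof (induction rule: products_on.induct)
    case (unit a)
    then obtain b where "a * b = 1" by (auto simp: unit_on_def)
    then have "const_of a * const_of b = 1" by (simp flip: const_of_hom)
    then show ?case using R_X_gens by (intro products_on.unit) (auto simp: unit_on_def)
  next
    case (step p a)
    then show ?case using products_on.step[of "const_of p" ?\<Gamma>] by simp
  qed
  show "prime_on R_X \<pi>" if "\<pi> \<in> ?\<Gamma>" for \<pi> using that prime_on_R_X_const by auto
  show "\<exists>s\<in>products_on R_X ?\<Gamma>. s * y \<in> R_X" for y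
  proof -
    have "\<exists>r. r \<noteq> 0 \<and> const_of r * y \<in> R_X"
    proof (induction y)
      case 0
      then show ?case using subring_on_0[OF subring_on_R_X] by (intro exI[of _ 1]) simp
    next
      case (pCons a q)
      obtain r where r: "r \<noteq> 0" "const_of r * q \<in> R_X" using pCons by blast
      obtain n d where nd: "a = Fract n d" "d \<noteq> 0" by (cases a)
      have a: "to_fract d * a = to_fract n" using nd by (simp add: Fract_conv_to_fract)
      have "const_of (d * r) * pCons a q = const_of (r * n) + const_of d * ([:0, 1:] * (const_of r * q))"
        unfolding const_of_def using a by (simp add: mult_ac)
      also have "\<dots> \<in> R_X"
        using r R_X_gens subring_on_add[OF subring_on_R_X] subring_on_mult[OF subring_on_R_X] by metis
      finally show ?case using r nd by (intro exI[of _ "d * r"]) simp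
    qed
    then show ?thesis using const by blast
  qed
  show "unit_on UNIV s" if "s \<in> products_on R_X ?\<Gamma>" for s
    using that
  proof (induction rule: products_on.induct)
    case (unit a)
    then show ?case by (auto simp: unit_on_def)
  next
    case (step p a)
    then obtain r where r: "p = const_of r" "r \<noteq> 0" by (auto simp: prime_elem_def)
    then have "p * [:inverse (to_fract r):] = 1" by (simp add: const_of_def one_pCons)
    then have "unit_on UNIV p" unfolding unit_on_def by blast
    then show ?case using step.IH unit_on_mult[OF subring_on_UNIV] by blast
  qed
  show "\<exists>s\<in>products_on R_X ?\<Gamma>. \<exists>c'\<in>R_X. c = s * c' \<and> (\<forall>\<pi>\<in>?\<Gamma>. \<not> dvd_on R_X \<pi> c')"
    if "c \<in> R_X" "c \<noteq> 0" for c
  proof -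
    obtain q :: "power_series_uv poly" where "c = map_poly to_fract q" using \<open>c \<in> R_X\<close> by (auto simp: R_X_eq)
    with \<open>c \<noteq> 0\<close> show ?thesis
    proof (induction "series_size (lead_coeff q)" arbitrary: c q rule: less_induct)
      case less
      show ?case
      proof (cases "\<exists>p. prime_elem p \<and> [:p:] dvd q")
        case True
        then obtain p q' where pq: "prime_elem p" "q = [:p:] * q'" by (auto elim!: dvdE)
        have nz: "p \<noteq> 0" "q' \<noteq> 0" using pq less.prems by auto
        have "series_size p > 0"
          using pq(1) series_size_0_imp_unit[OF nz(1)] by (auto simp: prime_elem_def)
        then have "series_size (lead_coeff q') < series_size (lead_coeff q)"
          using nz by (simp add: pq(2) series_size_mult)
        from less.hyps[OF this _ refl] nz
        obtain s c' where s: "s \<in> products_on R_X ?\<Gamma>" "c' \<in> R_X" "map_poly to_fract q' = s * c'"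
          "\<forall>\<pi>\<in>?\<Gamma>. \<not> dvd_on R_X \<pi> c'" by auto
        have "c = (const_of p * s) * c'"
          unfolding less.prems(2) pq(2) fract_poly_mult const_of_fract_poly by (simp only: s(3) mult.assoc)
        moreover have "const_of p * s \<in> products_on R_X ?\<Gamma>" using pq s by (intro products_on.step) auto
        ultimately show ?thesis using s by blast
      next
        case False
        have one: "1 \<in> products_on R_X ?\<Gamma>" using const[of 1] by simp
        have "\<forall>\<pi>\<in>?\<Gamma>. \<not> dvd_on R_X \<pi> c"
          using False dvd_on_R_X unfolding less.prems(2) const_of_fract_poly by auto
        moreover have "c \<in> R_X" using less.prems by (auto simp: R_X_eq)
        ultimately show ?thesis using one by (metis mult_1)
      qed
    qed
  qed
qed (use ufd_on_field_poly in auto)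

subsection \<open>Inverting \<open>u\<close>\<close>

lemma R_inv_u_X_iff: "y \<in> R_inv_u_X \<longleftrightarrow> (\<exists>k. u_el ^ k * y \<in> R_X)"
proof -
  let ?u = "to_fract series_u"
  let ?B = "generate_ring ring_of_type_algebra (range to_fract \<union> {inverse ?u})"
  have u0: "?u \<noteq> 0" by (simp add: series_u_def)
  note clB = subring_on_closed[OF subring_on_generate_ring[of "range to_fract \<union> {inverse ?u}"]]
  let ?V = "{a. \<exists>k. ?u ^ k * a \<in> range to_fract}"
  have pw: "to_fract (series_u ^ k) = ?u ^ k" for k by (induction k) simp_all
  have tf: "a - b \<in> range to_fract" "a * b \<in> range to_fract" if "a \<in> range to_fract" "b \<in> range to_fract"
    for a b :: "power_series_uv fract"
    using that by (auto simp flip: to_fract_diff to_fract_mult)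
  have pr: "?u ^ k \<in> range to_fract" for k by (metis pw rangeI)
  have "subring_on (range to_fract :: power_series_uv fract set)"
    by (rule subring_onI) (use pr[of 0] tf in auto)
  then have "subring_on ?V" by (rule subring_on_denominators) (use pr[of 1] in simp)
  moreover have "range to_fract \<union> {inverse ?u} \<subseteq> ?V"
  proof
    fix a assume "a \<in> range to_fract \<union> {inverse ?u}"
    then show "a \<in> ?V"
    proof
      assume "a \<in> range to_fract"
      then have "?u ^ 0 * a \<in> range to_fract" by simp
      then show ?thesis by blast
    next
      assume "a \<in> {inverse ?u}"
      then have "?u ^ 1 * a = ?u ^ 0" using u0 by simp
      then show ?thesis using pr by (metis (mono_tags, lifting) mem_Collect_eq)
    qed
  qed
  ultimately have BV: "?B \<subseteq> ?V" by (rule generate_ring_least)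
  have VB: "a \<in> ?B" if "?u ^ k * a \<in> range to_fract" for a k
  proof -
    have "inverse ?u ^ k * (?u ^ k * a) = a"
      using u0 by (simp add: mult.assoc[symmetric] power_mult_distrib[symmetric])
    moreover have "inverse ?u \<in> ?B" "?u ^ k * a \<in> ?B" using that by (auto intro: generate_ring.incl)
    ultimately show ?thesis using clB by metis
  qed
  have uk: "u_el ^ k * y = Polynomial.smult (?u ^ k) y" for k y
    by (induction k arbitrary: y) (simp_all add: u_el_def const_of_def mult.assoc)
  show ?thesis
  proof
    assume "y \<in> R_inv_u_X"
    then have "\<forall>i. Polynomial.coeff y i \<in> ?V" using BV by (auto simp: R_inv_u_X_def polys_over_def)
    then show "\<exists>k. u_el ^ k * y \<in> R_X"
    proof (induction y)
      case 0
      then show ?case using subring_on_0[OF subring_on_R_X] by simp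
    next
      case (pCons a y)
      have "a \<in> ?V" using pCons.prems[rule_format, of 0] by simp
      then obtain k where k: "?u ^ k * a \<in> range to_fract" by blast
      have "\<forall>i. Polynomial.coeff y i \<in> ?V"
      proof
        fix i show "Polynomial.coeff y i \<in> ?V" using pCons.prems[rule_format, of "Suc i"] by simp
      qed
      then obtain l where l: "u_el ^ l * y \<in> R_X" using pCons by blast
      obtain r where r: "?u ^ k * a = to_fract r" using k by blast
      have "u_el ^ (k + l) * pCons a y = const_of (series_u ^ l * r) + u_el ^ k * ([:0, 1:] * (u_el ^ l * y))"
        unfolding uk const_of_def using r[symmetric]
        by (simp add: pw power_add mult_ac smult_smult)
      also have "\<dots> \<in> R_X"
      proof -
        have "u_el ^ k \<in> R_X" unfolding u_el_def by (intro subring_on_power[OF subring_on_R_X] R_X_gens)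
        then show ?thesis
          by (intro subring_on_add[OF subring_on_R_X] subring_on_mult[OF subring_on_R_X] R_X_gens l)
      qed
      finally show ?case by blast
    qed
  next
    assume "\<exists>k. u_el ^ k * y \<in> R_X"
    then obtain k where "u_el ^ k * y \<in> R_X" by blast
    then have "?u ^ k * Polynomial.coeff y i \<in> range to_fract" for i
      unfolding uk R_X_def polys_over_def by auto
    then show "y \<in> R_inv_u_X" using VB by (auto simp: R_inv_u_X_def polys_over_def)
  qed
qed

lemma u_power_in_R_X: "u_el ^ k \<in> R_X"
  unfolding u_el_def by (intro subring_on_power[OF subring_on_R_X] R_X_gens)

lemma u_power_mult_u_inv_power: "u_el ^ k * u_inv ^ k = 1"
  by (simp add: u_inv_mult flip: power_mult_distrib)

lemma R_X_subset_R_inv_u_X: "R_X \<subseteq> R_inv_u_X"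
  using R_inv_u_X_iff by (metis mult_1 power_0 subsetI)

lemma subring_on_R_inv_u_X: "subring_on R_inv_u_X"
proof -
  have "R_inv_u_X = {y. \<exists>k. u_el ^ k * y \<in> R_X}" using R_inv_u_X_iff by blast
  then show ?thesis
    using subring_on_denominators[OF subring_on_R_X u_power_in_R_X[of 1]] by simp
qed

lemma R_inv_u_X_div_u: "u_el * y \<in> R_inv_u_X \<Longrightarrow> y \<in> R_inv_u_X"
  unfolding R_inv_u_X_iff by (metis mult.assoc power_Suc2)

lemma u_inv_in_R_inv_u_X: "u_inv \<in> R_inv_u_X"
  using R_inv_u_X_div_u[of u_inv] subring_on_1[OF subring_on_R_inv_u_X] by (simp add: u_inv_mult)

lemma D_ring_subset_R_inv_u_X: "D_ring \<subseteq> R_inv_u_X"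
proof -
  note cl = subring_on_closed[OF subring_on_R_inv_u_X]
  have c: "const_of r \<in> R_inv_u_X" for r using R_X_gens R_X_subset_R_inv_u_X by blast
  have uv: "u_el \<in> R_inv_u_X" "v_el \<in> R_inv_u_X" by (simp_all only: u_el_def v_el_def c)
  have x0: "x_seq 0 \<in> R_inv_u_X"
    using uv R_X_gens(2) R_X_subset_R_inv_u_X unfolding x_seq_relations(1) by (intro cl) auto
  have xS: "x_seq (Suc n) \<in> R_inv_u_X" for n
  proof (induction n)
    case 0
    have "u_el * x_seq 1 = v_el * x_seq 0 - 1" by (simp only: x_seq_relations(2)) simp
    also have "\<dots> \<in> R_inv_u_X" by (intro cl uv x0)
    finally show ?case using R_inv_u_X_div_u by simp
  next
    case (Suc n)
    have "u_el * x_seq (Suc (Suc n)) = x_seq (Suc n) ^ nth_prime (Suc n) - v_el"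
      using x_seq_relations(3)[of "Suc n"] by simp
    also have "\<dots> \<in> R_inv_u_X" by (intro cl uv Suc)
    finally show ?case using R_inv_u_X_div_u by simp
  qed
  have "x_seq n \<in> R_inv_u_X" for n using x0 xS by (cases n) auto
  then show ?thesis
    unfolding D_ring_def R_ring_def using c by (intro generate_ring_least subring_on_R_inv_u_X) auto
qed

lemma D_ring_denominator: "d \<in> D_ring \<Longrightarrow> \<exists>k. u_el ^ k * d \<in> R_X"
  using D_ring_subset_R_inv_u_X R_inv_u_X_iff by blast

lemma u_power_in_D_ring: "u_el ^ k \<in> D_ring"
  by (rule subring_on_power[OF subring_on_D_ring u_v_in_D_ring(1)])

lemma R_X_denominator: "y \<in> R_X \<Longrightarrow> \<exists>k. u_el ^ k * y \<in> D_ring"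
proof -
  let ?V = "{y. \<exists>k. u_el ^ k * y \<in> D_ring}"
  have "R_X \<subseteq> ?V"
  proof (rule R_X_least)
    show "subring_on ?V" by (rule subring_on_denominators[OF subring_on_D_ring u_v_in_D_ring(1)])
    have "u_el ^ 0 * const_of r \<in> D_ring" for r using D_ring_gens by simp
    then show "const_of r \<in> ?V" for r by blast
    have "u_el ^ 1 * [:0, 1:] \<in> D_ring" using D_ring_gens(2)[of 0] by (simp add: x_seq_relations(1))
    then show "[:0, 1:] \<in> ?V" by blast
  qed
  then show "y \<in> R_X \<Longrightarrow> \<exists>k. u_el ^ k * y \<in> D_ring" by blast
qed

theorem D_inv_u_eq: "D_inv_u = R_inv_u_X"
proof
  show "D_inv_u \<subseteq> R_inv_u_X"
    unfolding D_inv_u_def using D_ring_subset_R_inv_u_X u_inv_in_R_inv_u_X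
    by (intro generate_ring_least subring_on_R_inv_u_X) auto
  have sub: "subring_on D_inv_u" unfolding D_inv_u_def by (rule subring_on_generate_ring)
  note cl = subring_on_closed[OF sub]
  have D: "D_ring \<subseteq> D_inv_u" and ui: "u_inv \<in> D_inv_u"
    unfolding D_inv_u_def by (auto intro: generate_ring.incl)
  show "R_inv_u_X \<subseteq> D_inv_u"
  proof
    fix y assume "y \<in> R_inv_u_X"
    then obtain k where "u_el ^ k * y \<in> R_X" by (auto simp: R_inv_u_X_iff)
    then obtain l where "u_el ^ l * (u_el ^ k * y) \<in> D_ring" using R_X_denominator by blast
    then have "u_inv ^ (l + k) * (u_el ^ l * (u_el ^ k * y)) \<in> D_inv_u"
      by (intro cl(6) cl(7)[OF ui] subsetD[OF D])
    moreover have "u_inv ^ (l + k) * (u_el ^ l * (u_el ^ k * y)) = (u_el ^ (l + k) * u_inv ^ (l + k)) * y"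
      by (simp only: power_add mult_ac)
    ultimately show "y \<in> D_inv_u" by (simp only: u_power_mult_u_inv_power mult_1_left)
  qed
qed

lemma ufd_on_R_inv_u_X: "ufd_on R_inv_u_X"
proof (rule ufd_on_localization[OF subring_on_R_X subring_on_R_inv_u_X R_X_subset_R_inv_u_X prime_on_R_X_u])
  show "unit_on R_inv_u_X u_el"
    using u_power_in_R_X[of 1] R_X_subset_R_inv_u_X u_inv_in_R_inv_u_X u_inv_mult by (auto simp: unit_on_def)
qed (use ufd_on_R_X R_inv_u_X_iff in auto)

section \<open>Ring-theoretic properties of \<open>D\<close>\<close>

context radical_system
begin

lemmas to_L_facts = to_L_hom to_L_0 to_L_1 to_L_add

lemma to_L_kernel': "d \<in> D_ring \<Longrightarrow> to_L d = 0 \<longleftrightarrow> dvd_on D_ring u_el d"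
  using to_L_kernel unfolding dvd_on_def by blast

lemma to_L_u: "to_L u_el = 0"
  using to_L_kernel'[OF u_v_in_D_ring(1)] subring_on_1[OF subring_on_D_ring]
  by (auto simp: dvd_on_def intro!: bexI[of _ 1])

lemma prime_on_D_u: "prime_on D_ring u_el"
  unfolding prime_on_def
proof (intro conjI ballI impI)
  show "\<not> unit_on D_ring u_el"
  proof
    assume "unit_on D_ring u_el"
    then obtain b where "b \<in> D_ring" "u_el * b = 1" by (auto simp: unit_on_def)
    then have "to_L 1 = to_L u_el * to_L b" using to_L_facts(5) u_v_in_D_ring by metis
    then show False by (simp add: to_L_u to_L_facts)
  qed
  fix a b assume ab: "a \<in> D_ring" "b \<in> D_ring" "dvd_on D_ring u_el (a * b)"
  then have "to_L a * to_L b = 0"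
    using to_L_kernel'[OF subring_on_mult[OF subring_on_D_ring ab(1,2)]] to_L_facts(5)[OF ab(1,2)] by simp
  then show "dvd_on D_ring u_el a \<or> dvd_on D_ring u_el b" using to_L_kernel' ab by auto
qed (use u_v_in_D_ring in auto)

lemma D_ring_inverse_mod_u:
  assumes d: "d \<in> D_ring" "to_L d \<noteq> 0"
  obtains e f where "e \<in> D_ring" "f \<in> D_ring" "1 = e * d + u_el * f"
proof -
  note cl = subring_on_closed[OF subring_on_D_ring]
  have "to_L d \<in> L_field \<rho>" using to_L_in_L d by blast
  then have "inverse (to_L d) \<in> to_L ` D_ring"
    unfolding to_L_image using d(2) by (rule L_field_inverse)
  then obtain e where e: "e \<in> D_ring" "to_L e = inverse (to_L d)" by (metis imageE)
  have ed: "e * d \<in> D_ring" by (rule cl(6)[OF e(1) d(1)])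
  have "to_L (1 - e * d) = 0"
    using e d ed cl by (simp add: to_L_facts)
  then obtain f where "f \<in> D_ring" "1 - e * d = u_el * f"
    using to_L_kernel'[of "1 - e * d"] ed cl by (auto simp: dvd_on_def)
  then show thesis using that[of e f] e by (simp add: algebra_simps)
qed

lemma D_ring_u_order:
  assumes "d \<in> D_ring" "d \<noteq> 0"
  obtains k where "\<not> dvd_on D_ring (u_el ^ k) d"
  using D_ring_separated[OF assms(1)] assms(2) unfolding dvd_on_def by blast

text \<open>Nagata's criterion for \<open>D\<close> in \<open>D[1/u] = R[1/u][X]\<close> with the single prime element \<open>u\<close>.\<close>

theorem ufd_on_D: "ufd_on D_ring"
proof (rule ufd_on_Nagata[OF subring_on_D_ring subring_on_R_inv_u_X D_ring_subset_R_inv_u_X, of "{u_el}"])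
  have pw: "u_el ^ k \<in> products_on D_ring {u_el}" for k
  proof (induction k)
    case 0
    show ?case using subring_on_1[OF subring_on_D_ring] by (intro products_on.unit) (auto simp: unit_on_def)
  qed (auto intro: products_on.step)
  have uu: "unit_on R_inv_u_X u_el"
    using u_power_in_R_X[of 1] R_X_subset_R_inv_u_X u_inv_in_R_inv_u_X u_inv_mult by (auto simp: unit_on_def)
  show "\<exists>s\<in>products_on D_ring {u_el}. s * y \<in> D_ring" if y: "y \<in> R_inv_u_X" for y
  proof -
    obtain k where "u_el ^ k * y \<in> R_X" using y by (auto simp: R_inv_u_X_iff)
    then obtain l where "u_el ^ l * (u_el ^ k * y) \<in> D_ring" using R_X_denominator by blast
    then have "u_el ^ (l + k) * y \<in> D_ring" by (simp add: power_add mult.assoc)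
    then show ?thesis using pw by blast
  qed
  show "unit_on R_inv_u_X s" if "s \<in> products_on D_ring {u_el}" for s
    using that
  proof (induction rule: products_on.induct)
    case (unit a)
    then show ?case using D_ring_subset_R_inv_u_X by (auto simp: unit_on_def)
  next
    case (step p a)
    then show ?case using unit_on_mult[OF subring_on_R_inv_u_X uu] by simp
  qed
  show "\<exists>s\<in>products_on D_ring {u_el}. \<exists>c'\<in>D_ring. c = s * c' \<and> (\<forall>\<pi>\<in>{u_el}. \<not> dvd_on D_ring \<pi> c')"
    if c: "c \<in> D_ring" "c \<noteq> 0" for c
  proof -
    obtain k where k: "\<not> dvd_on D_ring (u_el ^ k) c" using D_ring_u_order[OF c] .
    have "dvd_on D_ring (u_el ^ 0) c" using c by (simp add: dvd_on_def)
    with k obtain j where j: "dvd_on D_ring (u_el ^ j) c" "\<not> dvd_on D_ring (u_el ^ Suc j) c"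
      using nat_induct[of "\<lambda>k. dvd_on D_ring (u_el ^ k) c" k] by blast
    then obtain c' where c': "c' \<in> D_ring" "c = u_el ^ j * c'" by (auto simp: dvd_on_def)
    have "\<not> dvd_on D_ring u_el c'"
    proof
      assume "dvd_on D_ring u_el c'"
      then obtain e where "e \<in> D_ring" "c' = u_el * e" by (auto simp: dvd_on_def)
      then show False using j(2) c' by (auto simp: dvd_on_def mult_ac)
    qed
    then show ?thesis using pw c' by blast
  qed
qed (use prime_on_D_u ufd_on_R_inv_u_X in auto)

text \<open>For the highest power \<open>u\<^sup>k\<close> dividing all elements of an ideal, the ideal of the quotients contains some
  \<open>j\<close> outside \<open>uD\<close>. As \<open>D/uD\<close> is a field, \<open>u\<close> is invertible modulo \<open>j\<close>; so generators up to powers of \<open>u\<close> are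
  generators once \<open>j\<close> is included.\<close>

theorem noeth_on_D: "noeth_on D_ring"
  unfolding noeth_on_def
proof (intro allI impI)
  note cl = subring_on_closed[OF subring_on_D_ring]
  note ud = u_power_in_D_ring
  fix J assume J: "ideal_on D_ring J"
  have JD: "J \<subseteq> D_ring" by (rule ideal_onD(1)[OF J])
  show "\<exists>F. finite F \<and> F \<subseteq> J \<and> (\<forall>H. ideal_on D_ring H \<longrightarrow> F \<subseteq> H \<longrightarrow> J \<subseteq> H)"
  proof (cases "J = {0}")
    case True
    then show ?thesis by (intro exI[of _ "{}"]) (auto simp: ideal_on_def)
  next
    case False
    then obtain c where c: "c \<in> J" "c \<noteq> 0" using ideal_onD(2)[OF J] by blast
    obtain k where k: "\<not> dvd_on D_ring (u_el ^ k) c" using D_ring_u_order[of c] c JD by blast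
    define Q where "Q k \<longleftrightarrow> (\<forall>x\<in>J. dvd_on D_ring (u_el ^ k) x)" for k
    have "Q 0" using JD by (auto simp: Q_def dvd_on_def)
    moreover have "\<not> Q k" using k c by (auto simp: Q_def)
    ultimately obtain k where k: "Q k" "\<not> Q (Suc k)" using nat_induct[of Q k] by blast
    let ?sat = "\<lambda>H. {d \<in> D_ring. u_el ^ k * d \<in> H}"
    have sat: "ideal_on D_ring (?sat H)" if H: "ideal_on D_ring H" for H
    proof (rule ideal_onI)
      show "0 \<in> ?sat H" using cl ideal_onD(2)[OF H] by simp
      show "a + b \<in> ?sat H" if "a \<in> ?sat H" "b \<in> ?sat H" for a b
        using that cl ideal_onD(3)[OF H] by (simp add: distrib_left)
      show "s * a \<in> ?sat H" if "s \<in> D_ring" "a \<in> ?sat H" for s a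
        using that cl ideal_onD(4)[OF H, of s "u_el ^ k * a"] by (simp add: mult.left_commute)
    qed auto
    obtain j where j: "j \<in> ?sat J" "to_L j \<noteq> 0"
    proof -
      obtain x where x: "x \<in> J" "\<not> dvd_on D_ring (u_el ^ Suc k) x" using k(2) by (auto simp: Q_def)
      obtain j where j: "j \<in> D_ring" "x = u_el ^ k * j" using k(1) x(1) by (auto simp: Q_def dvd_on_def)
      have "\<not> dvd_on D_ring u_el j"
      proof
        assume "dvd_on D_ring u_el j"
        then obtain e where "e \<in> D_ring" "j = u_el * e" by (auto simp: dvd_on_def)
        then show False using x(2) j by (auto simp: dvd_on_def mult_ac)
      qed
      then show thesis using that[of j] j x to_L_kernel' by auto
    qed
    then obtain e f where ef: "e \<in> D_ring" "f \<in> D_ring" "1 = e * j + u_el * f"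
      using D_ring_inverse_mod_u[of j] by blast
    obtain F where F: "finite F" "F \<subseteq> ?sat J"
      "\<forall>H x. ideal_on D_ring H \<longrightarrow> F \<subseteq> H \<longrightarrow> x \<in> ?sat J \<longrightarrow> (\<exists>m. u_el ^ m * x \<in> H)"
      using noeth_on_localization[OF noeth_on_R_X subring_on_R_X subring_on_D_ring
        u_power_in_R_X[of 1, simplified] u_v_in_D_ring(1) R_X_denominator D_ring_denominator sat[OF J]] by blast
    show ?thesis
    proof (intro exI[of _ "(\<lambda>x. u_el ^ k * x) ` insert j F"] conjI allI impI)
      fix H assume H: "ideal_on D_ring H" "(\<lambda>x. u_el ^ k * x) ` insert j F \<subseteq> H"
      have jF: "j \<in> ?sat H" "F \<subseteq> ?sat H" using H(2) F(2) j(1) by auto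
      have step: "x \<in> ?sat H" if "x \<in> D_ring" "u_el ^ m * x \<in> ?sat H" for m x
        using that(2)
      proof (induction m)
        case (Suc m)
        have "u_el ^ m * x = (e * j + u_el * f) * (u_el ^ m * x)" using ef(3) by simp
        also have "\<dots> = (e * (u_el ^ m * x)) * j + f * (u_el ^ Suc m * x)" by (simp add: algebra_simps)
        also have "\<dots> \<in> ?sat H"
          by (intro ideal_onD(3)[OF sat[OF H(1)]] ideal_onD(4)[OF sat[OF H(1)]] cl ef ud jF(1) Suc.prems \<open>x \<in> D_ring\<close>)
        finally show ?case by (rule Suc.IH)
      qed simp
      show "J \<subseteq> H"
      proof
        fix y assume y: "y \<in> J"
        obtain x where x: "x \<in> D_ring" "y = u_el ^ k * x" using k(1) y by (auto simp: Q_def dvd_on_def)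
        then have "x \<in> ?sat J" using y by simp
        then obtain m where "u_el ^ m * x \<in> ?sat H" using F(3)[rule_format, OF sat[OF H(1)] jF(2)] by blast
        then have "x \<in> ?sat H" using step x(1) by blast
        then show "y \<in> H" using x(2) by simp
      qed
    qed (use F j in auto)
  qed
qed

end

subsection \<open>The quotient by \<open>u\<close>\<close>

context radical_system
begin

lemma uD_eq: "uD = {d \<in> D_ring. to_L d = 0}"
proof -
  have "uD = {e * u_el | e. e \<in> D_ring}" by (simp add: cgenideal_def)
  also have "\<dots> = {d \<in> D_ring. to_L d = 0}"
    using to_L_kernel subring_on_mult[OF subring_on_D_ring _ u_v_in_D_ring(1)]
    by (auto simp: mult.commute)
  finally show ?thesis .
qed

lemma to_L_ring_hom: "ring_hom_ring (ring_on D_ring) (ring_on (L_field \<rho>)) to_L"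
  by (rule ring_hom_ringI[OF ring_ring_on[OF subring_on_D_ring] ring_ring_on[OF subring_on_L_field]])
    (simp_all add: to_L_in_L to_L_facts)

lemma uD_kernel: "a_kernel (ring_on D_ring) (ring_on (L_field \<rho>)) to_L = uD"
  unfolding uD_eq a_kernel_def' by simp

theorem D_quotient_iso: "ring_on D_ring Quot uD \<simeq> ring_on (L_field \<rho>)"
  using ring_hom_ring.FactRing_iso[OF to_L_ring_hom] to_L_image by (simp add: uD_kernel)

lemma uD_ideal: "ideal uD (ring_on D_ring)"
  using ring_hom_ring.kernel_is_ideal[OF to_L_ring_hom] by (simp only: uD_kernel)

lemma one_notin_uD: "1 \<notin> uD"
  by (simp add: uD_eq to_L_1)

theorem uD_maximal: "maximalideal uD (ring_on D_ring)"
proof (rule maximalidealI[OF uD_ideal])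
  note cl = subring_on_closed[OF subring_on_D_ring]
  show "carrier (ring_on D_ring) \<noteq> uD" using one_notin_uD cl(1) by auto
  fix J assume J: "ideal J (ring_on D_ring)" "uD \<subseteq> J" "J \<subseteq> carrier (ring_on D_ring)"
  have J': "ideal_on D_ring J" using J(1) by (simp add: ideal_ring_on_iff[OF subring_on_D_ring])
  show "J = uD \<or> J = carrier (ring_on D_ring)"
  proof (rule disjCI)
    assume "J \<noteq> carrier (ring_on D_ring)"
    then have ne: "J \<noteq> D_ring" by simp
    have "J \<subseteq> uD"
    proof
      fix d assume d: "d \<in> J"
      show "d \<in> uD"
      proof (rule ccontr)
        assume "d \<notin> uD"
        have dD: "d \<in> D_ring" using ideal_onD(1)[OF J'] d by blast
        with \<open>d \<notin> uD\<close> have "to_L d \<noteq> 0" by (simp add: uD_eq)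
        then obtain e f where ef: "e \<in> D_ring" "f \<in> D_ring" "1 = e * d + u_el * f"
          using D_ring_inverse_mod_u[OF dD] by blast
        have "u_el \<in> uD" by (simp add: uD_eq to_L_u u_v_in_D_ring)
        then have "u_el * f \<in> J" using ideal_onD(5)[OF J' ef(2)] J(2) by blast
        then have "e * d + u_el * f \<in> J" by (rule ideal_onD(3)[OF J' ideal_onD(4)[OF J' ef(1) d]])
        then have "1 \<in> J" by (simp only: ef(3)[symmetric])
        then have "s \<in> J" if "s \<in> D_ring" for s using ideal_onD(4)[OF J' that, of 1] by simp
        then show False using ne ideal_onD(1)[OF J'] by blast
      qed
    qed
    then show "J = uD" using J(2) by blast
  qed
qed

theorem uD_Int_R: "uD \<inter> R_ring = uR"
proof -
  have uR: "uR = {a * u_el | a. a \<in> R_ring}" by (simp add: cgenideal_def)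
  show ?thesis
  proof (intro equalityI subsetI)
    fix x assume "x \<in> uD \<inter> R_ring"
    then obtain r where r: "x = const_of r" "to_L x = 0" by (auto simp: uD_eq R_ring_def)
    then have "series_u dvd r" by (simp add: to_L_facts reduce_eq_0_iff)
    then obtain s where "r = series_u * s" by (auto elim: dvdE)
    then have "x = const_of s * u_el" using r by (simp add: u_el_def mult.commute)
    then show "x \<in> uR" unfolding uR by (auto simp: R_ring_def)
  next
    fix x assume "x \<in> uR"
    then obtain r where r: "x = const_of (r * series_u)" unfolding uR by (auto simp: R_ring_def u_el_def)
    have "to_L x = 0" unfolding r to_L_facts(1) by (simp add: reduce_hom reduce_u)
    moreover have "x \<in> D_ring" unfolding r by (rule D_ring_gens)
    moreover have "x \<in> R_ring" unfolding r R_ring_def by (rule rangeI)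
    ultimately show "x \<in> uD \<inter> R_ring" by (simp add: uD_eq)
  qed
qed

text \<open>A prime ideal strictly inside \<open>uD\<close> does not contain \<open>u\<close>, so its elements are divisible by \<open>u\<close> within
  it, arbitrarily often; by separatedness it is \<open>0\<close>.\<close>

theorem uD_height: "prime_height (ring_on D_ring) uD = 1"
proof -
  let ?R = "ring_on D_ring"
  interpret D: domain ?R by (rule domain_ring_on[OF subring_on_D_ring])
  have zero: "primeideal {0} ?R" using D.zeroprimeideal by simp
  have uDp: "primeideal uD ?R" by (rule D.maximalideal_prime[OF uD_maximal])
  have u: "u_el \<in> uD" by (simp add: uD_eq to_L_u u_v_in_D_ring)
  let ?chain = "\<lambda>n Q. (\<forall>i\<le>n. primeideal (Q i) ?R) \<and> (\<forall>i<n. Q i \<subset> Q (Suc i)) \<and> Q n = uD"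
  have le: "n \<le> 1" if "?chain n Q" for n Q
  proof (rule ccontr)
    assume "\<not> n \<le> 1"
    then obtain k where n: "n = Suc (Suc k)" by (metis One_nat_def Suc_leI not_less_eq_eq old.nat.exhaust zero_le)
    define P where "P = Q (Suc k)"
    have c: "\<forall>i\<le>Suc (Suc k). primeideal (Q i) ?R" "\<forall>i<Suc (Suc k). Q i \<subset> Q (Suc i)" "Q (Suc (Suc k)) = uD"
      using that unfolding n by blast+
    have chain: "Q k \<subset> P" "P \<subset> uD"
      using c(2)[rule_format, of k] c(2)[rule_format, of "Suc k"] c(3) unfolding P_def by simp_all
    have P: "primeideal P ?R" "primeideal (Q k) ?R"
      unfolding P_def by (rule c(1)[rule_format], simp)+
    have Pi: "ideal_on D_ring P" "ideal_on D_ring (Q k)"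
      using P[THEN primeideal.axioms(1)] by (simp_all only: ideal_ring_on_iff[OF subring_on_D_ring])
    have "u_el \<notin> P"
    proof
      assume "u_el \<in> P"
      then have "uD \<subseteq> P" using ideal_onD(4)[OF Pi(1)] by (auto simp: cgenideal_def)
      then show False using chain by blast
    qed
    have div: "\<exists>e\<in>P. d = u_el * e" if "d \<in> P" for d
    proof -
      have "d \<in> D_ring" "to_L d = 0" using that chain by (auto simp: uD_eq)
      then obtain e where e: "e \<in> D_ring" "d = u_el * e" using to_L_kernel by blast
      then have "u_el \<in> P \<or> e \<in> P" using primeideal.I_prime[OF P(1), of u_el e] u_v_in_D_ring that by simp
      then show ?thesis using \<open>u_el \<notin> P\<close> e by blast
    qed
    have "\<exists>e\<in>P. d = u_el ^ j * e" if "d \<in> P" for d j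
    proof (induction j)
      case 0
      then show ?case using that by simp
    next
      case (Suc j)
      then obtain e where "e \<in> P" "d = u_el ^ j * e" by blast
      moreover obtain e' where "e' \<in> P" "e = u_el * e'" using div[OF \<open>e \<in> P\<close>] by blast
      ultimately show ?case by (auto simp: mult_ac)
    qed
    then have "d = 0" if "d \<in> P" for d
      using D_ring_separated[of d] that ideal_onD(1)[OF Pi(1)] by blast
    then show False using chain(1) ideal_onD(2)[OF Pi(2)] by blast
  qed
  have "?chain 1 (\<lambda>i. if i = 0 then {0} else uD)"
  proof -
    have "0 \<in> uD" using additive_subgroup.zero_closed[OF ideal.axioms(1)[OF uD_ideal]] by simp
    moreover have "uD \<noteq> {0}" using u u_el_nonzero by (metis singletonD)
    ultimately have "{0} \<subset> uD" by blast
    then show ?thesis using zero uDp by auto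
  qed
  then have "\<exists>Q. ?chain 1 Q" by (rule exI[of _ "\<lambda>i. if i = 0 then {0} else uD"])
  then have "enat 1 \<in> {enat n | n. \<exists>Q. ?chain n Q}"
    by (intro CollectI exI[of _ 1] conjI[OF refl])
  then have "enat 1 \<le> prime_height ?R uD" unfolding prime_height_def by (rule Sup_upper)
  moreover have "prime_height ?R uD \<le> enat 1"
    unfolding prime_height_def by (rule Sup_least) (use le in auto)
  ultimately show ?thesis by (simp add: one_enat_def)
qed

subsection \<open>Failure of finite generation\<close>

lemma not_fin_gen_over_R:
  assumes C: "subring_on C" "R_ring \<subseteq> C" "C \<subseteq> D_ring" and onto: "L_field \<rho> \<subseteq> to_L ` C"
  shows "\<not> fin_gen_algebra id (ring_on R_ring) (ring_on C)"
proof
  assume "fin_gen_algebra id (ring_on R_ring) (ring_on C)"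
  then obtain F where F: "finite F" "F \<subseteq> C" "C = generate_ring (ring_on C) (R_ring \<union> F)"
    by (auto simp: fin_gen_algebra_def)
  have "to_L ` F \<subseteq> L_field \<rho>" using F(2) C(3) to_L_in_L by blast
  then obtain V n where V: "subring_on V" "range to_ac \<subseteq> V" "to_L ` F \<subseteq> V" "n > 0" "\<rho> n \<notin> V"
    using L_field_not_fin_gen[OF roots, of "to_L ` F"] F(1) by blast
  let ?W = "{c \<in> C. to_L c \<in> V}"
  have "subring_on ?W"
  proof (rule subring_onI)
    show "1 \<in> ?W" using subring_on_1[OF C(1)] subring_on_1[OF V(1)] by (simp add: to_L_1)
    fix a b assume ab: "a \<in> ?W" "b \<in> ?W"
    then have "a \<in> D_ring" "b \<in> D_ring" using C(3) by auto
    then show "a - b \<in> ?W" "a * b \<in> ?W"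
      using ab subring_on_closed[OF C(1)] subring_on_closed[OF V(1)] by (simp_all add: to_L_facts)
  qed
  moreover have "R_ring \<union> F \<subseteq> C" using C(2) F(2) by blast
  moreover have "R_ring \<union> F \<subseteq> ?W" using C(2) F(2) V(2,3) by (auto simp: R_ring_def to_L_facts reduce_def)
  ultimately have "generate_ring (ring_on C) (R_ring \<union> F) \<subseteq> ?W" by (intro generate_ring_on_least[OF C(1)])
  with F(3) have "C \<subseteq> ?W" by (rule ord_eq_le_trans)
  moreover have "\<rho> n \<in> to_L ` C" using onto L_field_gens(2)[OF V(4)] by blast
  ultimately show False using V(5) by auto
qed

theorem quotient_not_fin_gen:
  "\<not> fin_gen_algebra quot_map (ring_on R_ring Quot uR) (ring_on D_ring Quot uD)"
proof
  let ?R = "ring_on D_ring" and ?Q = "ring_on D_ring Quot uD" and ?L = "ring_on (L_field \<rho>)"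
  define \<theta> where "\<theta> = (\<lambda>Y. the_elem (to_L ` Y))"
  have iso: "\<theta> \<in> ring_iso ?Q ?L"
    using ring_hom_ring.FactRing_iso_set[OF to_L_ring_hom] to_L_image unfolding \<theta>_def by (simp add: uD_kernel)
  have rQ: "ring ?Q" by (rule ideal.quotient_is_ring[OF uD_ideal])
  interpret \<theta>: ring_hom_ring ?Q ?L \<theta>
    using iso rQ ring_ring_on[OF subring_on_L_field[of \<rho>]]
    by (intro ring_hom_ringI2) (auto simp: ring_iso_def)
  have \<theta>_coset: "\<theta> (uD +>\<^bsub>?R\<^esub> d) = to_L d" if d: "d \<in> D_ring" for d
  proof -
    have "to_L ` (uD +>\<^bsub>?R\<^esub> d) = {to_L d}"
    proof -
      have "uD +>\<^bsub>?R\<^esub> d = {x + d | x. x \<in> uD}" by (auto simp: a_r_coset_def')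
      moreover have "to_L (x + d) = to_L d" if "x \<in> uD" for x using that d by (simp add: uD_eq to_L_facts)
      moreover have "0 \<in> uD" using subring_on_0[OF subring_on_D_ring] by (simp add: uD_eq to_L_0)
      ultimately show ?thesis by auto
    qed
    then show ?thesis by (simp add: \<theta>_def)
  qed
  assume "fin_gen_algebra quot_map (ring_on R_ring Quot uR) ?Q"
  then obtain F where F: "finite F" "F \<subseteq> carrier ?Q"
    "carrier ?Q = generate_ring ?Q (quot_map ` carrier (ring_on R_ring Quot uR) \<union> F)"
    by (auto simp: fin_gen_algebra_def)
  have "\<theta> ` F \<subseteq> L_field \<rho>" using F(2) \<theta>.hom_closed by auto
  then obtain V n where V: "subring_on V" "range to_ac \<subseteq> V" "\<theta> ` F \<subseteq> V" "n > 0" "\<rho> n \<notin> V"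
    using L_field_not_fin_gen[OF roots, of "\<theta> ` F"] F(1) by blast
  have H: "Y \<in> carrier ?Q \<and> \<theta> Y \<in> V" if "Y \<in> quot_map ` carrier (ring_on R_ring Quot uR) \<union> F" for Y
    using that
  proof
    assume "Y \<in> F"
    then show ?thesis using F(2) V(3) by blast
  next
    assume "Y \<in> quot_map ` carrier (ring_on R_ring Quot uR)"
    then obtain r where r: "r \<in> R_ring" "Y = quot_map (uR +>\<^bsub>ring_on R_ring\<^esub> r)"
      by (auto simp: FactRing_def A_RCOSETS_def')
    have Y: "Y = uD +>\<^bsub>?R\<^esub> r" using r by (simp only: quot_map_coset)
    have rD: "r \<in> D_ring" using r R_ring_subset_D_ring by blast
    then have "Y \<in> carrier ?Q" unfolding Y by (auto simp: FactRing_def A_RCOSETS_def')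
    moreover have "\<theta> Y \<in> V" unfolding Y \<theta>_coset[OF rD] using r(1) V(2) by (auto simp: R_ring_def to_L_facts reduce_def)
    ultimately show ?thesis ..
  qed
  have "Y \<in> carrier ?Q \<and> \<theta> Y \<in> V"
    if "Y \<in> generate_ring ?Q (quot_map ` carrier (ring_on R_ring Quot uR) \<union> F)" for Y
    using that
  proof (induction rule: generate_ring.induct)
    case one
    then show ?case using \<theta>.hom_one subring_on_1[OF V(1)] by simp
  next
    case (incl h)
    then show ?case by (rule H)
  next
    case (a_inv h)
    then have "\<theta> (\<ominus>\<^bsub>?Q\<^esub> h) = - \<theta> h"
      using \<theta>.hom_a_inv[of h] \<theta>.hom_closed[of h] a_inv_ring_on[OF subring_on_L_field[of \<rho>], of "\<theta> h"] by simp
    then show ?case using a_inv subring_on_uminus[OF V(1)] by simp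
  next
    case (eng_add a b)
    then show ?case using \<theta>.hom_add[of a b] subring_on_add[OF V(1)] by simp
  next
    case (eng_mult a b)
    then show ?case using \<theta>.hom_mult[of a b] subring_on_mult[OF V(1)] by simp
  qed note gen = this
  have x: "x_seq n \<in> D_ring" by (rule D_ring_gens)
  then have "uD +>\<^bsub>?R\<^esub> x_seq n \<in> carrier ?Q" by (auto simp: FactRing_def A_RCOSETS_def')
  then have "\<theta> (uD +>\<^bsub>?R\<^esub> x_seq n) \<in> V" using gen F(3) by blast
  then show False using V(4,5) \<theta>_coset[OF x] by (simp add: to_L_facts)
qed

end

section \<open>The ring \<open>A\<close>\<close>

lemma subring_on_A_ring: "subring_on A_ring"
  using subring_on_R_X subring_on_D_ring by (auto simp: A_ring_def subring_on_def)

lemma R_ring_subset_A_ring: "R_ring \<subseteq> A_ring"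
  using R_X_gens(1) D_ring_gens(1) by (auto simp: A_ring_def R_ring_def)

text \<open>\<open>chart_a\<close> is \<open>1\<close> modulo \<open>uR[X]\<close> and \<open>0\<close> modulo \<open>uD\<close>, for \<open>chart_b\<close> it is the other way round. After
  inverting them \<open>A\<close> becomes a localisation of \<open>R[X]\<close>, respectively of \<open>D\<close>.\<close>

definition chart_a :: ambient where "chart_a = - (u_el * x_seq 1)"
definition chart_b :: ambient where "chart_b = v_el * x_seq 0"

lemma chart_sum: "chart_a + chart_b = 1"
  unfolding chart_a_def chart_b_def x_seq_relations(2) by simp

lemma chart_in_A: "chart_a \<in> A_ring" "chart_b \<in> A_ring"
proof -
  note clD = subring_on_closed[OF subring_on_D_ring] and clX = subring_on_closed[OF subring_on_R_X]
  have "chart_b \<in> D_ring" unfolding chart_b_def by (intro clD(6) u_v_in_D_ring D_ring_gens)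
  moreover have "chart_b \<in> R_X"
    unfolding chart_b_def x_seq_relations(1) v_el_def u_el_def by (intro clX(6) R_X_gens)
  ultimately show b: "chart_b \<in> A_ring" by (simp add: A_ring_def)
  have eq: "chart_a = 1 - chart_b" using chart_sum by (simp add: eq_diff_eq)
  show "chart_a \<in> A_ring"
    unfolding eq by (rule subring_on_diff[OF subring_on_A_ring subring_on_1[OF subring_on_A_ring] b])
qed

lemma chart_a_power:
  assumes y: "y \<in> R_X" shows "\<exists>m. \<forall>n\<ge>m. chart_a ^ n * y \<in> A_ring"
proof -
  obtain m where m: "u_el ^ m * y \<in> D_ring" using R_X_denominator[OF y] by blast
  have "chart_a ^ n * y \<in> A_ring" if "n \<ge> m" for n
  proof -
    have "u_el ^ n = u_el ^ (n - m) * u_el ^ m" using that by (simp flip: power_add)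
    moreover have a: "chart_a = (- x_seq 1) * u_el" by (simp add: chart_a_def)
    have "chart_a ^ n * y = (- x_seq 1) ^ n * (u_el ^ n * y)"
      unfolding a power_mult_distrib by (rule mult.assoc)
    ultimately have "chart_a ^ n * y = (- x_seq 1) ^ n * (u_el ^ (n - m) * (u_el ^ m * y))"
      by (simp only: mult.assoc)
    also have "\<dots> \<in> D_ring"
      by (intro subring_on_mult[OF subring_on_D_ring] subring_on_power[OF subring_on_D_ring]
          subring_on_uminus[OF subring_on_D_ring] D_ring_gens u_power_in_D_ring m)
    finally have "chart_a ^ n * y \<in> D_ring" .
    moreover have "chart_a ^ n * y \<in> R_X"
      using chart_in_A(1) y subring_on_mult[OF subring_on_R_X] subring_on_power[OF subring_on_R_X]
      by (simp add: A_ring_def)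
    ultimately show ?thesis by (simp add: A_ring_def)
  qed
  then show ?thesis by blast
qed

lemma chart_b_power:
  assumes d: "d \<in> D_ring" shows "\<exists>m. \<forall>n\<ge>m. chart_b ^ n * d \<in> A_ring"
proof -
  obtain m where m: "u_el ^ m * d \<in> R_X" using D_ring_denominator[OF d] by blast
  have "chart_b ^ n * d \<in> A_ring" if "n \<ge> m" for n
  proof -
    have "u_el ^ n = u_el ^ (n - m) * u_el ^ m" using that by (simp flip: power_add)
    then have "chart_b ^ n * d = (v_el * [:0, 1:]) ^ n * (u_el ^ (n - m) * (u_el ^ m * d))"
      unfolding chart_b_def x_seq_relations(1) by (simp only: power_mult_distrib mult_ac)
    also have "\<dots> \<in> R_X"
      unfolding v_el_def
      by (intro subring_on_mult[OF subring_on_R_X] subring_on_power[OF subring_on_R_X]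
          R_X_gens u_power_in_R_X m)
    finally have "chart_b ^ n * d \<in> R_X" .
    moreover have "chart_b ^ n * d \<in> D_ring"
      using chart_in_A(2) d subring_on_mult[OF subring_on_D_ring] subring_on_power[OF subring_on_D_ring]
      by (simp add: A_ring_def)
    ultimately show ?thesis by (simp add: A_ring_def)
  qed
  then show ?thesis by blast
qed

lemma comaximal_powers:
  fixes a b :: "'a::comm_ring_1"
  assumes C: "subring_on C" and ab: "a \<in> C" "b \<in> C" "a + b = 1"
  shows "\<exists>\<alpha>\<in>C. \<exists>\<beta>\<in>C. \<alpha> * a ^ m + \<beta> * b ^ n = 1"
proof -
  have one: "\<exists>\<alpha>\<in>C. \<exists>\<beta>\<in>C. \<alpha> * a ^ m + \<beta> * b = 1" for m
  proof (induction m)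
    case 0
    show ?case using subring_on_1[OF C] subring_on_0[OF C] by (intro bexI[of _ 1] bexI[of _ 0]) auto
  next
    case (Suc m)
    then obtain \<alpha> \<beta> where s: "\<alpha> \<in> C" "\<beta> \<in> C" "\<alpha> * a ^ m + \<beta> * b = 1" by blast
    have "\<alpha> * a ^ Suc m + (\<alpha> * a ^ m + \<beta>) * b = \<alpha> * a ^ m * (a + b) + \<beta> * b" by (simp add: algebra_simps)
    also have "\<dots> = 1" using s(3) ab(3) by simp
    finally have "\<alpha> * a ^ Suc m + (\<alpha> * a ^ m + \<beta>) * b = 1" .
    moreover have "\<alpha> * a ^ m + \<beta> \<in> C"
      by (intro subring_on_add[OF C] subring_on_mult[OF C] subring_on_power[OF C] s ab)
    ultimately show ?case using s(1) by blast
  qed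
  obtain \<alpha>' \<beta>' where s': "\<alpha>' \<in> C" "\<beta>' \<in> C" "\<alpha>' * a ^ m + \<beta>' * b = 1" using one by blast
  show ?thesis
  proof (induction n)
    case 0
    show ?case using subring_on_1[OF C] subring_on_0[OF C] by (intro bexI[of _ 0] bexI[of _ 1]) auto
  next
    case (Suc n)
    then obtain \<alpha> \<beta> where s: "\<alpha> \<in> C" "\<beta> \<in> C" "\<alpha> * a ^ m + \<beta> * b ^ n = 1" by blast
    have "(\<alpha> + \<beta> * b ^ n * \<alpha>') * a ^ m + (\<beta> * \<beta>') * b ^ Suc n =
        \<alpha> * a ^ m + \<beta> * b ^ n * (\<alpha>' * a ^ m + \<beta>' * b)" by (simp add: algebra_simps)
    also have "\<dots> = 1" using s(3) s'(3) by simp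
    finally have "(\<alpha> + \<beta> * b ^ n * \<alpha>') * a ^ m + (\<beta> * \<beta>') * b ^ Suc n = 1" .
    moreover have "\<alpha> + \<beta> * b ^ n * \<alpha>' \<in> C" "\<beta> * \<beta>' \<in> C"
      by (intro subring_on_add[OF C] subring_on_mult[OF C] subring_on_power[OF C] s s' ab)+
    ultimately show ?case by blast
  qed
qed

lemma A_subset: "A_ring \<subseteq> R_X" "A_ring \<subseteq> D_ring"
  by (auto simp: A_ring_def)

text \<open>\<open>A\<close> is integrally closed because \<open>R[X]\<close> and \<open>D\<close> are.\<close>

theorem normal_domain_A: 
  assumes ufdD: "ufd_on D_ring"
  shows "normal_domain A_ring"
  unfolding normal_domain_def
proof (intro conjI ballI impI domain_ring_on[OF subring_on_A_ring])
  fix z assume "z \<in> frac_field_of A_ring" "integral_over A_ring z"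
  then obtain a b p where ab: "z = Fract a b" "a \<in> A_ring" "b \<in> A_ring" "b \<noteq> 0"
    and p: "\<And>i. Polynomial.coeff p i \<in> A_ring" "lead_coeff p = 1" "poly (map_poly to_fract p) z = 0"
    by (auto simp: frac_field_of_def integral_over_def)
  define n where "n = Polynomial.degree p"
  have z: "z * to_fract b = to_fract a" using ab by (simp add: Fract_conv_to_fract)
  have deg: "Polynomial.degree (map_poly to_fract p) = n" unfolding n_def by (rule degree_map_poly) simp
  have "to_fract (\<Sum>i\<le>n. Polynomial.coeff p i * a ^ i * b ^ (n - i)) =
      (\<Sum>i\<le>n. to_fract (Polynomial.coeff p i) * z ^ i) * to_fract b ^ n"
  proof -
    have pw: "to_fract (x ^ k) = to_fract x ^ k" for x :: ambient and k by (induction k) simp_all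
    have sm: "to_fract (sum f I) = (\<Sum>i\<in>I. to_fract (f i))" for f :: "nat \<Rightarrow> ambient" and I
      by (induction I rule: infinite_finite_induct) simp_all
    have "to_fract (Polynomial.coeff p i * a ^ i * b ^ (n - i)) = to_fract (Polynomial.coeff p i) * z ^ i * to_fract b ^ n"
      if "i \<le> n" for i
    proof -
      have "to_fract b ^ n = to_fract b ^ i * to_fract b ^ (n - i)" using that by (simp flip: power_add)
      then show ?thesis by (simp add: pw z[symmetric] power_mult_distrib mult_ac)
    qed
    then show ?thesis unfolding sm sum_distrib_right by (intro sum.cong) auto
  qed
  also have "(\<Sum>i\<le>n. to_fract (Polynomial.coeff p i) * z ^ i) = 0"
    using p(3) unfolding poly_altdef deg by (simp add: coeff_map_poly)
  finally have "(\<Sum>i\<le>n. Polynomial.coeff p i * a ^ i * b ^ (n - i)) = 0"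
    by (simp only: mult_zero_left to_fract_eq_0_iff)
  then have "a ^ n + (\<Sum>i<n. Polynomial.coeff p i * a ^ i * b ^ (n - i)) = 0"
    using p(2) by (simp add: n_def lessThan_Suc_atMost[symmetric] add.commute)
  then have eq: "a ^ n = (\<Sum>i<n. (- Polynomial.coeff p i) * a ^ i * b ^ (n - i))"
    by (simp add: sum_negf eq_neg_iff_add_eq_0)
  have cl: "- Polynomial.coeff p i \<in> A_ring" for i by (rule subring_on_uminus[OF subring_on_A_ring p(1)])
  have "dvd_on R_X b a"
    by (rule ufd_on_integrally_closed[OF subring_on_R_X ufd_on_R_X _ _ ab(4) _ eq]) (use ab cl A_subset in auto)
  then obtain c where c: "c \<in> R_X" "a = b * c" by (auto simp: dvd_on_def)
  have "dvd_on D_ring b a"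
    by (rule ufd_on_integrally_closed[OF subring_on_D_ring ufdD _ _ ab(4) _ eq]) (use ab cl A_subset in auto)
  then obtain c' where c': "c' \<in> D_ring" "a = b * c'" by (auto simp: dvd_on_def)
  have "c = c'" using c(2) c'(2) ab(4) by simp
  then have "c \<in> A_ring" using c c' by (simp add: A_ring_def)
  moreover have "z = to_fract c"
    using ab c(2) by (simp add: Fract_conv_to_fract)
  ultimately show "z \<in> to_fract ` A_ring" by blast
qed

context radical_system
begin

text \<open>Generators of an ideal up to powers of \<open>chart_a\<close>, together with generators up to powers of
  \<open>chart_b\<close>, generate it because the powers of the two charts are comaximal.\<close>

theorem noeth_on_A: "noeth_on A_ring"
  unfolding noeth_on_def
proof (intro allI impI)
  fix J assume J: "ideal_on A_ring J"
  have a: "chart_a \<in> R_X" and b: "chart_b \<in> D_ring" using chart_in_A A_subset by auto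
  have le: "\<exists>m. s ^ m * y \<in> C" if "A_ring \<subseteq> C" "y \<in> A_ring" for s y :: ambient and C
    using that by (intro exI[of _ 0]) auto
  have "\<exists>F. finite F \<and> F \<subseteq> J \<and>
      (\<forall>H x. ideal_on A_ring H \<longrightarrow> F \<subseteq> H \<longrightarrow> x \<in> J \<longrightarrow> (\<exists>m. chart_a ^ m * x \<in> H))"
    by (rule noeth_on_localization[OF noeth_on_R_X subring_on_R_X subring_on_A_ring a chart_in_A(1) _
          le[OF A_subset(1)] J]) (use chart_a_power in blast)
  then obtain F where F: "finite F" "F \<subseteq> J"
    "\<forall>H x. ideal_on A_ring H \<longrightarrow> F \<subseteq> H \<longrightarrow> x \<in> J \<longrightarrow> (\<exists>m. chart_a ^ m * x \<in> H)" by blast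
  have "\<exists>G. finite G \<and> G \<subseteq> J \<and>
      (\<forall>H x. ideal_on A_ring H \<longrightarrow> G \<subseteq> H \<longrightarrow> x \<in> J \<longrightarrow> (\<exists>m. chart_b ^ m * x \<in> H))"
    by (rule noeth_on_localization[OF noeth_on_D subring_on_D_ring subring_on_A_ring b chart_in_A(2) _
          le[OF A_subset(2)] J]) (use chart_b_power in blast)
  then obtain G where G: "finite G" "G \<subseteq> J"
    "\<forall>H x. ideal_on A_ring H \<longrightarrow> G \<subseteq> H \<longrightarrow> x \<in> J \<longrightarrow> (\<exists>m. chart_b ^ m * x \<in> H)" by blast
  show "\<exists>F. finite F \<and> F \<subseteq> J \<and> (\<forall>H. ideal_on A_ring H \<longrightarrow> F \<subseteq> H \<longrightarrow> J \<subseteq> H)"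
  proof (intro exI[of _ "F \<union> G"] conjI allI impI subsetI)
    fix H x assume H: "ideal_on A_ring H" "F \<union> G \<subseteq> H" and x: "x \<in> J"
    obtain m where m: "chart_a ^ m * x \<in> H" using F(3) H x by blast
    obtain n where n: "chart_b ^ n * x \<in> H" using G(3) H x by blast
    obtain \<alpha> \<beta> where s: "\<alpha> \<in> A_ring" "\<beta> \<in> A_ring" "\<alpha> * chart_a ^ m + \<beta> * chart_b ^ n = 1"
      using comaximal_powers[OF subring_on_A_ring chart_in_A chart_sum] by blast
    have "x = (\<alpha> * chart_a ^ m + \<beta> * chart_b ^ n) * x" by (simp add: s(3))
    also have "\<dots> = \<alpha> * (chart_a ^ m * x) + \<beta> * (chart_b ^ n * x)" by (simp add: algebra_simps)
    also have "\<dots> \<in> H" by (rule ideal_onD(3)[OF H(1) ideal_onD(4)[OF H(1) s(1) m] ideal_onD(4)[OF H(1) s(2) n]])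
    finally show "x \<in> H" .
  qed (use F G in auto)
qed

lemma A_onto_L: "L_field \<rho> \<subseteq> to_L ` A_ring"
proof
  fix z assume "z \<in> L_field \<rho>"
  then obtain d where d: "d \<in> D_ring" "z = to_L d" using to_L_image by blast
  obtain m where m: "chart_b ^ m * d \<in> A_ring" using chart_b_power[OF d(1)] by blast
  have bD: "chart_b \<in> D_ring" using chart_in_A A_subset by blast
  have "to_L chart_b = 1"
    unfolding chart_b_def
    using to_L_facts(5)[OF u_v_in_D_ring(2) D_ring_gens(2)[of 0]] to_L_facts(1)[of series_v]
    by (simp add: to_L_facts(3) reduce_v v_el_def)
  then have "to_L (chart_b ^ m) = 1"
  proof (induction m)
    case (Suc m)
    then show ?case using to_L_facts(5)[OF bD subring_on_power[OF subring_on_D_ring bD, of m]] by simp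
  qed (simp add: to_L_1)
  then have "to_L (chart_b ^ m * d) = z"
    using to_L_facts(5)[OF subring_on_power[OF subring_on_D_ring bD, of m] d(1)] d(2) by simp
  then show "z \<in> to_L ` A_ring" using m by blast
qed

subsection \<open>Faithful flatness\<close>

text \<open>The coefficients of \<open>v\<^sup>s y\<close> with respect to the basis \<open>b\<^sub>k\<close>, provided that they exist in \<open>R\<close>. For \<open>y\<close> in
  \<open>D\<close> this is the case for all large \<open>s\<close>.\<close>

definition v_coeff :: "nat \<Rightarrow> ambient \<Rightarrow> nat \<Rightarrow> power_series_uv"
  where "v_coeff s y = (if \<exists>r. basis_rep (v_el ^ s * y) r then (THE r. basis_rep (v_el ^ s * y) r) else (\<lambda>_. 0))"

lemma v_coeff_eq: "basis_rep (v_el ^ s * y) r \<Longrightarrow> v_coeff s y = r"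
  unfolding v_coeff_def using basis_rep_unique by (auto intro!: the_equality)

lemma eventually_basis_rep:
  assumes "y \<in> D_ring"
  shows "\<forall>\<^sub>F s in sequentially. \<exists>r. basis_rep (v_el ^ s * y) r \<and> (\<forall>k>s. r k = 0)"
proof -
  obtain m r M where r: "basis_rep (v_el ^ m * y) r" "\<forall>k\<ge>M. r k = 0" using D_ring_rep[OF assms] by blast
  have "\<exists>r. basis_rep (v_el ^ s * y) r \<and> (\<forall>k>s. r k = 0)" if "s \<ge> max m M" for s
  proof -
    have "v_el ^ s = v_el ^ (s - m) * v_el ^ m" using that by (simp flip: power_add)
    then have eq: "v_el ^ s * y = const_of (series_v ^ (s - m)) * (v_el ^ m * y)"
      by (simp only: v_el_power[symmetric] mult.assoc)
    have "basis_rep (v_el ^ s * y) (\<lambda>k. series_v ^ (s - m) * r k)"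
      unfolding eq by (rule basis_rep_smult[OF r(1)])
    moreover have "\<forall>k>s. series_v ^ (s - m) * r k = 0" using r(2) that by auto
    ultimately show ?thesis by blast
  qed
  then show ?thesis unfolding eventually_sequentially by blast
qed

text \<open>For each \<open>s\<close> the two charts are glued: a polynomial of degree at most \<open>s\<close> whose multiple by \<open>v\<^sup>s\<close> is a
  combination of \<open>b\<^sub>0, \<dots>, b\<^sub>s\<close> is recovered from these two sets of coefficients by means of elements of
  \<open>A\<close>.\<close>

lemma glue_charts:
  "\<exists>e. (\<forall>j::nat. fst e j \<in> A_ring \<and> snd e j \<in> A_ring) \<and>
    (\<forall>y p q. y = (\<Sum>j\<le>s. p j * [:0, 1:] ^ j) \<longrightarrow> v_el ^ s * y = (\<Sum>k\<le>s. q k * basis_el k) \<longrightarrow>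
      y = (\<Sum>j\<le>s. p j * fst e j) + (\<Sum>k\<le>s. q k * snd e k))"
proof -
  have "\<forall>j. \<exists>m. \<forall>n\<ge>m. chart_a ^ n * [:0, 1:] ^ j \<in> A_ring"
    using chart_a_power subring_on_power[OF subring_on_R_X R_X_gens(2)] by blast
  then obtain ma where ma: "\<And>j n. n \<ge> ma j \<Longrightarrow> chart_a ^ n * [:0, 1:] ^ j \<in> A_ring" by metis
  have "\<forall>k. \<exists>m. \<forall>n\<ge>m. chart_b ^ n * (x_seq 0 ^ s * basis_el k) \<in> A_ring"
    using chart_b_power subring_on_mult[OF subring_on_D_ring subring_on_power[OF subring_on_D_ring D_ring_gens(2)] mixed_monomial_in_D]
    by blast
  then obtain mb where mb: "\<And>k n. n \<ge> mb k \<Longrightarrow> chart_b ^ n * (x_seq 0 ^ s * basis_el k) \<in> A_ring" by metis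
  define Ma Mb where "Ma = Max (ma ` {..s})" and "Mb = Max (mb ` {..s})"
  have M: "ma j \<le> Ma" "mb j \<le> Mb" if "j \<le> s" for j
    using that unfolding Ma_def Mb_def by (auto intro: Max_ge)
  obtain \<alpha> \<beta> where s: "\<alpha> \<in> A_ring" "\<beta> \<in> A_ring" "\<alpha> * chart_a ^ Ma + \<beta> * chart_b ^ (Mb + s) = 1"
    using comaximal_powers[OF subring_on_A_ring chart_in_A chart_sum] by blast
  define eX where "eX j = (if j \<le> s then \<alpha> * (chart_a ^ Ma * [:0, 1:] ^ j) else 0)" for j
  define eb where "eb k = (if k \<le> s then \<beta> * (chart_b ^ Mb * (x_seq 0 ^ s * basis_el k)) else 0)" for k
  show ?thesis
  proof (intro exI[of _ "(eX, eb)"] conjI allI impI, unfold fst_conv snd_conv)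
    show "eX j \<in> A_ring" for j
      using ma[OF M(1)] s subring_on_mult[OF subring_on_A_ring] subring_on_0[OF subring_on_A_ring] by (simp add: eX_def)
    show "eb j \<in> A_ring" for j
      using mb[OF M(2)] s subring_on_mult[OF subring_on_A_ring] subring_on_0[OF subring_on_A_ring] by (simp add: eb_def)
    fix y and p q :: "nat \<Rightarrow> ambient"
    assume y: "y = (\<Sum>j\<le>s. p j * [:0, 1:] ^ j)" "v_el ^ s * y = (\<Sum>k\<le>s. q k * basis_el k)"
    have X: "(\<Sum>j\<le>s. p j * eX j) = \<alpha> * chart_a ^ Ma * y"
      unfolding y(1) sum_distrib_left by (intro sum.cong) (auto simp: eX_def mult_ac)
    have "\<beta> * chart_b ^ (Mb + s) * y = \<beta> * chart_b ^ Mb * x_seq 0 ^ s * (v_el ^ s * y)"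
      by (simp add: chart_b_def power_add power_mult_distrib mult_ac)
    also have "\<dots> = (\<Sum>k\<le>s. q k * eb k)"
      unfolding y(2) sum_distrib_left by (intro sum.cong) (auto simp: eb_def mult_ac)
    finally have "(\<Sum>j\<le>s. p j * eX j) + (\<Sum>k\<le>s. q k * eb k) = (\<alpha> * chart_a ^ Ma + \<beta> * chart_b ^ (Mb + s)) * y"
      using X by (simp add: distrib_right)
    then show "y = (\<Sum>j\<le>s. p j * eX j) + (\<Sum>k\<le>s. q k * eb k)" by (simp add: s(3))
  qed
qed

text \<open>The functionals of the criterion are the coefficients of \<open>X\<^sup>j\<close> (index \<open>(False, j)\<close>) and of \<open>b\<^sub>k\<close> in \<open>v\<^sup>s y\<close>
  (index \<open>(True, k)\<close>); the retraction onto \<open>R\<close> is the value at \<open>X = 0\<close>.\<close>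

theorem faithfully_flat_A: "faithfully_flat T (ring_on R_ring) (module_on A_ring)"
proof -
  from choice[OF allI[OF glue_charts]] obtain e where
    e: "\<forall>s. (\<forall>j::nat. fst (e s) j \<in> A_ring \<and> snd (e s) j \<in> A_ring) \<and>
      (\<forall>y p q. y = (\<Sum>j\<le>s. p j * [:0, 1:] ^ j) \<longrightarrow> v_el ^ s * y = (\<Sum>k\<le>s. q k * basis_el k) \<longrightarrow>
        y = (\<Sum>j\<le>s. p j * fst (e s) j) + (\<Sum>k\<le>s. q k * snd (e s) k))"
    by (rule exE)
  have eA: "fst (e s) j \<in> A_ring" "snd (e s) j \<in> A_ring" for s j using e by blast+
  have glue: "y = (\<Sum>j\<le>s. p j * fst (e s) j) + (\<Sum>k\<le>s. q k * snd (e s) k)"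
    if "y = (\<Sum>j\<le>s. p j * [:0, 1:] ^ j)" "v_el ^ s * y = (\<Sum>k\<le>s. q k * basis_el k)" for s y p q
    using e that by blast
  define J where "J s = {False, True} \<times> {..s}" for s :: nat
  define E where "E s i = (if fst i then snd (e s) (snd i) else fst (e s) (snd i))" for s and i :: "bool \<times> nat"
  define \<phi> where "\<phi> s i y = (if fst i then const_of (v_coeff s y (snd i)) else [:Polynomial.coeff y (snd i):])"
    for s and i :: "bool \<times> nat" and y :: ambient
  have AD: "y \<in> D_ring" "y \<in> R_X" if "y \<in> A_ring" for y using that A_subset by auto
  show ?thesis
  proof (rule faithfully_flat_criterion[OF subring_on_R_ring subring_on_A_ring R_ring_subset_A_ring,
        of J E \<phi> "\<lambda>y. [:Polynomial.coeff y 0:]"])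
    show "finite (J s)" for s by (simp add: J_def)
    show "E s i \<in> A_ring" for s i by (simp add: E_def eA)
    show "\<phi> s i y \<in> R_ring" if "y \<in> A_ring" for s i y
      using R_X_coeff[OF AD(2)[OF that]] by (simp add: \<phi>_def R_ring_def)
    show "\<forall>\<^sub>F s in sequentially. \<forall>i\<in>J s. \<phi> s i (y + y') = \<phi> s i y + \<phi> s i y'"
      if y: "y \<in> A_ring" "y' \<in> A_ring" for y y'
      using eventually_basis_rep[OF AD(1)[OF y(1)]] eventually_basis_rep[OF AD(1)[OF y(2)]]
    proof eventually_elim
      case (elim s)
      then obtain r r' where r: "basis_rep (v_el ^ s * y) r" "basis_rep (v_el ^ s * y') r'" by blast
      have "v_coeff s (y + y') = (\<lambda>k. r k + r' k)"
        using basis_rep_add[OF r] by (intro v_coeff_eq) (simp add: distrib_left)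
      then show ?case using v_coeff_eq[OF r(1)] v_coeff_eq[OF r(2)] by (auto simp: \<phi>_def)
    qed
    show "\<forall>\<^sub>F s in sequentially. \<forall>i\<in>J s. \<phi> s i (r * y) = r * \<phi> s i y"
      if r: "r \<in> R_ring" and y: "y \<in> A_ring" for r y
    proof -
      obtain t where t: "r = const_of t" using r by (auto simp: R_ring_def)
      show ?thesis using eventually_basis_rep[OF AD(1)[OF y]]
      proof eventually_elim
        case (elim s)
        then obtain q where q: "basis_rep (v_el ^ s * y) q" by blast
        have "v_coeff s (r * y) = (\<lambda>k. t * q k)"
          using basis_rep_smult[OF q, of t] by (intro v_coeff_eq) (simp add: t mult.left_commute)
        moreover have "Polynomial.coeff (r * y) i = to_fract t * Polynomial.coeff y i" for i
          by (simp add: t const_of_def)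
        ultimately show ?case using v_coeff_eq[OF q] by (auto simp: \<phi>_def t) (simp_all add: const_of_def)
      qed
    qed
    show "\<forall>\<^sub>F s in sequentially. y = (\<Sum>i\<in>J s. \<phi> s i y * E s i)" if y: "y \<in> A_ring" for y
      using eventually_basis_rep[OF AD(1)[OF y]] eventually_ge_at_top[of "Polynomial.degree y"]
    proof eventually_elim
      case (elim s)
      then obtain r where r: "basis_rep (v_el ^ s * y) r" "\<forall>k>s. r k = 0" by blast
      have "y = (\<Sum>j\<le>s. Polynomial.monom (Polynomial.coeff y j) j)"
        using poly_as_sum_of_monoms'[OF elim(2)] by simp
      also have "\<dots> = (\<Sum>j\<le>s. [:Polynomial.coeff y j:] * [:0, 1:] ^ j)"
        by (intro sum.cong refl) (simp add: monom_altdef)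
      finally have 1: "y = (\<Sum>j\<le>s. [:Polynomial.coeff y j:] * [:0, 1:] ^ j)" .
      have "v_el ^ s * y = (\<Sum>k<Suc s. const_of (r k) * basis_el k)"
        using r(2) by (intro basis_rep_bound[OF r(1)]) auto
      then have 2: "v_el ^ s * y = (\<Sum>k\<le>s. const_of (r k) * basis_el k)" by (simp only: lessThan_Suc_atMost)
      have "(\<Sum>i\<in>J s. \<phi> s i y * E s i) =
          (\<Sum>j\<le>s. [:Polynomial.coeff y j:] * fst (e s) j) + (\<Sum>k\<le>s. const_of (r k) * snd (e s) k)"
      proof -
        have "(\<Sum>i\<in>J s. g i) = (\<Sum>b\<in>{False, True}. \<Sum>j\<le>s. g (b, j))" for g :: "bool \<times> nat \<Rightarrow> ambient"
          unfolding J_def sum.cartesian_product by (intro sum.cong refl) auto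
        then show ?thesis using v_coeff_eq[OF r(1)] by (simp add: \<phi>_def E_def)
      qed
      then show ?case using glue[OF 1 2] by simp
    qed
    show "[:Polynomial.coeff y 0:] \<in> R_ring" if "y \<in> A_ring" for y by (rule R_X_coeff[OF AD(2)[OF that]])
    show "[:Polynomial.coeff (r * y) 0:] = r * [:Polynomial.coeff y 0:]" if "r \<in> R_ring" for r y
      using that by (auto simp: R_ring_def const_of_def)
  qed (simp_all add: one_pCons)
qed

end

theorem mainTheorem4:
  fixes \<rho> :: "nat \<Rightarrow> complex fls alg_closure"
    and T :: "'n itself"
  assumes roots: "\<And>n. n > 0 \<Longrightarrow> \<rho> n ^ nth_prime n = to_ac fls_X"
  shows
    "D_inv_u = R_inv_u_X \<and>
     (ring_on D_ring Quot uD \<simeq> ring_on (L_field \<rho>) \<and>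
      \<not> fin_gen_algebra quot_map (ring_on R_ring Quot uR) (ring_on D_ring Quot uD)) \<and>
     (maximalideal uD (ring_on D_ring) \<and> uD \<inter> R_ring = uR \<and> prime_height (ring_on D_ring) uD = 1) \<and>
     (noetherian_ring (ring_on D_ring) \<and> factorial_domain (ring_on D_ring) \<and>
      \<not> fin_gen_algebra id (ring_on R_ring) (ring_on D_ring)) \<and>
     (noetherian_ring (ring_on A_ring) \<and> normal_domain A_ring \<and>
      faithfully_flat T (ring_on R_ring) (module_on A_ring) \<and>
      \<not> fin_gen_algebra id (ring_on R_ring) (ring_on A_ring))"
proof -
  interpret radical_system \<rho> by (unfold_locales) (rule roots)
  show ?thesis
  proof (intro conjI)
    show "\<not> fin_gen_algebra id (ring_on R_ring) (ring_on D_ring)"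
      using to_L_image by (intro not_fin_gen_over_R subring_on_D_ring R_ring_subset_D_ring) auto
    show "\<not> fin_gen_algebra id (ring_on R_ring) (ring_on A_ring)"
      using A_subset by (intro not_fin_gen_over_R subring_on_A_ring R_ring_subset_A_ring A_onto_L) auto
  qed (intro D_inv_u_eq D_quotient_iso quotient_not_fin_gen uD_maximal uD_Int_R uD_height
      noetherian_ring_on subring_on_D_ring noeth_on_D factorial_domain_ring_on ufd_on_D
      subring_on_A_ring noeth_on_A normal_domain_A faithfully_flat_A)+
qed

end
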